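(* Let $X$ be an irreducible affine variety over $\mathbb{C}$ of dimension $n$, and $\mathcal{F}$ an algebraic foliation on $X$. Let $p=\max_{x\in X}\dim V(\mathcal{F},x)$. Then there exists a dominant rational map $F:X\dashrightarrow Y$, where $Y$ is an irreducible variety of dimension $n-p$, such that for every very generic point $x$ of $X$, the Zariski closure of $F^{-1}(F(x))$ equals $V(\mathcal{F},x)$. In particular, the transcendence degree over $\mathbb{C}$ of the field $K_{\mathcal{F}}$ is $n-p$.
   Context: $\mathcal{O}_X$ denotes the ring of regular functions on $X$. An algebraic foliation $\mathcal{F}$ on $X$ is a collection of algebraic vector fields on $X$, viewed as $\mathbb{C}$-derivations of $\mathcal{O}_X$, which is stable under Lie bracket. For a Zariski closed subset $Y\subseteq X$ with vanishing ideal $I_Y$, $I(\mathcal{F},Y)$ denotes the largest ideal $I$ of $\mathcal{O}_X$ with $I\subseteq I_Y$ and $\partial(I)\subseteq I$ for all $\partial\in\mathcal{F}$; $V(\mathcal{F},Y)$ is its zero set, and $V(\mathcal{F},x):=V(\mathcal{F},\{x\})$. A rational first integral of $\mathcal{F}$ is a non-constant rational function $f$ on $X$ with $\partial(f)=0$ for all $\partial\in\mathcal{F}$; $K_{\mathcal{F}}$ is the field generated by $\mathbb{C}$ and the rational first integrals of $\mathcal{F}$. A property holds for every very generic point of $X$ if it holds at every point of some countable intersection of nonempty Zariski-open subsets of $X$. *)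

theory Defs
  imports Complex_Main
begin

inductive_set polyfun :: "(('a \<Rightarrow> complex) \<Rightarrow> complex) set" where
  pf_const: "(\<lambda>x. c) \<in> polyfun"
| pf_coord: "(\<lambda>x. x i) \<in> polyfun"
| pf_add: "f \<in> polyfun \<Longrightarrow> g \<in> polyfun \<Longrightarrow> (\<lambda>x. f x + g x) \<in> polyfun"
| pf_mult: "f \<in> polyfun \<Longrightarrow> g \<in> polyfun \<Longrightarrow> (\<lambda>x. f x * g x) \<in> polyfun"

definition zclosed :: "('a \<Rightarrow> complex) set \<Rightarrow> bool" where
  "zclosed S \<longleftrightarrow> (\<exists>P \<subseteq> polyfun. S = {x. \<forall>f\<in>P. f x = 0})"

definition zclosure :: "('a \<Rightarrow> complex) set \<Rightarrow> ('a \<Rightarrow> complex) set" where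
  "zclosure S = \<Inter>{C. zclosed C \<and> S \<subseteq> C}"

definition zirred :: "('a \<Rightarrow> complex) set \<Rightarrow> bool" where
  "zirred S \<longleftrightarrow> S \<noteq> {} \<and> zclosed S \<and>
     (\<forall>A B. zclosed A \<and> zclosed B \<and> S \<subseteq> A \<union> B \<longrightarrow> S \<subseteq> A \<or> S \<subseteq> B)"

definition zchain :: "('a \<Rightarrow> complex) set \<Rightarrow> nat \<Rightarrow> bool" where
  "zchain S k \<longleftrightarrow> (\<exists>Z :: nat \<Rightarrow> ('a \<Rightarrow> complex) set.
      (\<forall>i\<le>k. zirred (Z i) \<and> Z i \<subseteq> S) \<and> (\<forall>i<k. Z i \<subset> Z (Suc i)))"

definition zdim :: "('a \<Rightarrow> complex) set \<Rightarrow> nat" where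
  "zdim S = (GREATEST k. zchain S k)"

definition regfun :: "('a \<Rightarrow> complex) set \<Rightarrow> (('a \<Rightarrow> complex) \<Rightarrow> complex) set" where
  "regfun X = {f. \<exists>p\<in>polyfun. \<forall>x. f x = (if x \<in> X then p x else 0)}"

definition derivation :: "('a \<Rightarrow> complex) set \<Rightarrow>
    ((('a \<Rightarrow> complex) \<Rightarrow> complex) \<Rightarrow> (('a \<Rightarrow> complex) \<Rightarrow> complex)) \<Rightarrow> bool" where
  "derivation X D \<longleftrightarrow>
     (\<forall>f. f \<notin> regfun X \<longrightarrow> D f = (\<lambda>_. 0)) \<and>
     (\<forall>f\<in>regfun X. D f \<in> regfun X) \<and>
     (\<forall>f\<in>regfun X. \<forall>g\<in>regfun X. D (\<lambda>x. f x + g x) = (\<lambda>x. D f x + D g x)) \<and>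
     (\<forall>c. \<forall>f\<in>regfun X. D (\<lambda>x. c * f x) = (\<lambda>x. c * D f x)) \<and>
     (\<forall>f\<in>regfun X. \<forall>g\<in>regfun X. D (\<lambda>x. f x * g x) = (\<lambda>x. f x * D g x + g x * D f x))"

definition lie_bracket :: "('a \<Rightarrow> complex) set \<Rightarrow>
    ((('a \<Rightarrow> complex) \<Rightarrow> complex) \<Rightarrow> (('a \<Rightarrow> complex) \<Rightarrow> complex)) \<Rightarrow>
    ((('a \<Rightarrow> complex) \<Rightarrow> complex) \<Rightarrow> (('a \<Rightarrow> complex) \<Rightarrow> complex)) \<Rightarrow>
    ((('a \<Rightarrow> complex) \<Rightarrow> complex) \<Rightarrow> (('a \<Rightarrow> complex) \<Rightarrow> complex))" where
  "lie_bracket X D1 D2 = (\<lambda>f. if f \<in> regfun X then (\<lambda>x. D1 (D2 f) x - D2 (D1 f) x) else (\<lambda>_. 0))"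

definition foliation :: "('a \<Rightarrow> complex) set \<Rightarrow>
    ((('a \<Rightarrow> complex) \<Rightarrow> complex) \<Rightarrow> (('a \<Rightarrow> complex) \<Rightarrow> complex)) set \<Rightarrow> bool" where
  "foliation X Fs \<longleftrightarrow> (\<forall>D\<in>Fs. derivation X D) \<and> (\<forall>D1\<in>Fs. \<forall>D2\<in>Fs. lie_bracket X D1 D2 \<in> Fs)"

definition ideal_of :: "('a \<Rightarrow> complex) set \<Rightarrow> (('a \<Rightarrow> complex) \<Rightarrow> complex) set \<Rightarrow> bool" where
  "ideal_of X I \<longleftrightarrow> I \<subseteq> regfun X \<and> (\<lambda>_. 0) \<in> I \<and>
     (\<forall>f\<in>I. \<forall>g\<in>I. (\<lambda>x. f x + g x) \<in> I) \<and>
     (\<forall>f\<in>I. \<forall>g\<in>regfun X. (\<lambda>x. g x * f x) \<in> I)"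

definition vanishing_ideal :: "('a \<Rightarrow> complex) set \<Rightarrow> ('a \<Rightarrow> complex) set \<Rightarrow> (('a \<Rightarrow> complex) \<Rightarrow> complex) set" where
  "vanishing_ideal X Y = {f \<in> regfun X. \<forall>y\<in>Y. f y = 0}"

text \<open>\<open>I(F,Y)\<close>: the largest F-invariant ideal contained in \<open>I_Y\<close> (the union of all of them,
  which is itself such an ideal since the family is directed).\<close>
definition inv_ideal where
  "inv_ideal X Fs Y = \<Union>{I. ideal_of X I \<and> I \<subseteq> vanishing_ideal X Y \<and> (\<forall>D\<in>Fs. \<forall>f\<in>I. D f \<in> I)}"

definition Vset where
  "Vset X Fs Y = {x \<in> X. \<forall>f \<in> inv_ideal X Fs Y. f x = 0}"

definition very_generic :: "('a \<Rightarrow> complex) set \<Rightarrow> (('a \<Rightarrow> complex) \<Rightarrow> bool) \<Rightarrow> bool" where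
  "very_generic X P \<longleftrightarrow> (\<exists>C :: nat \<Rightarrow> ('a \<Rightarrow> complex) set.
      (\<forall>k. zclosed (C k) \<and> X - C k \<noteq> {}) \<and> (\<forall>x\<in>X. (\<forall>k. x \<notin> C k) \<longrightarrow> P x))"

text \<open>A rational function on irreducible \<open>X\<close> is represented by a pair (numerator, denominator)
  of regular functions with denominator not identically zero on \<open>X\<close>.\<close>
definition ratfun :: "('a \<Rightarrow> complex) set \<Rightarrow>
    (('a \<Rightarrow> complex) \<Rightarrow> complex) \<times> (('a \<Rightarrow> complex) \<Rightarrow> complex) \<Rightarrow> bool" where
  "ratfun X r \<longleftrightarrow> fst r \<in> regfun X \<and> snd r \<in> regfun X \<and> (\<exists>x\<in>X. snd r x \<noteq> 0)"

text \<open>Derivations act on \<open>a/b\<close> by the quotient rule; \<open>D(a/b)=0\<close> iff \<open>D a * b - a * D b = 0\<close>.\<close>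
definition first_integral where
  "first_integral X Fs r \<longleftrightarrow> ratfun X r \<and>
     \<not> (\<exists>c. \<forall>x\<in>X. fst r x = c * snd r x) \<and>
     (\<forall>D\<in>Fs. \<forall>x\<in>X. D (fst r) x * snd r x - fst r x * D (snd r) x = 0)"

inductive_set KF for X :: "('a \<Rightarrow> complex) set" and Fs where
  KF_const: "((\<lambda>x. if x \<in> X then c else 0), (\<lambda>x. if x \<in> X then 1 else 0)) \<in> KF X Fs"
| KF_fi: "first_integral X Fs r \<Longrightarrow> r \<in> KF X Fs"
| KF_add: "(a1, b1) \<in> KF X Fs \<Longrightarrow> (a2, b2) \<in> KF X Fs \<Longrightarrow>
     ((\<lambda>x. a1 x * b2 x + a2 x * b1 x), (\<lambda>x. b1 x * b2 x)) \<in> KF X Fs"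
| KF_mult: "(a1, b1) \<in> KF X Fs \<Longrightarrow> (a2, b2) \<in> KF X Fs \<Longrightarrow>
     ((\<lambda>x. a1 x * a2 x), (\<lambda>x. b1 x * b2 x)) \<in> KF X Fs"
| KF_neg: "(a, b) \<in> KF X Fs \<Longrightarrow> ((\<lambda>x. - a x), b) \<in> KF X Fs"
| KF_inv: "(a, b) \<in> KF X Fs \<Longrightarrow> (\<exists>x\<in>X. a x \<noteq> 0) \<Longrightarrow> (b, a) \<in> KF X Fs"

text \<open>Polynomials in \<open>k\<close> variables over C: finitely supported coefficient functions on exponent vectors.\<close>
definition mpoly :: "nat \<Rightarrow> ((nat \<Rightarrow> nat) \<Rightarrow> complex) \<Rightarrow> bool" where
  "mpoly k c \<longleftrightarrow> finite {e. c e \<noteq> 0} \<and> (\<forall>e. c e \<noteq> 0 \<longrightarrow> (\<forall>i\<ge>k. e i = 0))"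

definition mpoly_eval :: "((nat \<Rightarrow> nat) \<Rightarrow> complex) \<Rightarrow> nat \<Rightarrow> (nat \<Rightarrow> complex) \<Rightarrow> complex" where
  "mpoly_eval c k t = (\<Sum>e\<in>{e. c e \<noteq> 0}. c e * (\<Prod>i<k. t i ^ e i))"

text \<open>\<open>g 0, \<dots>, g (k-1)\<close> algebraically independent over C: no nonzero polynomial relation
  \<open>P(g)=0\<close> holds in the function field, i.e. \<open>P(g)\<close> is nonzero at some point of the common domain.\<close>
definition alg_indep where
  "alg_indep X k g \<longleftrightarrow> (\<forall>i<k. ratfun X (g i)) \<and>
     (\<forall>c. mpoly k c \<and> (\<exists>e. c e \<noteq> 0) \<longrightarrow>
        (\<exists>x\<in>X. (\<forall>i<k. snd (g i) x \<noteq> 0) \<and> mpoly_eval c k (\<lambda>i. fst (g i) x / snd (g i) x) \<noteq> 0))"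

definition has_trdeg where
  "has_trdeg X K d \<longleftrightarrow>
     (\<exists>g. (\<forall>i<d. g i \<in> K) \<and> alg_indep X d g) \<and>
     (\<forall>k g. (\<forall>i<k. g i \<in> K) \<and> alg_indep X k g \<longrightarrow> k \<le> d)"

end

theory Submission
  imports Defs "HOL-Library.Function_Algebras" "HOL-Library.FuncSet"
    "HOL-Analysis.Continuum_Not_Denumerable" "HOL-Computational_Algebra.Fundamental_Theorem_Algebra"
begin

text \<open>
  Write \<open>D\<^sub>w\<close> for the composition of a word \<open>w\<close> of derivations in \<open>Fs\<close>. The ideal \<open>I(F,x)\<close> consists of the
  regular functions \<open>f\<close> such that \<open>D\<^sub>w f\<close> vanishes at \<open>x\<close> for all \<open>w\<close>, and it is prime, so a polynomial
  \<open>\<Sum>c\<^sub>e m\<^sub>e\<close> vanishes on \<open>V(F,x)\<close> iff \<open>c\<close> lies in the kernel at \<open>x\<close> of the matrix \<open>(D\<^sub>w m\<^sub>e)\<close> with rows \<open>w\<close> and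
  columns the monomials \<open>m\<^sub>e\<close>. Over the function field, a kernel vector of this matrix of minimal support has all
  its ratios annihilated by the derivations, so the kernel is spanned by vectors of rational first integrals;
  at a point \<open>x\<close> outside countably many proper closed subsets these vectors, evaluated at \<open>x\<close>, also span the kernel at
  \<open>x\<close>. Hence \<open>V(F,x)\<close> is the zero set of the polynomials \<open>G\<^sub>v(x,z) = \<Sum>v\<^sub>e(x) m\<^sub>e(z)\<close>, and by Noetherianity for
  the pair \<open>(x,z)\<close> finitely many of these ratios suffice; they are the components of the map \<open>F\<close>.

  For the dimensions, a set of coordinates \<open>T\<close> with no kernel vector supported on monomials in \<open>T\<close> has at most \<open>p\<close>
  elements, since otherwise some \<open>V(F,x)\<close> would have larger dimension. If \<open>T\<close> is maximal, each remaining
  coordinate is algebraic over the first integrals and \<open>T\<close>, so there are at least \<open>n - p\<close> independent first integrals.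
  Conversely, coordinates independent on some \<open>V(F,x\<^sub>0)\<close> of dimension \<open>p\<close> stay independent over the first
  integrals, because a relation would give a nonzero kernel vector, which specialises to \<open>x\<^sub>0\<close>.

  Transcendence degree is handled by counting dimensions of filtered pieces of function algebras, and the
  Nullstellensatz needed is that of a polynomial ring in countably many variables over an uncountable field.
\<close>

text \<open>The matrix has infinitely many rows, and every finite set of monomials brings its own
  generic condition. The exceptional points therefore fill a countable union of proper closed sets,
  and only the uncountability of the complex numbers guarantees points outside it; the same fact
  drives the Nullstellensatz, which has to keep countably many functions nonzero at once. Function
  fields are never formed. A first integral is a pair of regular functions satisfying the
  cross-multiplied quotient rule, kernel vectors have entries in the ring, and elimination is
  fraction free. An algebra with inverted denominators is realised by actual functions on the whole
  type, precomposed with a retraction onto the open set where the denominators do not vanish, so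
  that equality on this set is equality of functions. This is why transcendence degree is handled by
  counting: the count only needs upper bounds for spans after multiplication by powers of one fixed
  nonzero function, and it yields both the existence of a basis and the bound on every independent
  family without any exchange argument in a field.\<close>

declare plus_fun_apply [simp del] times_fun_apply [simp del] zero_fun_apply [simp del] one_fun_apply [simp del]
  minus_apply [simp del] uminus_apply [simp del]

section \<open>Complex-valued functions as a vector space\<close>

lemmas fun_ops_apply = plus_fun_apply times_fun_apply zero_fun_apply one_fun_apply minus_apply uminus_apply

lemma sum_fun_apply: "(\<Sum>i\<in>A. f i) x = (\<Sum>i\<in>A. f i x)" for f :: "'i \<Rightarrow> 'b \<Rightarrow> complex"
  by (induction A rule: infinite_finite_induct) (auto simp: fun_ops_apply)

lemma prod_fun_apply: "(\<Prod>i\<in>A. f i) x = (\<Prod>i\<in>A. f i x)" for f :: "'i \<Rightarrow> 'b \<Rightarrow> complex"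
  by (induction A rule: infinite_finite_induct) (auto simp: fun_ops_apply)

lemma power_fun_apply: "(f ^ n) x = f x ^ n" for f :: "'b \<Rightarrow> complex"
  by (induction n) (auto simp: fun_ops_apply)

lemmas fun_apply = fun_ops_apply sum_fun_apply prod_fun_apply power_fun_apply

text \<open>A scalar acts as a constant function, so that the vector space structure is part of the
  ring structure and the library's \<open>span\<close> and \<open>dependent\<close> apply to sets of
  functions.\<close>

global_interpretation fs: vector_space "\<lambda>c (f :: 'b \<Rightarrow> complex). (\<lambda>_. c) * f"
  by standard (auto simp: fun_eq_iff fun_ops_apply algebra_simps)

text \<open>Multiplication by \<open>h\<close> is linear, so its effect on a span can be tested on
  generators.\<close>

lemma span_mult:
  assumes "\<And>g. g \<in> G \<Longrightarrow> h * g \<in> fs.span G'" and "w \<in> fs.span G"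
  shows "h * w \<in> fs.span G'"
  using assms(2)
proof (induction rule: fs.span_induct_alt)
  case base
  then show ?case by (simp add: fs.span_zero)
next
  case (step c x y)
  have "h * ((\<lambda>_. c) * x + y) = (\<lambda>_. c) * (h * x) + h * y" by (simp add: algebra_simps)
  then show ?case
    using step assms(1) by (metis (no_types) fs.span_add fs.span_scale)
qed

text \<open>The relation is indexed by \<open>E\<close> and not by the set of values, so two equal
  members of the family also have to produce one; hence the case distinction on injectivity.\<close>

lemma exists_linear_relation:
  assumes "finite E" "finite G" "card G < card E" "\<And>e. e \<in> E \<Longrightarrow> v e \<in> fs.span G"
  shows "\<exists>c. (\<exists>e\<in>E. c e \<noteq> 0) \<and> (\<Sum>e\<in>E. (\<lambda>_. c e) * v e) = (0 :: 'b \<Rightarrow> complex)"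
proof (cases "inj_on v E")
  case True
  have "fs.dependent (v ` E)"
  proof (rule ccontr)
    assume "\<not> ?thesis"
    with fs.independent_span_bound[OF \<open>finite G\<close>, of "v ` E"] assms
    have "card (v ` E) \<le> card G" by blast
    with assms(3) card_image[OF True] show False by simp
  qed
  then obtain t u where t: "finite t" "t \<subseteq> v ` E" "(\<Sum>w\<in>t. (\<lambda>_. u w) * w) = 0" "\<exists>w\<in>t. u w \<noteq> 0"
    unfolding fs.dependent_explicit by blast
  define c where "c e = (if v e \<in> t then u (v e) else 0)" for e
  have "(\<Sum>e\<in>E. (\<lambda>_. c e) * v e) = (\<Sum>w\<in>v ` E. (\<lambda>_. if w \<in> t then u w else 0) * w)"
    by (simp add: sum.reindex[OF True] c_def cong: if_cong)
  also have "\<dots> = (\<Sum>w\<in>t. (\<lambda>_. u w) * w)"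
    using t assms(1) by (intro sum.mono_neutral_cong_right) (auto simp: fun_eq_iff fun_ops_apply)
  finally have "(\<Sum>e\<in>E. (\<lambda>_. c e) * v e) = 0" using t by simp
  moreover have "\<exists>e\<in>E. c e \<noteq> 0" using t unfolding c_def by fastforce
  ultimately show ?thesis by blast
next
  case False
  then obtain e e' where e: "e \<in> E" "e' \<in> E" "e \<noteq> e'" "v e = v e'" by (auto simp: inj_on_def)
  define c where "c x = (if x = e then 1 else if x = e' then - 1 else (0::complex))" for x
  have "(\<Sum>x\<in>E. (\<lambda>_. c x) * v x) = (\<Sum>x\<in>{e, e'}. (\<lambda>_. c x) * v x)"
    using e assms(1) by (intro sum.mono_neutral_right) (auto simp: c_def fun_eq_iff fun_ops_apply)
  also have "\<dots> = 0" using e by (auto simp: c_def fun_eq_iff fun_ops_apply)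
  finally show ?thesis using e by (intro exI[of _ c]) (auto simp: c_def)
qed

section \<open>Subalgebras of function rings and their growth\<close>

inductive_set alg :: "('b \<Rightarrow> complex) set \<Rightarrow> ('b \<Rightarrow> complex) set" for Z where
  alg_const: "(\<lambda>_. c) \<in> alg Z"
| alg_gen: "z \<in> Z \<Longrightarrow> z \<in> alg Z"
| alg_add: "f \<in> alg Z \<Longrightarrow> g \<in> alg Z \<Longrightarrow> f + g \<in> alg Z"
| alg_mult: "f \<in> alg Z \<Longrightarrow> g \<in> alg Z \<Longrightarrow> f * g \<in> alg Z"

definition no_zero_divisors :: "('b \<Rightarrow> complex) set \<Rightarrow> bool" where
  "no_zero_divisors R \<longleftrightarrow> (\<forall>f\<in>R. \<forall>g\<in>R. f * g = 0 \<longrightarrow> f = 0 \<or> g = 0)"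

lemma alg_0: "0 \<in> alg Z" and alg_1: "1 \<in> alg Z"
  using alg_const[of 0 Z] alg_const[of 1 Z] by (simp_all add: zero_fun_def one_fun_def)

lemma alg_uminus: "f \<in> alg Z \<Longrightarrow> - f \<in> alg Z"
  using alg_mult[OF alg_const[of "- 1"], of f Z] by (simp add: times_fun_def fun_Compl_def)

lemma alg_diff: "f \<in> alg Z \<Longrightarrow> g \<in> alg Z \<Longrightarrow> f - g \<in> alg Z"
  using alg_add[OF _ alg_uminus, of f Z g] by simp

lemma alg_power: "f \<in> alg Z \<Longrightarrow> f ^ n \<in> alg Z"
  by (induction n) (auto intro: alg_1 alg_mult)

lemma alg_sum: "(\<And>i. i \<in> A \<Longrightarrow> f i \<in> alg Z) \<Longrightarrow> (\<Sum>i\<in>A. f i) \<in> alg Z"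
  by (induction A rule: infinite_finite_induct) (auto intro: alg_0 alg_add)

lemma alg_prod: "(\<And>i. i \<in> A \<Longrightarrow> f i \<in> alg Z) \<Longrightarrow> (\<Prod>i\<in>A. f i) \<in> alg Z"
  by (induction A rule: infinite_finite_induct) (auto intro: alg_1 alg_mult)

lemma alg_minimal:
  assumes "f \<in> alg Z" "Z \<subseteq> alg Z'"
  shows "f \<in> alg Z'"
  using assms(1) by induction (use assms(2) in \<open>auto intro: alg.intros\<close>)

lemma alg_mono: "Z \<subseteq> Z' \<Longrightarrow> alg Z \<subseteq> alg Z'"
  by (meson alg_minimal alg_gen subset_iff)

lemma no_zero_divisors_subset: "no_zero_divisors R \<Longrightarrow> S \<subseteq> R \<Longrightarrow> no_zero_divisors S"
  unfolding no_zero_divisors_def by blast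

lemma no_zero_divisors_power:
  assumes "no_zero_divisors (alg Z)" "f \<in> alg Z" "f \<noteq> 0"
  shows "f ^ n \<noteq> 0"
proof (induction n)
  case 0
  show ?case by simp
next
  case (Suc n)
  then show ?case using assms alg_power[of f Z n] unfolding no_zero_divisors_def by auto
qed

text \<open>A filtration by finite-dimensional spans together with a denominator \<open>s\<close>.
  Only \<open>s\<close> itself is required to move the filtration by a bounded amount; this models
  an algebra localised at \<open>s\<close> without forming fractions.\<close>

locale growth_filtration =
  fixes s :: "'b \<Rightarrow> complex" and G :: "nat \<Rightarrow> ('b \<Rightarrow> complex) set" and c0 :: nat
  assumes span_Suc: "fs.span (G e) \<subseteq> fs.span (G (Suc e))"
    and s_step: "w \<in> fs.span (G e) \<Longrightarrow> s * w \<in> fs.span (G (e + c0))"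
begin

lemma span_le: "e \<le> e' \<Longrightarrow> fs.span (G e) \<subseteq> fs.span (G e')"
  using lift_Suc_mono_le[of "\<lambda>e. fs.span (G e)"] span_Suc by blast

text \<open>After clearing the denominator \<open>s ^ D\<close>, multiplication by \<open>h\<close>
  raises the degree by at most \<open>C\<close>. The essential point is that \<open>D\<close> and
  \<open>C\<close> do not depend on \<open>e\<close>.\<close>

definition tame :: "nat \<Rightarrow> nat \<Rightarrow> ('b \<Rightarrow> complex) \<Rightarrow> bool" where
  "tame D C h \<longleftrightarrow> (\<forall>e. \<forall>w\<in>fs.span (G e). s ^ D * h * w \<in> fs.span (G (e + C)))"

lemma tameD: "tame D C h \<Longrightarrow> w \<in> fs.span (G e) \<Longrightarrow> s ^ D * h * w \<in> fs.span (G (e + C))"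
  unfolding tame_def by blast

lemma tame_mono: "tame D C h \<Longrightarrow> C \<le> C' \<Longrightarrow> tame D C' h"
  unfolding tame_def using span_le by (meson add_left_mono subsetD)

text \<open>Used to bring several functions to the same power of \<open>s\<close>; each extra factor
  costs \<open>c0\<close> degrees.\<close>

lemma tame_raise: "tame D C h \<Longrightarrow> tame (D + k) (C + k * c0) h"
proof (induction k)
  case (Suc k)
  show ?case unfolding tame_def
  proof (intro allI ballI)
    fix e w assume "w \<in> fs.span (G e)"
    from s_step[OF tameD[OF Suc.IH[OF Suc.prems] this]]
    show "s ^ (D + Suc k) * h * w \<in> fs.span (G (e + (C + Suc k * c0)))"
      by (simp add: algebra_simps)
  qed
qed simp

lemma tame_const: "tame 0 0 (\<lambda>_. c)"
  unfolding tame_def using fs.span_scale by auto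

lemma tame_mult:
  assumes "tame D1 C1 h1" "tame D2 C2 h2"
  shows "tame (D1 + D2) (C1 + C2) (h1 * h2)"
  unfolding tame_def
proof (intro allI ballI)
  fix e w assume "w \<in> fs.span (G e)"
  from tameD[OF assms(1) tameD[OF assms(2) this]]
  show "s ^ (D1 + D2) * (h1 * h2) * w \<in> fs.span (G (e + (C1 + C2)))"
    by (simp add: algebra_simps power_add)
qed

lemma tame_add_same:
  assumes "tame D C1 h1" "tame D C2 h2"
  shows "tame D (C1 + C2) (h1 + h2)"
  unfolding tame_def
proof (intro allI ballI)
  fix e w assume w: "w \<in> fs.span (G e)"
  have "s ^ D * h1 * w \<in> fs.span (G (e + (C1 + C2)))" "s ^ D * h2 * w \<in> fs.span (G (e + (C1 + C2)))"
    using tameD[OF assms(1) w] tameD[OF assms(2) w] span_le[of "e + C1" "e + (C1 + C2)"]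
      span_le[of "e + C2" "e + (C1 + C2)"] by auto
  from fs.span_add[OF this] show "s ^ D * (h1 + h2) * w \<in> fs.span (G (e + (C1 + C2)))"
    by (simp add: algebra_simps)
qed

lemma tame_add:
  assumes "tame D1 C1 h1" "tame D2 C2 h2"
  shows "tame (D1 + D2) (C1 + D2 * c0 + (C2 + D1 * c0)) (h1 + h2)"
  using tame_add_same[OF tame_raise[OF assms(1), of D2] tame_raise[OF assms(2), of D1, unfolded add.commute[of D2 D1]]] .

lemma tame_alg:
  assumes "f \<in> alg Z" "\<And>z. z \<in> Z \<Longrightarrow> \<exists>D C. tame D C z"
  shows "\<exists>D C. tame D C f"
  using assms(1)
proof induction
  case (alg_const c)
  show ?case using tame_const by blast
next
  case (alg_gen z)
  then show ?case using assms(2) by blast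
next
  case (alg_add f g)
  then show ?case using tame_add by blast
next
  case (alg_mult f g)
  then show ?case using tame_mult by blast
qed

lemma tame_power: "tame D C h \<Longrightarrow> tame (n * D) (n * C) (h ^ n)"
proof (induction n)
  case 0
  show ?case using tame_const[of 1] by (simp add: one_fun_def)
next
  case (Suc n)
  from tame_mult[OF Suc.prems Suc.IH[OF Suc.prems]] show ?case by simp
qed

lemma tame_uniform:
  assumes "finite A" "\<And>i. i \<in> A \<Longrightarrow> \<exists>D C. tame D C (h i)"
  shows "\<exists>D C. \<forall>i\<in>A. tame D C (h i)"
proof -
  from assms(2) obtain D C where DC: "\<And>i. i \<in> A \<Longrightarrow> tame (D i) (C i) (h i)" by metis
  define D' where "D' = (\<Sum>i\<in>A. D i)"
  define C' where "C' = (\<Sum>i\<in>A. C i + D' * c0)"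
  have "tame D' C' (h i)" if "i \<in> A" for i
  proof -
    have D: "D i \<le> D'" unfolding D'_def using assms(1) that by (intro member_le_sum) auto
    have "tame (D i + (D' - D i)) (C i + (D' - D i) * c0) (h i)" by (rule tame_raise[OF DC[OF that]])
    moreover have "C i + (D' - D i) * c0 \<le> C i + D' * c0" by simp
    moreover have "C i + D' * c0 \<le> C'" unfolding C'_def using assms(1) that by (intro member_le_sum[of _ _ "\<lambda>i. C i + D' * c0"]) auto
    ultimately show ?thesis using D tame_mono by (metis le_add_diff_inverse order_trans)
  qed
  then show ?thesis by blast
qed

end

text \<open>The algebra \<open>R\<close> behaves, up to inverting \<open>s\<close>, like a finite module over a polynomial ring in
  \<open>t\<close> variables: \<open>span (G e)\<close> plays the role of the part of degree at most \<open>e\<close>.\<close>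

definition growth :: "('b \<Rightarrow> complex) set \<Rightarrow> nat \<Rightarrow> bool" where
  "growth R t \<longleftrightarrow> (\<exists>s G c0 B. s \<in> R \<and> s \<noteq> 0 \<and> growth_filtration s G c0 \<and> 1 \<in> fs.span (G 0) \<and>
     (\<forall>e. finite (G e) \<and> card (G e) \<le> B * (e + 1) ^ t) \<and>
     (\<forall>h\<in>R. \<exists>D C. growth_filtration.tame s G D C h))"

lemma growth_constants: "growth (alg ({} :: ('b \<Rightarrow> complex) set)) 0"
proof -
  interpret growth_filtration "1 :: 'b \<Rightarrow> complex" "\<lambda>_. {1}" 0 by standard auto
  have "\<exists>D C. tame D C h" if "h \<in> alg {}" for h using tame_alg[OF that] by blast
  then show ?thesis unfolding growth_def
    by (intro exI[of _ 1] exI[of _ "\<lambda>_. {1}"] exI[of _ 0]) (auto intro: growth_filtration_axioms alg_1 fs.span_base)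
qed

text \<open>Degree at most \<open>e\<close> now allows powers of \<open>y\<close> up to
  \<open>e\<close>, which multiplies the number of generators by \<open>e + 1\<close>. Only this
  upper bound matters, so \<open>y\<close> may be any function.\<close>

lemma growth_adjoin:
  assumes "growth R t"
  shows "growth (alg (insert y R)) (Suc t)"
proof -
  from assms obtain s G c0 B where s: "s \<in> R" "s \<noteq> 0" "growth_filtration s G c0" "1 \<in> fs.span (G 0)"
    and G: "\<And>e. finite (G e)" "\<And>e. card (G e) \<le> B * (e + 1) ^ t"
    and R: "\<And>h. h \<in> R \<Longrightarrow> \<exists>D C. growth_filtration.tame s G D C h"
    unfolding growth_def by blast
  interpret growth_filtration s G c0 by fact
  define G' where "G' e = (\<lambda>(g, j). g * y ^ j) ` (G e \<times> {..e})" for e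
  have in_G': "w * y ^ j \<in> fs.span (G' e)" if "w \<in> fs.span (G e)" "j \<le> e" for w j e
  proof -
    have "y ^ j * w \<in> fs.span (G' e)"
      by (rule span_mult[OF _ that(1)])
        (use that(2) in \<open>auto simp: G'_def intro!: fs.span_base image_eqI[where x = "(_, _)"] mult.commute\<close>)
    then show ?thesis by (simp only: mult.commute[of w])
  qed
  have G'E: "h * w \<in> fs.span (G' e')" if "w \<in> fs.span (G' e)"
    "\<And>w j. w \<in> fs.span (G e) \<Longrightarrow> j \<le> e \<Longrightarrow> h * (w * y ^ j) \<in> fs.span (G' e')" for w e e' h
  proof (rule span_mult[OF _ that(1)])
    fix g assume "g \<in> G' e"
    then obtain g0 j where "g = g0 * y ^ j" "g0 \<in> G e" "j \<le> e" by (auto simp: G'_def)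
    then show "h * g \<in> fs.span (G' e')" by (simp add: that(2) fs.span_base)
  qed
  interpret G': growth_filtration s G' c0
  proof
    fix e show "fs.span (G' e) \<subseteq> fs.span (G' (Suc e))"
    proof
      fix w assume "w \<in> fs.span (G' e)"
      then have "1 * w \<in> fs.span (G' (Suc e))"
        by (rule G'E) (use in_G' span_Suc in fastforce)
      then show "w \<in> fs.span (G' (Suc e))" by simp
    qed
    fix w assume "w \<in> fs.span (G' e)"
    then show "s * w \<in> fs.span (G' (e + c0))"
    proof (rule G'E)
      fix w j assume "w \<in> fs.span (G e)" "j \<le> e"
      then show "s * (w * y ^ j) \<in> fs.span (G' (e + c0))"
        using in_G'[OF s_step, of w e j] by (simp add: mult.assoc)
    qed
  qed
  have "\<exists>D C. G'.tame D C h" if "h \<in> R" for h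
  proof -
    obtain D C where DC: "tame D C h" using R \<open>h \<in> R\<close> by blast
    have "G'.tame D C h" unfolding G'.tame_def
    proof (intro allI ballI)
      fix e w assume "w \<in> fs.span (G' e)"
      then show "s ^ D * h * w \<in> fs.span (G' (e + C))"
      proof (rule G'E)
        fix w j assume "w \<in> fs.span (G e)" "j \<le> e"
        then show "s ^ D * h * (w * y ^ j) \<in> fs.span (G' (e + C))"
          using in_G'[OF tameD[OF DC], of w e j] by (simp add: mult.assoc)
      qed
    qed
    then show ?thesis by blast
  qed
  moreover have "G'.tame 0 1 y" unfolding G'.tame_def
  proof (intro allI ballI)
    fix e w assume "w \<in> fs.span (G' e)"
    then show "s ^ 0 * y * w \<in> fs.span (G' (e + 1))"
    proof (rule G'E)
      fix w j assume "w \<in> fs.span (G e)" "j \<le> e"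
      then show "s ^ 0 * y * (w * y ^ j) \<in> fs.span (G' (e + 1))"
        using in_G'[of w "e + 1" "Suc j"] span_Suc[of e] by (auto simp: algebra_simps)
    qed
  qed
  ultimately have "\<exists>D C. G'.tame D C h" if "h \<in> insert y R" for h using that by blast
  then have "\<exists>D C. G'.tame D C h" if "h \<in> alg (insert y R)" for h using G'.tame_alg[OF that] by blast
  moreover have "finite (G' e)" for e using G by (simp add: G'_def)
  moreover have "card (G' e) \<le> B * (e + 1) ^ Suc t" for e
  proof -
    have "card (G' e) \<le> card (G e \<times> {..e})" unfolding G'_def by (rule card_image_le) (simp add: G)
    also have "\<dots> = card (G e) * (e + 1)" by (simp add: card_cartesian_product)
    also have "\<dots> \<le> B * (e + 1) ^ t * (e + 1)" using G(2)[of e] mult_le_mono1 by blast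
    finally show ?thesis by (simp add: algebra_simps)
  qed
  moreover have "1 \<in> fs.span (G' 0)" using in_G'[OF s(4), of 0] by simp
  moreover have "s \<in> alg (insert y R)" using s by (auto intro: alg_gen)
  ultimately show ?thesis unfolding growth_def using s G'.growth_filtration_axioms by blast
qed

definition algebraic_over :: "('b \<Rightarrow> complex) set \<Rightarrow> ('b \<Rightarrow> complex) \<Rightarrow> bool" where
  "algebraic_over R z \<longleftrightarrow> (\<exists>p m. (\<forall>l. p l \<in> R) \<and> (\<exists>l\<le>m. p l \<noteq> 0) \<and> (\<Sum>l\<le>m. p l * z ^ l) = 0)"

text \<open>If the relation has degree \<open>m\<close>, the powers of \<open>z\<close> below
  \<open>m\<close> suffice, which changes the count only by the factor \<open>m\<close>. The
  relation is not monic, so its leading coefficient has to be made part of the denominator.\<close>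

lemma growth_adjoin_algebraic:
  assumes gr: "growth (alg Z) t" and dom: "no_zero_divisors (alg Z)" and z: "algebraic_over (alg Z) z"
  shows "growth (alg (insert z (alg Z))) t"
proof -
  from gr obtain s G c0 B where s: "s \<in> alg Z" "s \<noteq> 0" "growth_filtration s G c0" "1 \<in> fs.span (G 0)"
    and G: "\<And>e. finite (G e)" "\<And>e. card (G e) \<le> B * (e + 1) ^ t"
    and R: "\<And>h. h \<in> alg Z \<Longrightarrow> \<exists>D C. growth_filtration.tame s G D C h"
    unfolding growth_def by blast
  interpret growth_filtration s G c0 by fact
  obtain p m0 where p: "\<And>l. p l \<in> alg Z" "\<exists>l\<le>m0. p l \<noteq> 0" "(\<Sum>l\<le>m0. p l * z ^ l) = 0"
    using z unfolding algebraic_over_def by blast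
  \<comment> \<open>The top index with a nonzero coefficient, so that \<open>p m\<close> may enter
    the denominator, which must be nonzero.\<close>
  define m where "m = Max {l. l \<le> m0 \<and> p l \<noteq> 0}"
  have m: "m \<le> m0" "p m \<noteq> 0" "\<And>l. l \<le> m0 \<Longrightarrow> m < l \<Longrightarrow> p l = 0"
    using Max_in[of "{l. l \<le> m0 \<and> p l \<noteq> 0}"] p(2) Max_ge[of "{l. l \<le> m0 \<and> p l \<noteq> 0}"]
    by (auto simp: m_def)
  have "(\<Sum>l\<le>m0. p l * z ^ l) = (\<Sum>l\<le>m. p l * z ^ l)"
    using m by (intro sum.mono_neutral_right) auto
  then have rel: "(\<Sum>l<m. p l * z ^ l) + p m * z ^ m = 0"
    using p(3) by (simp add: lessThan_Suc_atMost[symmetric])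
  obtain D0 Cq where q: "tame D0 Cq (p m)" using R p(1) by blast
  \<comment> \<open>\<open>p m\<close> moves the filtration by a bounded amount only after
    multiplication by \<open>s ^ D0\<close>; the product \<open>q\<close> does so by itself, with
    shift \<open>Cq\<close>. The new denominator \<open>s * q\<close> takes over the roles of both
    \<open>s\<close> and the leading coefficient.\<close>
  define q where "q = s ^ D0 * p m"
  define s' where "s' = s * q"
  have q_step: "q * w \<in> fs.span (G (e + Cq))" if "w \<in> fs.span (G e)" for w e
    using tameD[OF q that] by (simp add: q_def)
  have q_pow: "q ^ k * w \<in> fs.span (G (e + k * Cq))" if "w \<in> fs.span (G e)" for w e k
  proof (induction k)
    case (Suc k)
    from q_step[OF this] show ?case by (simp add: algebra_simps)
  qed (use that in simp)
  have s'_eq: "s' ^ k = q ^ k * s ^ k" for k by (simp add: s'_def power_mult_distrib mult.commute)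
  define G' where "G' e = (\<lambda>(g, j). g * z ^ j) ` (G e \<times> {..<m})" for e
  have in_G': "w * z ^ j \<in> fs.span (G' e)" if "w \<in> fs.span (G e)" "j < m" for w j e
  proof -
    have "z ^ j * w \<in> fs.span (G' e)"
      by (rule span_mult[OF _ that(1)])
        (use that(2) in \<open>auto simp: G'_def intro!: fs.span_base image_eqI[where x = "(_, _)"] mult.commute\<close>)
    then show ?thesis by (simp only: mult.commute[of w])
  qed
  have G'E: "h * w \<in> fs.span (G' e')" if "w \<in> fs.span (G' e)"
    "\<And>w j. w \<in> fs.span (G e) \<Longrightarrow> j < m \<Longrightarrow> h * (w * z ^ j) \<in> fs.span (G' e')" for w e e' h
  proof (rule span_mult[OF _ that(1)])
    fix g assume "g \<in> G' e"
    then obtain g0 j where "g = g0 * z ^ j" "g0 \<in> G e" "j < m" by (auto simp: G'_def)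
    then show "h * g \<in> fs.span (G' e')" by (simp add: that(2) fs.span_base)
  qed
  have m0: "m \<noteq> 0" using rel m(2) by auto
  interpret G': growth_filtration s' G' "c0 + Cq"
  proof
    fix e show "fs.span (G' e) \<subseteq> fs.span (G' (Suc e))"
    proof
      fix w assume "w \<in> fs.span (G' e)"
      then have "1 * w \<in> fs.span (G' (Suc e))"
        by (rule G'E) (use in_G' span_Suc in fastforce)
      then show "w \<in> fs.span (G' (Suc e))" by simp
    qed
    fix w assume "w \<in> fs.span (G' e)"
    then show "s' * w \<in> fs.span (G' (e + (c0 + Cq)))"
    proof (rule G'E)
      fix w j assume "w \<in> fs.span (G e)" "j < m"
      then show "s' * (w * z ^ j) \<in> fs.span (G' (e + (c0 + Cq)))"
        using in_G'[OF s_step[OF q_step], of w e j] by (simp add: mult.assoc s'_def add.assoc add.commute[of Cq])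
    qed
  qed
  have R': "s' ^ D * h * w \<in> fs.span (G (e + (C + D * Cq)))" if "tame D C h" "w \<in> fs.span (G e)" for D C h w e
    using q_pow[OF tameD[OF that], of D] by (simp add: s'_eq algebra_simps)
  have "\<exists>D C. G'.tame D C h" if "h \<in> alg Z" for h
  proof -
    obtain D C where DC: "tame D C h" using R \<open>h \<in> alg Z\<close> by blast
    have "G'.tame D (C + D * Cq) h" unfolding G'.tame_def
    proof (intro allI ballI)
      fix e w assume "w \<in> fs.span (G' e)"
      then show "s' ^ D * h * w \<in> fs.span (G' (e + (C + D * Cq)))"
      proof (rule G'E)
        fix w j assume "w \<in> fs.span (G e)" "j < m"
        then show "s' ^ D * h * (w * z ^ j) \<in> fs.span (G' (e + (C + D * Cq)))"
          using in_G'[OF R'[OF DC], of w e j] by (simp add: mult.assoc)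
      qed
    qed
    then show ?thesis by blast
  qed
  moreover have "\<exists>D C. G'.tame D C z"
  proof -
    obtain D C where DC: "\<And>l. l < m \<Longrightarrow> tame D C (p l)"
      using tame_uniform[of "{..<m}" p] R p(1) by blast
    \<comment> \<open>\<open>C + D * Cq\<close> is the cost of clearing the coefficients with
      \<open>s' ^ D\<close>, and \<open>Suc D0 * c0\<close> that of the factor
      \<open>s ^ Suc D0\<close> left over when \<open>p m\<close> is split off from one
      \<open>s'\<close>. \<open>Ct\<close> also covers the case in which the power of
      \<open>z\<close> just goes up by one.\<close>
    define C' where "C' = C + D * Cq + Suc D0 * c0"
    define Ct where "Ct = C' + Suc D * (c0 + Cq)"
    have s_pow: "s ^ k * w \<in> fs.span (G (e + k * c0))" if "w \<in> fs.span (G e)" for k w e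
      using tameD[OF tame_raise[OF tame_const[of 1], of k] that] by (simp add: one_fun_def[symmetric])
    have "G'.tame (Suc D) Ct z" unfolding G'.tame_def
    proof (intro allI ballI)
      fix e w assume "w \<in> fs.span (G' e)"
      then show "s' ^ Suc D * z * w \<in> fs.span (G' (e + Ct))"
      proof (rule G'E)
        fix w j assume w: "w \<in> fs.span (G e)" and j: "j < m"
        show "s' ^ Suc D * z * (w * z ^ j) \<in> fs.span (G' (e + Ct))"
        proof (cases "Suc j < m")
          case True
          have "s' ^ Suc D * (w * z ^ Suc j) \<in> fs.span (G' (e + Suc D * (c0 + Cq)))"
            using G'.tameD[OF G'.tame_raise[OF G'.tame_const[of 1], of "Suc D"] in_G'[OF w True]]
            by (simp add: one_fun_def[symmetric])
          moreover have "fs.span (G' (e + Suc D * (c0 + Cq))) \<subseteq> fs.span (G' (e + Ct))"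
            by (rule G'.span_le) (simp add: Ct_def)
          ultimately show ?thesis by (auto simp: algebra_simps)
        next
          case False
          then have "m = Suc j" using j by simp
          then have zm: "z ^ m = z * z ^ j" by simp
          have eq: "p m * z ^ m = - (\<Sum>l<m. p l * z ^ l)" using rel by (simp add: eq_neg_iff_add_eq_0 add.commute)
          \<comment> \<open>The exponent has reached \<open>m\<close>: one factor \<open>s'\<close>
            supplies \<open>p m\<close>, and the relation replaces \<open>p m * z ^ m\<close> by
            lower powers of \<open>z\<close>.\<close>
          have "s' ^ Suc D * z * (w * z ^ j) = s' ^ D * s ^ Suc D0 * w * (p m * z ^ m)"
            unfolding zm by (simp add: s'_def q_def algebra_simps)
          also have "\<dots> = - (\<Sum>l<m. (s ^ Suc D0 * (s' ^ D * p l * w)) * z ^ l)"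
            unfolding eq by (simp add: sum_distrib_left algebra_simps)
          also have "\<dots> \<in> fs.span (G' (e + C'))"
          proof (rule fs.span_neg, rule fs.span_sum)
            fix l assume "l \<in> {..<m}"
            then have l: "l < m" by simp
            from in_G'[OF s_pow[OF R'[OF DC[OF l] w], of "Suc D0"] l]
            show "s ^ Suc D0 * (s' ^ D * p l * w) * z ^ l \<in> fs.span (G' (e + C'))"
              by (simp only: C'_def add.assoc)
          qed
          also have "fs.span (G' (e + C')) \<subseteq> fs.span (G' (e + Ct))"
            by (rule G'.span_le) (simp add: Ct_def)
          finally show ?thesis .
        qed
      qed
    qed
    then show ?thesis by blast
  qed
  ultimately have "\<exists>D C. G'.tame D C h" if "h \<in> insert z (alg Z)" for h using that by blast
  then have "\<exists>D C. G'.tame D C h" if "h \<in> alg (insert z (alg Z))" for h using G'.tame_alg[OF that] by blast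
  moreover have "finite (G' e)" for e using G by (simp add: G'_def)
  moreover have "card (G' e) \<le> B * m * (e + 1) ^ t" for e
  proof -
    have "card (G' e) \<le> card (G e \<times> {..<m})" unfolding G'_def by (rule card_image_le) (simp add: G)
    also have "\<dots> = card (G e) * m" by (simp add: card_cartesian_product)
    also have "\<dots> \<le> B * (e + 1) ^ t * m" using G(2)[of e] mult_le_mono1 by blast
    finally show ?thesis by (simp add: algebra_simps)
  qed
  moreover have "1 \<in> fs.span (G' 0)" using in_G'[OF s(4), of 0] m0 by simp
  moreover have "s' \<in> alg (insert z (alg Z))"
    unfolding s'_def q_def using s p(1) by (auto intro!: alg_mult alg_power intro: alg_gen)
  moreover have "s' \<noteq> 0"
  proof -
    have "q \<noteq> 0" unfolding q_def
      using no_zero_divisors_power[OF dom s(1,2), of D0] dom alg_power[OF s(1), of D0] p(1) m(2)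
      unfolding no_zero_divisors_def by blast
    moreover have "q \<in> alg Z" unfolding q_def using s p(1) by (auto intro!: alg_mult alg_power)
    ultimately show ?thesis unfolding s'_def using dom s unfolding no_zero_divisors_def by blast
  qed
  ultimately show ?thesis unfolding growth_def using G'.growth_filtration_axioms by blast
qed

section \<open>Algebraic independence and transcendence bases\<close>

definition exps :: "'i set \<Rightarrow> ('i \<Rightarrow> nat) set" where
  "exps T = {e. \<forall>i. i \<notin> T \<longrightarrow> e i = 0}"

text \<open>Polynomials are coefficient families on finite sets of exponent vectors, and a relation
  is tested only at the points of \<open>V\<close>. Thus coordinates on a closed set and fractions
  on an open set are covered by one notion.\<close>

definition alg_independent_on :: "'b set \<Rightarrow> 'i set \<Rightarrow> ('i \<Rightarrow> 'b \<Rightarrow> complex) \<Rightarrow> bool" where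
  "alg_independent_on V T z \<longleftrightarrow>
     (\<forall>E c. finite E \<and> E \<subseteq> exps T \<and> (\<forall>x\<in>V. (\<Sum>e\<in>E. c e * (\<Prod>i\<in>T. z i x ^ e i)) = 0) \<longrightarrow>
        (\<forall>e\<in>E. c e = 0))"

lemma alg_independent_onD:
  "alg_independent_on V T z \<Longrightarrow> finite E \<Longrightarrow> E \<subseteq> exps T \<Longrightarrow>
   (\<And>x. x \<in> V \<Longrightarrow> (\<Sum>e\<in>E. c e * (\<Prod>i\<in>T. z i x ^ e i)) = 0) \<Longrightarrow> e \<in> E \<Longrightarrow> c e = 0"
  unfolding alg_independent_on_def by blast

lemma alg_independent_on_UNIV:
  "alg_independent_on UNIV T z \<longleftrightarrow> (\<forall>E c. finite E \<and> E \<subseteq> exps T \<and>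
     (\<Sum>e\<in>E. (\<lambda>_. c e) * (\<Prod>i\<in>T. z i ^ e i)) = 0 \<longrightarrow> (\<forall>e\<in>E. c e = 0))"
  unfolding alg_independent_on_def by (simp add: fun_eq_iff fun_apply)

lemma alg_independent_on_pullback:
  assumes "range \<phi> = V"
  shows "alg_independent_on UNIV T (\<lambda>i. z i \<circ> \<phi>) \<longleftrightarrow> alg_independent_on V T z"
  unfolding alg_independent_on_def assms[symmetric] by simp

lemma alg_independent_on_mono: "alg_independent_on V T z \<Longrightarrow> V \<subseteq> W \<Longrightarrow> alg_independent_on W T z"
  unfolding alg_independent_on_def by blast

lemma alg_independent_on_cong:
  assumes "\<And>i x. i \<in> T \<Longrightarrow> x \<in> V \<Longrightarrow> z i x = z' i x"
  shows "alg_independent_on V T z \<longleftrightarrow> alg_independent_on V T z'"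
  using assms unfolding alg_independent_on_def by (simp cong: sum.cong prod.cong ball_cong)

lemma alg_independent_on_subset:
  assumes "alg_independent_on V T z" "S \<subseteq> T" "finite T"
  shows "alg_independent_on V S z"
  unfolding alg_independent_on_def
proof (intro allI impI ballI)
  fix E c e
  assume E: "finite E \<and> E \<subseteq> exps S \<and> (\<forall>x\<in>V. (\<Sum>e\<in>E. c e * (\<Prod>i\<in>S. z i x ^ e i)) = 0)"
    and e: "e \<in> E"
  have "(\<Prod>i\<in>T. z i x ^ e i) = (\<Prod>i\<in>S. z i x ^ e i)" if "e \<in> E" for e x
    using E that assms(2,3) by (intro prod.mono_neutral_right) (auto simp: exps_def)
  then have "(\<Sum>e\<in>E. c e * (\<Prod>i\<in>T. z i x ^ e i)) = (\<Sum>e\<in>E. c e * (\<Prod>i\<in>S. z i x ^ e i))" for x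
    by (intro sum.cong) auto
  with E have "\<And>x. x \<in> V \<Longrightarrow> (\<Sum>e\<in>E. c e * (\<Prod>i\<in>T. z i x ^ e i)) = 0" by simp
  moreover have "E \<subseteq> exps T" using E assms(2) by (auto simp: exps_def)
  ultimately show "c e = 0" using alg_independent_onD[OF assms(1), of E c e] E e by blast
qed

lemma sum_regroup:
  fixes z :: "'i \<Rightarrow> 'a::comm_semiring_1"
  assumes "finite E" "finite T" "i \<notin> T" "\<And>e. e \<in> E \<Longrightarrow> e i \<le> m"
  shows "(\<Sum>e\<in>E. a e * (\<Prod>j\<in>insert i T. z j ^ e j)) =
    (\<Sum>l\<le>m. (\<Sum>e\<in>{e\<in>E. e i = l}. a e * (\<Prod>j\<in>T. z j ^ e j)) * z i ^ l)"
proof -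
  have "(\<Sum>e\<in>E. a e * (\<Prod>j\<in>insert i T. z j ^ e j)) =
    (\<Sum>l\<le>m. \<Sum>e\<in>{e\<in>E. e i = l}. a e * (\<Prod>j\<in>insert i T. z j ^ e j))"
    using assms by (intro sum.group[symmetric]) auto
  also have "\<dots> = (\<Sum>l\<le>m. (\<Sum>e\<in>{e\<in>E. e i = l}. a e * (\<Prod>j\<in>T. z j ^ e j)) * z i ^ l)"
    using assms by (intro sum.cong refl) (simp add: sum_distrib_right, intro sum.cong refl, simp add: mult_ac)
  finally show ?thesis .
qed

text \<open>Sorted by powers of \<open>z i\<close>, a relation becomes a polynomial in
  \<open>z i\<close> over \<open>alg Z\<close>. Transcendence makes each of its coefficients vanish,
  and each coefficient is a relation among the members of \<open>T\<close>.\<close>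

lemma alg_independent_insert:
  assumes ind: "alg_independent_on UNIV T z" and T: "finite T" "i \<notin> T"
    and Z: "\<And>j. j \<in> T \<Longrightarrow> z j \<in> alg Z" and na: "\<not> algebraic_over (alg Z) (z i)"
  shows "alg_independent_on UNIV (insert i T) z"
  unfolding alg_independent_on_UNIV
proof (intro allI impI ballI)
  fix E c e
  assume E: "finite E \<and> E \<subseteq> exps (insert i T) \<and>
    (\<Sum>e\<in>E. (\<lambda>_. c e) * (\<Prod>j\<in>insert i T. z j ^ e j)) = 0" and e: "e \<in> E"
  define m where "m = Max ((\<lambda>e. e i) ` E)"
  have m: "\<And>e. e \<in> E \<Longrightarrow> e i \<le> m" using E by (simp add: m_def)
  define p where "p l = (\<Sum>e\<in>{e\<in>E. e i = l}. (\<lambda>_. c e) * (\<Prod>j\<in>T. z j ^ e j))" for l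
  have "(\<Sum>l\<le>m. p l * z i ^ l) = 0"
    using sum_regroup[of E T i m "\<lambda>e _. c e" z] E T m unfolding p_def by simp
  moreover have "p l \<in> alg Z" for l
    unfolding p_def by (intro alg_sum alg_mult alg_const alg_prod alg_power Z)
  ultimately have "\<forall>l\<le>m. p l = 0" using na unfolding algebraic_over_def by blast
  then have p0: "p (e i) = 0" using m e by blast
  \<comment> \<open>The slice of exponents with the same \<open>i\<close>-th entry as
    \<open>e\<close>; setting this entry to 0 moves the slice into \<open>exps T\<close> and loses
    nothing, since the entry is constant on it.\<close>
  define E' where "E' = (\<lambda>e. e(i := 0)) ` {f\<in>E. f i = e i}"
  have inj: "inj_on (\<lambda>e. e(i := 0)) {f\<in>E. f i = e i}"
    by (rule inj_onI) (metis (mono_tags, lifting) fun_upd_triv fun_upd_upd mem_Collect_eq)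
  have "(\<Sum>f\<in>E'. (\<lambda>_. c (f(i := e i))) * (\<Prod>j\<in>T. z j ^ f j)) = p (e i)"
    unfolding E'_def p_def sum.reindex[OF inj] o_def
  proof (intro sum.cong refl)
    fix f assume "f \<in> {f\<in>E. f i = e i}"
    then have "f(i := 0, i := e i) = f" by (metis (mono_tags) fun_upd_triv fun_upd_upd mem_Collect_eq)
    moreover have "(\<Prod>j\<in>T. z j ^ (f(i := 0)) j) = (\<Prod>j\<in>T. z j ^ f j)"
      using T by (intro prod.cong) auto
    ultimately show "(\<lambda>_. c (f(i := 0, i := e i))) * (\<Prod>j\<in>T. z j ^ (f(i := 0)) j) = (\<lambda>_. c f) * (\<Prod>j\<in>T. z j ^ f j)"
      by simp
  qed
  moreover have "finite E'" "E' \<subseteq> exps T" using E T unfolding E'_def by (auto simp: exps_def)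
  ultimately have "\<forall>f\<in>E'. c (f(i := e i)) = 0"
    using ind p0 unfolding alg_independent_on_UNIV by (auto dest!: spec[of _ E'] spec[of _ "\<lambda>f. c (f(i := e i))"])
  then show "c e = 0" using e unfolding E'_def by auto
qed

lemma alg_independent_empty: "V \<noteq> {} \<Longrightarrow> alg_independent_on V {} z"
  unfolding alg_independent_on_def
proof (intro allI impI ballI)
  fix E c e
  assume "V \<noteq> {}" and E: "finite E \<and> E \<subseteq> exps {} \<and> (\<forall>x\<in>V. (\<Sum>e\<in>E. c e * (\<Prod>i\<in>{}. z i x ^ e i)) = 0)" "e \<in> E"
  have "exps {} = {e}" using E by (auto simp: exps_def fun_eq_iff subset_iff)
  then have "E = {e}" using E by auto
  then show "c e = 0" using E \<open>V \<noteq> {}\<close> by auto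
qed

lemma alg_alg_insert: "alg (insert y (alg Z)) = alg (insert y Z)"
proof
  have "insert y (alg Z) \<subseteq> alg (insert y Z)" using alg_mono[of Z "insert y Z"] by (auto intro: alg_gen)
  then show "alg (insert y (alg Z)) \<subseteq> alg (insert y Z)" using alg_minimal by blast
  show "alg (insert y Z) \<subseteq> alg (insert y (alg Z))" by (rule alg_mono) (auto intro: alg_gen)
qed

text \<open>Adjoin the generators one at a time: one that is transcendental over its predecessors
  joins \<open>T\<close> and raises the growth exponent by one, an algebraic one leaves both
  unchanged.\<close>

theorem growth_basis:
  assumes "finite S" "no_zero_divisors (alg (z ` S))"
  shows "\<exists>T\<subseteq>S. alg_independent_on UNIV T z \<and> growth (alg (z ` S)) (card T)"
  using assms
proof (induction S)
  case empty
  then show ?case using growth_constants by (auto intro: alg_independent_empty)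
next
  case (insert i S)
  have dom: "no_zero_divisors (alg (z ` S))"
    using insert.prems by (rule no_zero_divisors_subset) (rule alg_mono, auto)
  from insert.IH[OF dom] obtain T where T: "T \<subseteq> S" "alg_independent_on UNIV T z" "growth (alg (z ` S)) (card T)"
    by blast
  have fin: "finite T" "i \<notin> T" using T insert.hyps finite_subset by auto
  show ?case
  proof (cases "algebraic_over (alg (z ` S)) (z i)")
    case True
    from growth_adjoin_algebraic[OF T(3) dom True] show ?thesis using T
      by (intro exI[of _ T]) (auto simp: alg_alg_insert)
  next
    case False
    have "alg_independent_on UNIV (insert i T) z"
      by (rule alg_independent_insert[OF T(2) fin _ False]) (use T in \<open>auto intro: alg_gen\<close>)
    moreover have "growth (alg (z ` insert i S)) (card (insert i T))"
      using growth_adjoin[OF T(3), of "z i"] fin by (simp add: alg_alg_insert)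
    ultimately show ?thesis using T by (intro exI[of _ "insert i T"]) auto
  qed
qed

lemma card_box_exps:
  assumes "finite T"
  shows "finite {e \<in> exps T. \<forall>i. e i \<le> d} \<and> card {e \<in> exps T. \<forall>i. e i \<le> d} = (d + 1) ^ card T"
proof -
  define f where "f g i = (if i \<in> T then g i else 0)" for g :: "'a \<Rightarrow> nat" and i
  have inj: "inj_on f (PiE T (\<lambda>_. {..d}))"
  proof (rule inj_onI)
    fix g h assume gh: "g \<in> PiE T (\<lambda>_. {..d})" "h \<in> PiE T (\<lambda>_. {..d})" "f g = f h"
    show "g = h" 
    proof
      fix i show "g i = h i"
        using gh(1,2) fun_cong[OF gh(3), of i] by (cases "i \<in> T") (auto simp: f_def PiE_def extensional_def)
    qed
  qed
  have img: "f ` PiE T (\<lambda>_. {..d}) = {e \<in> exps T. \<forall>i. e i \<le> d}"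
  proof (intro subset_antisym subsetI)
    fix e assume "e \<in> {e \<in> exps T. \<forall>i. e i \<le> d}"
    then have "e = f (restrict e T)" "restrict e T \<in> PiE T (\<lambda>_. {..d})" by (auto simp: f_def exps_def fun_eq_iff)
    then show "e \<in> f ` PiE T (\<lambda>_. {..d})" by blast
  qed (auto simp: f_def exps_def PiE_iff)
  have "card (PiE T (\<lambda>_. {..d})) = (d + 1) ^ card T" using assms by (simp add: card_PiE)
  moreover have "finite (PiE T (\<lambda>_. {..d}))" using assms by (simp add: finite_PiE)
  ultimately show ?thesis using card_image[OF inj] img by (metis finite_imageI)
qed

text \<open>The monomials with all exponents at most \<open>d\<close> number
  \<open>(d + 1) ^ card T\<close>, while after multiplication by one power of \<open>s\<close> they
  all lie in a space whose dimension grows only like the power \<open>t\<close> of \<open>d\<close>.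
  For large \<open>d\<close> they are linearly dependent, and \<open>s\<close> cancels.\<close>

theorem growth_imp_dependent:
  assumes gr: "growth (alg Z) t" and dom: "no_zero_divisors (alg Z)"
    and T: "finite T" "t < card T" and z: "\<And>i. i \<in> T \<Longrightarrow> z i \<in> alg Z"
  shows "\<not> alg_independent_on UNIV T z"
proof
  assume ind: "alg_independent_on UNIV T z"
  from gr obtain s G c0 B where s: "s \<in> alg Z" "s \<noteq> 0" "growth_filtration s G c0" "1 \<in> fs.span (G 0)"
    and G: "\<And>e. finite (G e)" "\<And>e. card (G e) \<le> B * (e + 1) ^ t"
    and R: "\<And>h. h \<in> alg Z \<Longrightarrow> \<exists>D C. growth_filtration.tame s G D C h"
    unfolding growth_def by blast
  interpret growth_filtration s G c0 by fact
  obtain D C where DC: "\<And>i. i \<in> T \<Longrightarrow> tame D C (z i)"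
    using tame_uniform[OF T(1), of z] R z by blast
  \<comment> \<open>Each of the \<open>card T\<close> factors has exponent at most \<open>d\<close>
    and costs \<open>C\<close> degrees, plus \<open>D * c0\<close> for raising all monomials to the
    common denominator \<open>s ^ N\<close>; so \<open>K * d\<close> bounds the degree.\<close>
  define K where "K = card T * (C + D * c0)"
  \<comment> \<open>Chosen so that the dimension bound \<open>B * ((K + 1) * (d + 1)) ^ t\<close>
    becomes \<open>d * (d + 1) ^ t\<close>, which is just below
    \<open>(d + 1) ^ Suc t\<close>.\<close>
  define d where "d = B * (K + 1) ^ t"
  define E where "E = {e \<in> exps T. \<forall>i. e i \<le> d}"
  define N where "N = card T * d * D"
  have mon: "\<exists>D' C'. D' \<le> card S * d * D \<and> C' \<le> card S * d * C \<and> tame D' C' (\<Prod>i\<in>S. z i ^ e i)"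
    if "e \<in> E" "S \<subseteq> T" for e S
  proof -
    have "finite S" using that T finite_subset by blast
    then show ?thesis using that(2)
    proof (induction S)
      case empty
      then show ?case using tame_const[of 1] by (auto simp: one_fun_def)
    next
      case (insert i S)
      then obtain D' C' where DC': "D' \<le> card S * d * D" "C' \<le> card S * d * C" "tame D' C' (\<Prod>i\<in>S. z i ^ e i)" by blast
      have "tame (e i * D + D') (e i * C + C') (z i ^ e i * (\<Prod>i\<in>S. z i ^ e i))"
        by (rule tame_mult[OF tame_power[OF DC] DC'(3)]) (use insert in auto)
      then have t: "tame (e i * D + D') (e i * C + C') (\<Prod>i\<in>insert i S. z i ^ e i)" using insert.hyps by simp
      have le: "e i * D \<le> d * D" "e i * C \<le> d * C" using that(1) by (auto simp: E_def)
      have "e i * D + D' \<le> card (insert i S) * d * D" "e i * C + C' \<le> card (insert i S) * d * C"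
        using add_mono[OF le(1) DC'(1)] add_mono[OF le(2) DC'(2)] insert.hyps
        by (simp_all only: card_insert_disjoint mult_Suc add_mult_distrib not_False_eq_True)
      with t show ?case by blast
    qed
  qed
  have v: "s ^ N * (\<Prod>i\<in>T. z i ^ e i) \<in> fs.span (G (K * d))" if e: "e \<in> E" for e
  proof -
    obtain D' C' where DC': "D' \<le> N" "C' \<le> card T * d * C" "tame D' C' (\<Prod>i\<in>T. z i ^ e i)"
      using mon[OF e subset_refl] unfolding N_def by blast
    have le: "C' + (N - D') * c0 \<le> K * d"
    proof -
      have "(N - D') * c0 \<le> N * c0" by simp
      then have "C' + (N - D') * c0 \<le> card T * d * C + N * c0" using DC' by linarith
      also have "\<dots> = K * d" by (simp add: K_def N_def algebra_simps)
      finally show ?thesis .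
    qed
    have "tame (D' + (N - D')) (C' + (N - D') * c0) (\<Prod>i\<in>T. z i ^ e i)"
      by (rule tame_raise[OF DC'(3)])
    then have "tame N (K * d) (\<Prod>i\<in>T. z i ^ e i)" using tame_mono[OF _ le] DC'(1) by simp
    from tameD[OF this s(4)] show ?thesis by simp
  qed
  have fE: "finite E" and cE: "card E = (d + 1) ^ card T"
    using card_box_exps[OF T(1), of d] by (auto simp: E_def)
  have "card (G (K * d)) \<le> B * (K * d + 1) ^ t" using G(2) .
  also have "\<dots> \<le> B * ((K + 1) * (d + 1)) ^ t"
    by (intro mult_le_mono power_mono) (auto simp: algebra_simps)
  also have "\<dots> = d * (d + 1) ^ t" by (simp only: power_mult_distrib d_def[symmetric] mult.assoc[symmetric])
  also have "\<dots> < (d + 1) ^ Suc t" by simp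
  also have "\<dots> \<le> card E" unfolding cE using T(2) by (intro power_increasing) auto
  finally obtain c where c: "\<exists>e\<in>E. c e \<noteq> 0" "(\<Sum>e\<in>E. (\<lambda>_. c e) * (s ^ N * (\<Prod>i\<in>T. z i ^ e i))) = 0"
    using exists_linear_relation[OF fE G(1), of "K * d" "\<lambda>e. s ^ N * (\<Prod>i\<in>T. z i ^ e i)"] v by blast
  define P where "P = (\<Sum>e\<in>E. (\<lambda>_. c e) * (\<Prod>i\<in>T. z i ^ e i))"
  have "s ^ N * P = 0" using c(2) by (simp add: P_def sum_distrib_left mult_ac)
  moreover have "P \<in> alg Z" unfolding P_def by (intro alg_sum alg_mult alg_const alg_prod alg_power z)
  ultimately have "P = 0"
    using no_zero_divisors_power[OF dom s(1,2), of N] dom alg_power[OF s(1), of N] unfolding no_zero_divisors_def by blast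
  then show False using ind c(1) fE unfolding alg_independent_on_UNIV P_def E_def by blast
qed

section \<open>Countable Nullstellensatz\<close>

definition coord :: "'a \<Rightarrow> ('a \<Rightarrow> complex) \<Rightarrow> complex" where
  "coord i x = x i"

text \<open>Polynomial functions are the algebra generated by the coordinates; all closure
  properties and the growth theory carry over through this equation.\<close>

lemma polyfun_eq_alg: "(polyfun :: (('a \<Rightarrow> complex) \<Rightarrow> complex) set) = alg (range coord)"
proof (intro subset_antisym subsetI)
  fix f :: "('a \<Rightarrow> complex) \<Rightarrow> complex"
  assume "f \<in> polyfun"
  then show "f \<in> alg (range coord)"
  proof induction
    case (pf_coord i)
    have eq: "(\<lambda>x :: 'a \<Rightarrow> complex. x i) = coord i" by (simp add: coord_def fun_eq_iff)
    show ?case unfolding eq by (rule alg_gen) simp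
  next
    case (pf_add f g)
    then show ?case using alg_add[of f _ g] by (simp add: plus_fun_def)
  next
    case (pf_mult f g)
    then show ?case using alg_mult[of f _ g] by (simp add: times_fun_def)
  qed (rule alg_const)
next
  fix f :: "('a \<Rightarrow> complex) \<Rightarrow> complex"
  assume "f \<in> alg (range coord)"
  then show "f \<in> polyfun"
  proof induction
    case (alg_gen z)
    then obtain i where i: "z = coord i" by blast
    have "coord i = (\<lambda>x :: 'a \<Rightarrow> complex. x i)" by (simp add: coord_def fun_eq_iff)
    then show ?case unfolding i by (simp add: pf_coord)
  qed (auto simp: plus_fun_def times_fun_def intro: polyfun.intros)
qed

lemmas polyfun_const = alg_const[of _ "range coord", folded polyfun_eq_alg]
  and polyfun_0 = alg_0[of "range coord", folded polyfun_eq_alg]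
  and polyfun_1 = alg_1[of "range coord", folded polyfun_eq_alg]
  and polyfun_coord = alg_gen[of _ "range coord", folded polyfun_eq_alg, OF rangeI]
  and polyfun_add = alg_add[of _ "range coord", folded polyfun_eq_alg]
  and polyfun_diff = alg_diff[of _ "range coord", folded polyfun_eq_alg]
  and polyfun_uminus = alg_uminus[of _ "range coord", folded polyfun_eq_alg]
  and polyfun_mult = alg_mult[of _ "range coord", folded polyfun_eq_alg]
  and polyfun_power = alg_power[of _ "range coord", folded polyfun_eq_alg]
  and polyfun_sum = alg_sum[of _ _ "range coord", folded polyfun_eq_alg]
  and polyfun_prod = alg_prod[of _ _ "range coord", folded polyfun_eq_alg]

lemmas polyfun_closed = polyfun_const polyfun_0 polyfun_1 polyfun_coord polyfun_add polyfun_diff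
  polyfun_uminus polyfun_mult polyfun_power

lemma alg_coord_polyfun: "f \<in> alg (coord ` T) \<Longrightarrow> f \<in> polyfun"
  unfolding polyfun_eq_alg using alg_mono[of "coord ` T" "range coord"] by blast

lemma span_image_explicit:
  assumes "f \<in> fs.span (v ` J)"
  shows "\<exists>E c. finite E \<and> E \<subseteq> J \<and> f = (\<Sum>e\<in>E. (\<lambda>_. c e) * v e)"
proof -
  obtain t r where t: "finite t" "t \<subseteq> v ` J" "f = (\<Sum>w\<in>t. (\<lambda>_. r w) * w)"
    using assms unfolding fs.span_explicit by blast
  from t(2) obtain E where E: "E \<subseteq> J" "t = v ` E" "inj_on v E" by (meson subset_image_inj)
  have "f = (\<Sum>e\<in>E. (\<lambda>_. r (v e)) * v e)" using t(3) unfolding E(2) by (simp add: sum.reindex[OF E(3)])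
  moreover have "finite E" using t(1) E finite_image_iff by blast
  ultimately show ?thesis using E(1) by (intro exI[of _ E] exI[of _ "\<lambda>e. r (v e)"] conjI)
qed

definition poly_ideal :: "(('a \<Rightarrow> complex) \<Rightarrow> complex) set \<Rightarrow> bool" where
  "poly_ideal I \<longleftrightarrow> I \<subseteq> polyfun \<and> 0 \<in> I \<and> (\<forall>f\<in>I. \<forall>g\<in>I. f + g \<in> I) \<and> (\<forall>f\<in>I. \<forall>g\<in>polyfun. g * f \<in> I)"

definition prime_ideal :: "(('a \<Rightarrow> complex) \<Rightarrow> complex) set \<Rightarrow> bool" where
  "prime_ideal P \<longleftrightarrow> poly_ideal P \<and> 1 \<notin> P \<and>
     (\<forall>f\<in>polyfun. \<forall>g\<in>polyfun. f * g \<in> P \<longrightarrow> f \<in> P \<or> g \<in> P)"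

definition mult_closed :: "(('a \<Rightarrow> complex) \<Rightarrow> complex) set \<Rightarrow> bool" where
  "mult_closed M \<longleftrightarrow> M \<subseteq> polyfun \<and> 1 \<in> M \<and> (\<forall>f\<in>M. \<forall>g\<in>M. f * g \<in> M)"

lemma poly_idealD:
  assumes "poly_ideal I"
  shows "I \<subseteq> polyfun" "0 \<in> I" "f \<in> I \<Longrightarrow> g \<in> I \<Longrightarrow> f + g \<in> I" "f \<in> I \<Longrightarrow> h \<in> polyfun \<Longrightarrow> h * f \<in> I"
  using assms unfolding poly_ideal_def by auto

lemma poly_ideal_uminus: "poly_ideal I \<Longrightarrow> f \<in> I \<Longrightarrow> - f \<in> I"
  using poly_idealD(4)[of I f "- 1"] by (simp add: polyfun_closed)

lemma poly_ideal_diff: "poly_ideal I \<Longrightarrow> f \<in> I \<Longrightarrow> g \<in> I \<Longrightarrow> f - g \<in> I"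
  using poly_idealD(3)[of I f "- g"] poly_ideal_uminus[of I g] by simp

lemma poly_ideal_sum: "poly_ideal I \<Longrightarrow> (\<And>i. i \<in> A \<Longrightarrow> f i \<in> I) \<Longrightarrow> (\<Sum>i\<in>A. f i) \<in> I"
  by (induction A rule: infinite_finite_induct) (auto intro: poly_idealD)

definition adjoin_ideal :: "(('a \<Rightarrow> complex) \<Rightarrow> complex) set \<Rightarrow> (('a \<Rightarrow> complex) \<Rightarrow> complex) \<Rightarrow> (('a \<Rightarrow> complex) \<Rightarrow> complex) set" where
  "adjoin_ideal I y = {p + u * y | p u. p \<in> I \<and> u \<in> polyfun}"

lemma poly_ideal_adjoin:
  assumes I: "poly_ideal I" and y: "y \<in> polyfun"
  shows "poly_ideal (adjoin_ideal I y)" "I \<subseteq> adjoin_ideal I y" "y \<in> adjoin_ideal I y"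
proof -
  show "I \<subseteq> adjoin_ideal I y"
    unfolding adjoin_ideal_def using polyfun_0 by (force intro: exI[of _ 0])
  show "y \<in> adjoin_ideal I y"
    unfolding adjoin_ideal_def using polyfun_1 poly_idealD(2)[OF I] by (force intro: exI[of _ 0] exI[of _ 1])
  show "poly_ideal (adjoin_ideal I y)"
    unfolding poly_ideal_def
  proof (intro conjI ballI)
    show "adjoin_ideal I y \<subseteq> polyfun"
      unfolding adjoin_ideal_def using poly_idealD(1)[OF I] y by (auto intro: polyfun_closed)
    show "0 \<in> adjoin_ideal I y" using \<open>I \<subseteq> adjoin_ideal I y\<close> poly_idealD(2)[OF I] by blast
    fix f assume "f \<in> adjoin_ideal I y"
    then obtain p u where f: "f = p + u * y" "p \<in> I" "u \<in> polyfun" unfolding adjoin_ideal_def by blast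
    {
      fix g assume "g \<in> adjoin_ideal I y"
      then obtain q v where g: "g = q + v * y" "q \<in> I" "v \<in> polyfun" unfolding adjoin_ideal_def by blast
      have "f + g = (p + q) + (u + v) * y" using f g by (simp add: algebra_simps)
      then show "f + g \<in> adjoin_ideal I y"
        unfolding adjoin_ideal_def using f g poly_idealD(3)[OF I] polyfun_add by blast
    }
    fix h :: "('a \<Rightarrow> complex) \<Rightarrow> complex" assume h: "h \<in> polyfun"
    have "h * f = h * p + (h * u) * y" using f by (simp add: algebra_simps)
    then show "h * f \<in> adjoin_ideal I y"
      unfolding adjoin_ideal_def using f h poly_idealD(4)[OF I] polyfun_mult by blast
  qed
qed

text \<open>Zorn's lemma, and the usual argument that maximality among ideals missing a
  multiplicative set implies primality. Maximality is part of the conclusion because the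
  Nullstellensatz uses it once more.\<close>

lemma exists_maximal_disjoint_ideal:
  assumes I: "poly_ideal I" and M: "mult_closed M" and disj: "I \<inter> M = {}"
  shows "\<exists>P. prime_ideal P \<and> I \<subseteq> P \<and> P \<inter> M = {} \<and>
    (\<forall>J. poly_ideal J \<and> P \<subseteq> J \<and> J \<inter> M = {} \<longrightarrow> J = P)"
proof -
  define \<A> where "\<A> = {J. poly_ideal J \<and> I \<subseteq> J \<and> J \<inter> M = {}}"
  have "\<exists>P\<in>\<A>. \<forall>J\<in>\<A>. P \<subseteq> J \<longrightarrow> J = P"
  proof (rule subset_Zorn_nonempty)
    show "\<A> \<noteq> {}" using I disj unfolding \<A>_def by blast
    fix \<C> assume ne: "\<C> \<noteq> {}" and ch: "subset.chain \<A> \<C>"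
    then have C: "\<And>J. J \<in> \<C> \<Longrightarrow> poly_ideal J \<and> I \<subseteq> J \<and> J \<inter> M = {}"
      unfolding \<A>_def subset.chain_def by blast
    have "poly_ideal (\<Union>\<C>)" unfolding poly_ideal_def
    proof (intro conjI ballI)
      show "\<Union>\<C> \<subseteq> polyfun" using C poly_idealD(1) by blast
      show "0 \<in> \<Union>\<C>" using ne C poly_idealD(2) by blast
      fix f assume f: "f \<in> \<Union>\<C>"
      then show "g * f \<in> \<Union>\<C>" if "g \<in> polyfun" for g using that C poly_idealD(4) by blast
      fix g assume g: "g \<in> \<Union>\<C>"
      from f g obtain J K where "J \<in> \<C>" "K \<in> \<C>" "f \<in> J" "g \<in> K" by blast
      moreover have "J \<subseteq> K \<or> K \<subseteq> J" using ch \<open>J \<in> \<C>\<close> \<open>K \<in> \<C>\<close> unfolding subset.chain_def by blast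
      ultimately show "f + g \<in> \<Union>\<C>" using C poly_idealD(3) by blast
    qed
    then show "\<Union>\<C> \<in> \<A>" using ne C unfolding \<A>_def by blast
  qed
  then obtain P where PA: "P \<in> \<A>" and mx: "\<forall>J\<in>\<A>. P \<subseteq> J \<longrightarrow> J = P" by (elim bexE)
  have P: "poly_ideal P" "I \<subseteq> P" "P \<inter> M = {}" using PA by (simp_all add: \<A>_def)
  have max: "J = P" if "poly_ideal J" "P \<subseteq> J" "J \<inter> M = {}" for J
    using mx that P(2) unfolding \<A>_def by simp
  have hit: "\<exists>h\<in>M. h \<in> adjoin_ideal P f" if "f \<in> polyfun" "f \<notin> P" for f
    using max[OF poly_ideal_adjoin(1,2)[OF P(1) that(1)]] poly_ideal_adjoin(3)[OF P(1) that(1)] that by blast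
  have "prime_ideal P" unfolding prime_ideal_def
  proof (intro conjI ballI impI)
    show "1 \<notin> P" using P(3) M unfolding mult_closed_def by blast
    fix f g :: "('a \<Rightarrow> complex) \<Rightarrow> complex"
    assume fg: "f \<in> polyfun" "g \<in> polyfun" "f * g \<in> P"
    show "f \<in> P \<or> g \<in> P"
    proof (rule ccontr)
      assume "\<not> ?thesis"
      with hit fg obtain h k where hk: "h \<in> M" "k \<in> M" "h \<in> adjoin_ideal P f" "k \<in> adjoin_ideal P g" by blast
      then obtain p u q v where "h = p + u * f" "p \<in> P" "u \<in> polyfun" "k = q + v * g" "q \<in> P" "v \<in> polyfun"
        unfolding adjoin_ideal_def by blast
      then have "h * k = (q + v * g) * p + (u * f) * q + (u * v) * (f * g)"
        by (simp add: algebra_simps)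
      moreover have "(q + v * g) * p \<in> P"
        using \<open>p \<in> P\<close> \<open>q \<in> P\<close> \<open>v \<in> polyfun\<close> fg(2) poly_idealD(1)[OF P(1)]
        by (intro poly_idealD(4)[OF P(1)] polyfun_add polyfun_mult) auto
      moreover have "(u * f) * q \<in> P"
        using \<open>q \<in> P\<close> \<open>u \<in> polyfun\<close> fg(1) by (intro poly_idealD(4)[OF P(1)] polyfun_mult)
      moreover have "(u * v) * (f * g) \<in> P"
        using \<open>v \<in> polyfun\<close> \<open>u \<in> polyfun\<close> fg(3) by (rule_tac poly_idealD(4)[OF P(1)]) (auto intro: polyfun_mult)
      ultimately have "h * k \<in> P" using poly_idealD(3)[OF P(1)] by metis
      moreover have "h * k \<in> M" using hk M unfolding mult_closed_def by blast
      ultimately show False using P(3) by blast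
    qed
  qed (rule P(1))
  then show ?thesis
    using P by (intro exI[of _ P] conjI allI impI) (simp_all add: max)
qed

text \<open>Monomials are indexed by lists of variables: over a countable type of variables there
  are countably many lists, whereas arbitrary exponent functions on an infinite type would be
  uncountably many.\<close>

definition mon :: "'a list \<Rightarrow> ('a \<Rightarrow> complex) \<Rightarrow> complex" where
  "mon xs = prod_list (map coord xs)"

lemma polyfun_span_mon: "f \<in> polyfun \<Longrightarrow> f \<in> fs.span (range mon)"
  unfolding polyfun_eq_alg
proof (induction rule: alg.induct)
  case (alg_const c)
  have "(\<lambda>_. c) * mon [] \<in> fs.span (range mon)" by (intro fs.span_scale fs.span_base) simp
  then show ?case by (simp add: mon_def)
next
  case (alg_gen z)
  then obtain i where "z = mon [i]" by (auto simp: mon_def)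
  then show ?case by (simp add: fs.span_base)
next
  case (alg_add f g)
  then show ?case by (intro fs.span_add)
next
  case (alg_mult f g)
  show ?case
  proof (rule span_mult[OF _ alg_mult.IH(2)])
    fix g' :: "('a \<Rightarrow> complex) \<Rightarrow> complex" assume "g' \<in> range mon"
    then obtain ys where g': "g' = mon ys" by blast
    have "g' * f \<in> fs.span (range mon)"
    proof (rule span_mult[OF _ alg_mult.IH(1)])
      fix f' :: "('a \<Rightarrow> complex) \<Rightarrow> complex" assume "f' \<in> range mon"
      then obtain xs where "f' = mon xs" by blast
      then have "g' * f' = mon (ys @ xs)" using g' by (simp add: mon_def)
      then show "g' * f' \<in> fs.span (range mon)" by (simp add: fs.span_base)
    qed
    then show "f * g' \<in> fs.span (range mon)" by (simp only: mult.commute)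
  qed
qed

text \<open>The key use of the uncountability of \<open>\<complex>\<close>: polynomial functions have countable dimension,
  while \<open>c\<close> ranges over an uncountable set, so infinitely many of the \<open>u c\<close> lie in one
  finite-dimensional space and share the same \<open>h c\<close>.\<close>
lemma uncountable_relation:
  fixes P :: "(('a::countable \<Rightarrow> complex) \<Rightarrow> complex) set"
  assumes P: "prime_ideal P" and y: "y \<in> polyfun" and M: "countable M" "M \<inter> P = {}" "M \<subseteq> polyfun"
    and u: "\<And>c. u c \<in> polyfun" and h: "\<And>c. h c \<in> M" and g: "\<And>c. g c \<in> polyfun"
    and rel: "\<And>c. g c * h c - (y - (\<lambda>_. c)) * u c \<in> P"
  shows "\<exists>A r. finite A \<and> (\<exists>c\<in>A. r c \<noteq> 0) \<and>
    (\<Sum>c\<in>A. (\<lambda>_. r c) * g c * (\<Prod>j\<in>A - {c}. y - (\<lambda>_. j))) \<in> P"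
proof -
  have I: "poly_ideal P" using P unfolding prime_ideal_def by blast
  have "\<exists>L. finite L \<and> u c \<in> fs.span (mon ` L)" for c
  proof -
    obtain E r where "finite E" "u c = (\<Sum>e\<in>E. (\<lambda>_. r e) * mon e)"
      using span_image_explicit[OF polyfun_span_mon[OF u[of c]]] by blast
    then show ?thesis by (intro exI[of _ E]) (simp, intro fs.span_sum fs.span_scale fs.span_base, simp)
  qed
  then obtain L where L: "\<And>c. finite (L c)" "\<And>c. u c \<in> fs.span (mon ` L c)" by metis
  \<comment> \<open>Everything that has to be constant along an infinite set of values
    \<open>c\<close>: the multiplier \<open>h c\<close> and a finite set of monomials spanning
    \<open>u c\<close>. It takes only countably many values.\<close>
  define \<kappa> where "\<kappa> c = (h c, L c)" for c
  have "countable (range \<kappa>)"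
  proof (rule countable_subset)
    show "range \<kappa> \<subseteq> M \<times> {L. finite L}" using h L by (auto simp: \<kappa>_def)
    show "countable (M \<times> {L :: 'a list set. finite L})" using M(1) countable_Collect_finite by blast
  qed
  have "\<exists>k. infinite (\<kappa> -` {k})"
  proof (rule ccontr)
    assume "\<nexists>k. infinite (\<kappa> -` {k})"
    then have "countable (\<Union>k\<in>range \<kappa>. \<kappa> -` {k})"
      using \<open>countable (range \<kappa>)\<close> by (intro countable_UN) (auto intro: countable_finite)
    moreover have "(\<Union>k\<in>range \<kappa>. \<kappa> -` {k}) = UNIV" by auto
    ultimately show False using uncountable_UNIV_complex by simp
  qed
  then obtain h0 L0 where inf: "infinite (\<kappa> -` {(h0, L0)})" by auto
  then obtain c0 where "\<kappa> c0 = (h0, L0)" by (metis finite.emptyI ex_in_conv vimage_singleton_eq)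
  then have h0: "h0 \<in> M" "finite L0" using h[of c0] L(1)[of c0] by (auto simp: \<kappa>_def)
  \<comment> \<open>One more value of \<open>c\<close> than the dimension of the common span forces
    a linear relation among the \<open>u c\<close>.\<close>
  obtain A where A: "finite A" "card A = Suc (card (mon ` L0))" "A \<subseteq> \<kappa> -` {(h0, L0)}"
    using infinite_arbitrarily_large[OF inf] by blast
  have A': "h c = h0" "u c \<in> fs.span (mon ` L0)" if "c \<in> A" for c
    using A(3) that L(2)[of c] by (auto simp: \<kappa>_def)
  obtain r where r: "\<exists>c\<in>A. r c \<noteq> 0" "(\<Sum>c\<in>A. (\<lambda>_. r c) * u c) = 0"
    using exists_linear_relation[of A "mon ` L0" u] A A'(2) h0(2) by auto
  define W where "W c = (\<Prod>j\<in>A - {c}. y - (\<lambda>_. j))" for c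
  define S where "S = (\<Sum>c\<in>A. (\<lambda>_. r c) * g c * W c)"
  have W: "W c \<in> polyfun" for c unfolding W_def using y by (intro polyfun_prod polyfun_closed)
  have S: "S \<in> polyfun" unfolding S_def using W g by (intro polyfun_sum polyfun_closed)
  have full: "(\<Prod>j\<in>A. y - (\<lambda>_. j)) = (y - (\<lambda>_. c)) * W c" if "c \<in> A" for c
    unfolding W_def using A(1) that by (simp add: prod.remove)
  \<comment> \<open>Modulo \<open>P\<close>, \<open>g c * h0\<close> may be replaced by
    \<open>y - c\<close> times \<open>u c\<close>. This completes \<open>W c\<close> to the full
    product, which then factors out of the sum and leaves the vanishing combination of the
    \<open>u c\<close>. Finally \<open>h0\<close> is cancelled, as it lies outside the prime
    \<open>P\<close>.\<close>
  have "h0 * S = (\<Sum>c\<in>A. ((\<lambda>_. r c) * W c) * (g c * h c - (y - (\<lambda>_. c)) * u c))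
      + (\<Sum>c\<in>A. (\<lambda>_. r c) * (((y - (\<lambda>_. c)) * W c) * u c))"
    unfolding S_def sum.distrib[symmetric] sum_distrib_left
    by (intro sum.cong refl) (simp add: A' algebra_simps)
  also have "(\<Sum>c\<in>A. (\<lambda>_. r c) * (((y - (\<lambda>_. c)) * W c) * u c)) = (\<Prod>j\<in>A. y - (\<lambda>_. j)) * (\<Sum>c\<in>A. (\<lambda>_. r c) * u c)"
    unfolding sum_distrib_left by (intro sum.cong refl) (simp add: full algebra_simps)
  finally have "h0 * S = (\<Sum>c\<in>A. ((\<lambda>_. r c) * W c) * (g c * h c - (y - (\<lambda>_. c)) * u c))"
    using r(2) by simp
  also have "\<dots> \<in> P"
    using W by (intro poly_ideal_sum[OF I] poly_idealD(4)[OF I] rel polyfun_closed)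
  finally have "S \<in> P" using P S h0(1) M unfolding prime_ideal_def by blast
  then show ?thesis using A(1) r(1) unfolding S_def W_def by blast
qed

text \<open>Over the complex numbers the polynomial splits into linear factors, and the prime ideal
  must contain one of them; a nonzero constant is impossible because \<open>P\<close> is
  proper.\<close>

lemma prime_ideal_root:
  assumes P: "prime_ideal P" and y: "y \<in> polyfun"
  shows "p \<noteq> 0 \<Longrightarrow> (\<lambda>x. poly p (y x)) \<in> P \<Longrightarrow> \<exists>r. y - (\<lambda>_. r) \<in> P"
proof (induction "degree p" arbitrary: p)
  case 0
  then obtain c where c: "p = [:c:]" "c \<noteq> 0" by (metis degree_eq_zeroE pCons_eq_0_iff)
  have "(\<lambda>_. inverse c) * (\<lambda>x. poly p (y x)) \<in> P"
    using P 0 unfolding prime_ideal_def by (intro poly_idealD(4)) (auto intro: polyfun_closed)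
  moreover have "(\<lambda>_. inverse c) * (\<lambda>x. poly p (y x)) = 1" using c by (simp add: fun_eq_iff fun_apply)
  ultimately show ?case using P unfolding prime_ideal_def by simp
next
  case (Suc d)
  have "\<not> constant (poly p)" using Suc.hyps(2) by (simp add: constant_degree)
  then obtain r where "poly p r = 0" using fundamental_theorem_of_algebra by blast
  then obtain q where q: "p = [:- r, 1:] * q" by (metis dvdE poly_eq_0_iff_dvd)
  have q0: "q \<noteq> 0" using Suc.prems(1) q by auto
  have "degree p = Suc (degree q)" unfolding q using q0 by (subst degree_mult_eq) auto
  then have deg: "d = degree q" using Suc.hyps(2) by simp
  have pf: "(\<lambda>x. poly q (y x)) \<in> polyfun" for q
  proof (induction q)
    case 0
    then show ?case using polyfun_const[of 0] by simp
  next
    case (pCons a q)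
    have "(\<lambda>x. poly (pCons a q) (y x)) = (\<lambda>_. a) + y * (\<lambda>x. poly q (y x))" by (simp add: fun_eq_iff fun_apply)
    then show ?case using pCons y by (simp only:) (intro polyfun_closed)
  qed
  have "(y - (\<lambda>_. r)) * (\<lambda>x. poly q (y x)) = (\<lambda>x. poly p (y x))" by (simp add: q fun_eq_iff fun_apply algebra_simps)
  then have "y - (\<lambda>_. r) \<in> P \<or> (\<lambda>x. poly q (y x)) \<in> P"
    using P Suc.prems(2) y pf unfolding prime_ideal_def by (metis polyfun_const polyfun_diff)
  then show ?case using Suc.hyps(1)[OF deg q0] by blast
qed

text \<open>Take \<open>P\<close> maximal among the ideals that contain \<open>I\<close> and miss
  \<open>M\<close>. If some \<open>y\<close> had no value modulo \<open>P\<close>, every ideal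
  generated by \<open>P\<close> and \<open>y - c\<close> would meet \<open>M\<close>, and
  \<open>uncountable_relation\<close> would give a polynomial equation for \<open>y\<close> modulo
  \<open>P\<close>, hence a value after all. The values of the coordinates form the point
  \<open>a\<close>.\<close>

theorem countable_nullstellensatz:
  fixes I :: "(('a::countable \<Rightarrow> complex) \<Rightarrow> complex) set"
  assumes I: "poly_ideal I" and M: "mult_closed M" "countable M" and disj: "I \<inter> M = {}"
  shows "\<exists>a. (\<forall>f\<in>I. f a = 0) \<and> (\<forall>h\<in>M. h a \<noteq> 0)"
proof -
  obtain P where P: "prime_ideal P" "I \<subseteq> P" "P \<inter> M = {}"
    and max: "\<And>J. poly_ideal J \<Longrightarrow> P \<subseteq> J \<Longrightarrow> J \<inter> M = {} \<Longrightarrow> J = P"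
    using exists_maximal_disjoint_ideal[OF I M(1) disj] by metis
  have PI: "poly_ideal P" using P(1) unfolding prime_ideal_def by blast
  have root: "\<exists>r. y - (\<lambda>_. r) \<in> P" if y: "y \<in> polyfun" for y
  proof (rule ccontr)
    assume no: "\<nexists>r. y - (\<lambda>_. r) \<in> P"
    have "\<exists>u h. u \<in> polyfun \<and> h \<in> M \<and> 1 * h - (y - (\<lambda>_. c)) * u \<in> P" for c
    proof -
      have yc: "y - (\<lambda>_. c) \<in> polyfun" using y by (intro polyfun_closed)
      have "adjoin_ideal P (y - (\<lambda>_. c)) \<inter> M \<noteq> {}"
        using max[OF poly_ideal_adjoin(1,2)[OF PI yc]] poly_ideal_adjoin(3)[OF PI yc] no by blast
      then obtain p u where "p \<in> P" "u \<in> polyfun" "p + u * (y - (\<lambda>_. c)) \<in> M"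
        unfolding adjoin_ideal_def by blast
      then show ?thesis by (intro exI[of _ u] exI[of _ "p + u * (y - (\<lambda>_. c))"]) (auto simp: algebra_simps)
    qed
    then obtain u h where uh: "\<And>c. u c \<in> polyfun" "\<And>c. h c \<in> M" "\<And>c. 1 * h c - (y - (\<lambda>_. c)) * u c \<in> P"
      by metis
    obtain A r where A: "finite A" "\<exists>c\<in>A. r c \<noteq> 0"
      and rel: "(\<Sum>c\<in>A. (\<lambda>_. r c) * 1 * (\<Prod>j\<in>A - {c}. y - (\<lambda>_. j))) \<in> P"
      using uncountable_relation[OF P(1) y M(2) _ _ uh(1,2) polyfun_1 uh(3)] P(3) M(1)
      unfolding mult_closed_def by blast
    define p where "p = (\<Sum>c\<in>A. smult (r c) (\<Prod>j\<in>A - {c}. [:- j, 1:]))"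
    have "(\<Sum>c\<in>A. (\<lambda>_. r c) * 1 * (\<Prod>j\<in>A - {c}. y - (\<lambda>_. j))) = (\<lambda>x. poly p (y x))"
      by (simp add: fun_eq_iff fun_apply p_def poly_sum poly_prod)
    \<comment> \<open>At a point \<open>c\<close> of \<open>A\<close> with \<open>r c\<close>
      nonzero, every other summand contains the factor \<open>c - c\<close>.\<close>
    moreover have "p \<noteq> 0"
    proof -
      obtain c where c: "c \<in> A" "r c \<noteq> 0" using A by blast
      have "poly p c = (\<Sum>c'\<in>A. r c' * (\<Prod>j\<in>A - {c'}. c - j))"
        by (simp add: p_def poly_sum poly_prod)
      also have "\<dots> = (\<Sum>c'\<in>{c}. r c' * (\<Prod>j\<in>A - {c'}. c - j))"
        using A(1) c(1) by (intro sum.mono_neutral_right) auto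
      finally have "poly p c \<noteq> 0" using A(1) c by auto
      then show ?thesis by auto
    qed
    ultimately show False using prime_ideal_root[OF P(1) y, of p] rel no by simp
  qed
  have "\<forall>i. \<exists>r. coord i - (\<lambda>_. r) \<in> P" by (intro allI root polyfun_coord)
  from choice[OF this] obtain a where a: "\<forall>i. coord i - (\<lambda>_. a i) \<in> P" ..
  \<comment> \<open>Modulo \<open>P\<close> each polynomial equals its value at \<open>a\<close>. A
    member of \<open>P\<close> with nonzero value would put a nonzero constant into
    \<open>P\<close>, and a member of \<open>M\<close> with value zero would itself lie in
    \<open>P\<close>.\<close>
  have red: "f - (\<lambda>_. f a) \<in> P" if "f \<in> polyfun" for f
    using that[unfolded polyfun_eq_alg]
  proof (induction rule: alg.induct)
    case (alg_const c)
    then show ?case using poly_idealD(2)[OF PI] by simp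
  next
    case (alg_gen z)
    then obtain i where "z = coord i" by blast
    then show ?case using a by (simp add: coord_def[of i a])
  next
    case (alg_add f g)
    have "(f + g) - (\<lambda>_. (f + g) a) = (f - (\<lambda>_. f a)) + (g - (\<lambda>_. g a))" by (simp add: fun_eq_iff fun_apply)
    then show ?case using poly_idealD(3)[OF PI alg_add.IH] by (simp only:)
  next
    case (alg_mult f g)
    have "(f * g) - (\<lambda>_. (f * g) a) = g * (f - (\<lambda>_. f a)) + (\<lambda>_. f a) * (g - (\<lambda>_. g a))"
      by (simp add: fun_eq_iff fun_apply algebra_simps)
    moreover have "g * (f - (\<lambda>_. f a)) \<in> P"
      by (rule poly_idealD(4)[OF PI alg_mult.IH(1)]) (simp add: polyfun_eq_alg alg_mult.hyps)
    moreover have "(\<lambda>_. f a) * (g - (\<lambda>_. g a)) \<in> P"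
      by (rule poly_idealD(4)[OF PI alg_mult.IH(2) polyfun_const])
    ultimately show ?case using poly_idealD(3)[OF PI] by (simp only:)
  qed
  have "f a = 0" if "f \<in> I" for f
  proof (rule ccontr)
    assume nz: "f a \<noteq> 0"
    have f: "f \<in> P" "f \<in> polyfun" using that P(2) poly_idealD(1)[OF I] by auto
    have "f - (f - (\<lambda>_. f a)) \<in> P" by (rule poly_ideal_diff[OF PI f(1) red[OF f(2)]])
    moreover have "f - (f - (\<lambda>_. f a)) = (\<lambda>_. f a)" by (rule ext) (simp add: fun_apply)
    ultimately have "(\<lambda>_. f a) \<in> P" by (simp only:)
    then have mem: "(\<lambda>_. inverse (f a)) * (\<lambda>_. f a) \<in> P" by (rule poly_idealD(4)[OF PI _ polyfun_const])
    have eq: "(\<lambda>_. inverse (f a)) * (\<lambda>_. f a) = 1" by (rule ext) (simp add: fun_apply nz)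
    have "1 \<in> P" using mem unfolding eq .
    then show False using P(1) unfolding prime_ideal_def by blast
  qed
  moreover have "h a \<noteq> 0" if hM: "h \<in> M" for h
  proof
    assume h0: "h a = 0"
    have "h \<in> polyfun" using hM M(1) unfolding mult_closed_def by blast
    then have mem: "h - (\<lambda>_. h a) \<in> P" by (rule red)
    have eq: "h - (\<lambda>_. h a) = h" by (rule ext) (simp add: h0 fun_apply)
    have "h \<in> P" using mem unfolding eq .
    then show False using hM P(3) by blast
  qed
  ultimately show ?thesis by (intro exI[of _ a] conjI ballI)
qed

section \<open>Irreducible closed sets and their dimension\<close>

definition vanishing :: "('a \<Rightarrow> complex) set \<Rightarrow> (('a \<Rightarrow> complex) \<Rightarrow> complex) set" where
  "vanishing V = {f \<in> polyfun. \<forall>x\<in>V. f x = 0}"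

definition zeros :: "(('a \<Rightarrow> complex) \<Rightarrow> complex) set \<Rightarrow> ('a \<Rightarrow> complex) set" where
  "zeros P = {x. \<forall>f\<in>P. f x = 0}"

lemma zclosed_zeros: "P \<subseteq> polyfun \<Longrightarrow> zclosed (zeros P)"
  unfolding zclosed_def zeros_def by blast

lemma zclosed_zero_set: "f \<in> polyfun \<Longrightarrow> zclosed {x. f x = 0}"
  using zclosed_zeros[of "{f}"] by (simp add: zeros_def)

lemma zeros_vanishing: "zclosed V \<Longrightarrow> zeros (vanishing V) = V"
  unfolding zclosed_def zeros_def vanishing_def by auto

lemma not_in_zclosed:
  assumes "zclosed V" "x \<notin> V"
  shows "\<exists>f\<in>polyfun. (\<forall>y\<in>V. f y = 0) \<and> f x \<noteq> 0"
  using zeros_vanishing[OF assms(1)] assms(2) unfolding zeros_def vanishing_def by blast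

lemma zclosure_superset: "S \<subseteq> zclosure S"
  unfolding zclosure_def by blast

lemma zclosure_minimal: "zclosed C \<Longrightarrow> S \<subseteq> C \<Longrightarrow> zclosure S \<subseteq> C"
  unfolding zclosure_def by blast

lemma zclosure_eq: "zclosure S = {x. \<forall>f\<in>polyfun. (\<forall>y\<in>S. f y = 0) \<longrightarrow> f x = 0}"
proof (intro subset_antisym subsetI)
  fix x assume x: "x \<in> zclosure S"
  have "f x = 0" if "f \<in> polyfun" "\<forall>y\<in>S. f y = 0" for f
    using zclosure_minimal[OF zclosed_zero_set[OF that(1)], of S] that(2) x by blast
  then show "x \<in> {x. \<forall>f\<in>polyfun. (\<forall>y\<in>S. f y = 0) \<longrightarrow> f x = 0}" by blast
next
  fix x assume x: "x \<in> {x. \<forall>f\<in>polyfun. (\<forall>y\<in>S. f y = 0) \<longrightarrow> f x = 0}"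
  have "x \<in> C" if "zclosed C" "S \<subseteq> C" for C
    using not_in_zclosed[OF that(1)] that(2) x by blast
  then show "x \<in> zclosure S" unfolding zclosure_def by blast
qed

lemma zclosed_zclosure: "zclosed (zclosure S)"
proof -
  have "zclosure S = zeros (vanishing S)" by (auto simp: zclosure_eq zeros_def vanishing_def)
  moreover have "vanishing S \<subseteq> polyfun" by (auto simp: vanishing_def)
  ultimately show ?thesis by (simp add: zclosed_zeros)
qed

lemma zclosure_vanish: "f \<in> polyfun \<Longrightarrow> (\<And>y. y \<in> S \<Longrightarrow> f y = 0) \<Longrightarrow> x \<in> zclosure S \<Longrightarrow> f x = 0"
  unfolding zclosure_eq by blast

lemma poly_ideal_vanishing: "poly_ideal (vanishing V)"
  unfolding poly_ideal_def vanishing_def by (auto intro: polyfun_closed simp: fun_apply)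

lemma zirred_no_zero_divisors:
  assumes "zirred V" "f \<in> polyfun" "g \<in> polyfun" "\<And>x. x \<in> V \<Longrightarrow> f x * g x = 0"
  shows "(\<forall>x\<in>V. f x = 0) \<or> (\<forall>x\<in>V. g x = 0)"
proof -
  have "V \<subseteq> {x. f x = 0} \<union> {x. g x = 0}" using assms(4) by auto
  then show ?thesis
    using assms(1) zclosed_zero_set[OF assms(2)] zclosed_zero_set[OF assms(3)] unfolding zirred_def by blast
qed

lemma zirredI:
  assumes "V \<noteq> {}" "zclosed V"
    and "\<And>f g. f \<in> polyfun \<Longrightarrow> g \<in> polyfun \<Longrightarrow> (\<And>x. x \<in> V \<Longrightarrow> f x * g x = 0) \<Longrightarrow>
      (\<forall>x\<in>V. f x = 0) \<or> (\<forall>x\<in>V. g x = 0)"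
  shows "zirred V"
  unfolding zirred_def
proof (intro conjI assms allI impI)
  fix A B assume AB: "zclosed A \<and> zclosed B \<and> V \<subseteq> A \<union> B"
  show "V \<subseteq> A \<or> V \<subseteq> B"
  proof (rule ccontr)
    assume "\<not> ?thesis"
    then obtain x y where "x \<in> V" "x \<notin> A" "y \<in> V" "y \<notin> B" by blast
    then obtain f g where "f \<in> polyfun" "\<forall>y\<in>A. f y = 0" "f x \<noteq> 0" "g \<in> polyfun" "\<forall>y\<in>B. g y = 0" "g y \<noteq> 0"
      using not_in_zclosed AB by metis
    moreover from this have "f z * g z = 0" if "z \<in> V" for z using that AB by auto
    ultimately show False using assms(3)[of f g] \<open>x \<in> V\<close> \<open>y \<in> V\<close> by blast
  qed
qed

lemma prime_ideal_vanishing: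
  assumes "zirred V"
  shows "prime_ideal (vanishing V)"
  unfolding prime_ideal_def
proof (intro conjI poly_ideal_vanishing ballI impI)
  show "1 \<notin> vanishing V" using assms unfolding zirred_def vanishing_def by (auto simp: fun_apply)
  fix f g :: "('a \<Rightarrow> complex) \<Rightarrow> complex"
  assume "f \<in> polyfun" "g \<in> polyfun" "f * g \<in> vanishing V"
  then show "f \<in> vanishing V \<or> g \<in> vanishing V"
    using zirred_no_zero_divisors[OF assms, of f g] by (auto simp: vanishing_def fun_apply)
qed

text \<open>A polynomial \<open>f\<close> outside the prime \<open>P\<close> has all its powers
  outside \<open>P\<close>; the Nullstellensatz for the multiplicative set of these powers gives a
  zero of \<open>P\<close> at which \<open>f\<close> does not vanish.\<close>

lemma vanishing_zeros:
  fixes P :: "(('a::countable \<Rightarrow> complex) \<Rightarrow> complex) set"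
  assumes P: "prime_ideal P"
  shows "vanishing (zeros P) = P"
proof (intro subset_antisym subsetI)
  have PI: "poly_ideal P" using P unfolding prime_ideal_def by blast
  fix f assume "f \<in> P"
  then show "f \<in> vanishing (zeros P)" using poly_idealD(1)[OF PI] by (auto simp: vanishing_def zeros_def)
next
  have PI: "poly_ideal P" using P unfolding prime_ideal_def by blast
  fix f assume f: "f \<in> vanishing (zeros P)"
  show "f \<in> P"
  proof (rule ccontr)
    assume nf: "f \<notin> P"
    have fp: "f \<in> polyfun" using f by (simp add: vanishing_def)
    define M where "M = range (\<lambda>n::nat. f ^ n)"
    have "f ^ n \<notin> P" for n
    proof (induction n)
      case 0
      then show ?case using P unfolding prime_ideal_def by simp
    next
      case (Suc n)
      then show ?case using P fp nf polyfun_power[OF fp] unfolding prime_ideal_def by auto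
    qed
    then have "P \<inter> M = {}" unfolding M_def by blast
    moreover have "mult_closed M" unfolding mult_closed_def M_def
      using polyfun_power[OF fp] by (auto simp: power_add[symmetric] intro: range_eqI[of _ _ 0])
    moreover have "countable M" unfolding M_def by simp
    ultimately obtain a where "\<forall>g\<in>P. g a = 0" "\<forall>h\<in>M. h a \<noteq> 0"
      using countable_nullstellensatz[OF PI] by blast
    moreover have "f \<in> M" unfolding M_def by (rule range_eqI[of _ _ 1]) simp
    ultimately show False using f by (auto simp: vanishing_def zeros_def)
  qed
qed

lemma zirred_zeros:
  fixes P :: "(('a::countable \<Rightarrow> complex) \<Rightarrow> complex) set"
  assumes P: "prime_ideal P"
  shows "zirred (zeros P)"
proof (rule zirredI)
  have PI: "poly_ideal P" using P unfolding prime_ideal_def by blast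
  show "zclosed (zeros P)" by (rule zclosed_zeros[OF poly_idealD(1)[OF PI]])
  show "zeros P \<noteq> {}"
    using vanishing_zeros[OF P] P polyfun_1 unfolding prime_ideal_def vanishing_def by force
  fix f g :: "('a \<Rightarrow> complex) \<Rightarrow> complex"
  assume fg: "f \<in> polyfun" "g \<in> polyfun" "\<And>x. x \<in> zeros P \<Longrightarrow> f x * g x = 0"
  then have "f * g \<in> vanishing (zeros P)" by (auto simp: vanishing_def fun_apply intro: polyfun_mult)
  then have "f \<in> vanishing (zeros P) \<or> g \<in> vanishing (zeros P)"
    using P fg unfolding vanishing_zeros[OF P] prime_ideal_def by blast
  then show "(\<forall>x\<in>zeros P. f x = 0) \<or> (\<forall>x\<in>zeros P. g x = 0)" by (auto simp: vanishing_def)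
qed

text \<open>The finite products of members of \<open>H\<close> still form a countable set, and by
  primality none of them vanishes identically on \<open>V\<close>; so the Nullstellensatz applies to
  them simultaneously.\<close>

lemma exists_very_generic_point:
  fixes V :: "('a::countable \<Rightarrow> complex) set"
  assumes V: "zirred V" and H: "countable H" "\<And>h. h \<in> H \<Longrightarrow> h \<in> polyfun \<and> (\<exists>x\<in>V. h x \<noteq> 0)"
  shows "\<exists>x\<in>V. \<forall>h\<in>H. h x \<noteq> 0"
proof -
  define M where "M = prod_list ` lists H"
  have pf: "prod_list hs \<in> polyfun" if "hs \<in> lists H" for hs
    using that H(2) by (induction hs) (auto intro: polyfun_closed)
  have nv: "prod_list hs \<notin> vanishing V" if "hs \<in> lists H" for hs
    using that
  proof (induction hs)
    case Nil
    then show ?case using prime_ideal_vanishing[OF V] unfolding prime_ideal_def by simp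
  next
    case (Cons h hs)
    then have "h \<notin> vanishing V" "prod_list hs \<notin> vanishing V" using H(2) by (auto simp: vanishing_def)
    then show ?case using prime_ideal_vanishing[OF V] Cons.hyps H(2) pf unfolding prime_ideal_def
      by (metis prod_list.Cons Cons.prems)
  qed
  have "mult_closed M" unfolding mult_closed_def
  proof (intro conjI ballI)
    show "M \<subseteq> polyfun" using pf unfolding M_def by blast
    show "1 \<in> M" unfolding M_def by (rule image_eqI[of _ _ "[]"]) auto
    fix f g assume "f \<in> M" "g \<in> M"
    then obtain hs ks where "hs \<in> lists H" "ks \<in> lists H" "f = prod_list hs" "g = prod_list ks" unfolding M_def by blast
    then show "f * g \<in> M" unfolding M_def by (intro image_eqI[of _ _ "hs @ ks"]) auto
  qed
  moreover have "countable M" unfolding M_def using H(1) by simp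
  moreover have "vanishing V \<inter> M = {}" using nv unfolding M_def by blast
  ultimately obtain a where a: "\<forall>f\<in>vanishing V. f a = 0" "\<forall>h\<in>M. h a \<noteq> 0"
    using countable_nullstellensatz[OF poly_ideal_vanishing] by blast
  have "a \<in> V" using a(1) zeros_vanishing[of V] V unfolding zeros_def zirred_def by blast
  moreover have "h \<in> M" if "h \<in> H" for h unfolding M_def using that by (intro image_eqI[of _ _ "[h]"]) auto
  ultimately show ?thesis using a(2) by blast
qed

lemma alg_coord_update:
  "f \<in> alg (coord ` T) \<Longrightarrow> i \<notin> T \<Longrightarrow> f (x(i := t)) = f x"
  by (induction rule: alg.induct) (auto simp: coord_def fun_apply)

lemma alg_independent_coord: "finite T \<Longrightarrow> alg_independent_on UNIV T coord"
proof (induction T rule: finite_induct)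
  case empty
  show ?case by (rule alg_independent_empty) simp
next
  case (insert i T)
  have "\<not> algebraic_over (alg (coord ` T)) (coord i)"
  proof
    assume "algebraic_over (alg (coord ` T)) (coord i)"
    then obtain p m where p: "\<And>l. p l \<in> alg (coord ` T)" "\<exists>l\<le>m. p l \<noteq> 0" "(\<Sum>l\<le>m. p l * coord i ^ l) = 0"
      unfolding algebraic_over_def by blast
    have "p l x = 0" if "l \<le> m" for l x
    proof -
      \<comment> \<open>The coefficients do not involve coordinate \<open>i\<close>, so this
        coordinate can be varied freely.\<close>
      have "(\<Sum>l\<le>m. p l x * t ^ l) = 0" for t
      proof -
        have "(\<Sum>l\<le>m. p l * coord i ^ l) (x(i := t)) = 0" using p(3) by (simp add: fun_apply)
        then show ?thesis using alg_coord_update[OF p(1) insert.hyps(2)] by (simp add: fun_apply coord_def)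
      qed
      then show ?thesis using polyfun_eq_0[of "\<lambda>l. p l x" m] that by blast
    qed
    then show False using p(2) by (auto simp: fun_eq_iff fun_apply)
  qed
  then show ?case using alg_independent_insert[OF insert.IH insert.hyps(1,2), of "coord ` T"]
    by (blast intro: alg_gen)
qed

lemma alg_span_monomials:
  assumes "finite T" "f \<in> alg (z ` T)"
  shows "f \<in> fs.span ((\<lambda>e. \<Prod>i\<in>T. z i ^ e i) ` exps T)"
  using assms(2)
proof induction
  let ?S = "fs.span ((\<lambda>e. \<Prod>i\<in>T. z i ^ e i) ` exps T)"
  {
    case (alg_const c)
    have "1 = (\<Prod>i\<in>T. z i ^ ((\<lambda>_. 0) i))" by simp
    then have "1 \<in> ?S" by (intro fs.span_base image_eqI[of _ _ "\<lambda>_. 0"]) (auto simp: exps_def)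
    from fs.span_scale[OF this, of c] show ?case by simp
  next
    case (alg_gen y)
    then obtain i where i: "i \<in> T" "y = z i" by blast
    have "(\<Prod>j\<in>T. z j ^ (if j = i then 1 else 0)) = (\<Prod>j\<in>{i}. z j ^ (if j = i then 1 else 0))"
      using i assms(1) by (intro prod.mono_neutral_right) auto
    then have "y = (\<Prod>j\<in>T. z j ^ (if j = i then 1 else 0))" using i by simp
    then show ?case using i
      by (intro fs.span_base image_eqI[of _ _ "\<lambda>j. if j = i then 1 else 0"]) (auto simp: exps_def)
  next
    case (alg_add f g)
    then show ?case by (intro fs.span_add)
  next
    case (alg_mult f g)
    show ?case
    proof (rule span_mult[OF _ alg_mult.IH(2)])
      fix g' assume "g' \<in> (\<lambda>e. \<Prod>i\<in>T. z i ^ e i) ` exps T"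
      then obtain e where g': "g' = (\<Prod>i\<in>T. z i ^ e i)" "e \<in> exps T" by blast
      have "g' * f \<in> ?S"
      proof (rule span_mult[OF _ alg_mult.IH(1)])
        fix f' assume "f' \<in> (\<lambda>e. \<Prod>i\<in>T. z i ^ e i) ` exps T"
        then obtain e' where f': "f' = (\<Prod>i\<in>T. z i ^ e' i)" "e' \<in> exps T" by blast
        have "g' * f' = (\<Prod>i\<in>T. z i ^ (e i + e' i))" using f' g' by (simp add: power_add prod.distrib)
        then show "g' * f' \<in> ?S" using f' g'
          by (intro fs.span_base image_eqI[of _ _ "\<lambda>i. e i + e' i"]) (auto simp: exps_def)
      qed
      then show "f * g' \<in> ?S" by (simp only: mult.commute)
    qed
  }
qed

lemma alg_explicit:
  assumes "finite T" "f \<in> alg (z ` T)"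
  shows "\<exists>E c. finite E \<and> E \<subseteq> exps T \<and> f = (\<Sum>e\<in>E. (\<lambda>_. c e) * (\<Prod>i\<in>T. z i ^ e i))"
  using span_image_explicit[OF alg_span_monomials[OF assms]] .

lemma alg_independent_vanish:
  assumes ind: "alg_independent_on V T z" and T: "finite T" and f: "f \<in> alg (z ` T)" "\<And>x. x \<in> V \<Longrightarrow> f x = 0"
  shows "f = 0"
proof -
  obtain E c where E: "finite E" "E \<subseteq> exps T" "f = (\<Sum>e\<in>E. (\<lambda>_. c e) * (\<Prod>i\<in>T. z i ^ e i))"
    using alg_explicit[OF T f(1)] by blast
  have "\<forall>e\<in>E. c e = 0"
    using alg_independent_onD[OF ind E(1,2), of c] f(2) by (auto simp: E(3) fun_apply)
  then show ?thesis unfolding E(3) by (intro sum.neutral) (auto simp: fun_eq_iff fun_apply)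
qed

lemma alg_independent_onI:
  assumes T: "finite T" and amb: "alg_independent_on UNIV T z"
    and f: "\<And>f. f \<in> alg (z ` T) \<Longrightarrow> (\<And>x. x \<in> V \<Longrightarrow> f x = 0) \<Longrightarrow> f = 0"
  shows "alg_independent_on V T z"
  unfolding alg_independent_on_def
proof (intro allI impI)
  fix E c
  assume E: "finite E \<and> E \<subseteq> exps T \<and> (\<forall>x\<in>V. (\<Sum>e\<in>E. c e * (\<Prod>i\<in>T. z i x ^ e i)) = 0)"
  have "(\<Sum>e\<in>E. (\<lambda>_. c e) * (\<Prod>i\<in>T. z i ^ e i)) = 0"
    by (rule f) (use E in \<open>auto simp: fun_apply intro!: alg_sum alg_mult alg_const alg_prod alg_power intro: alg_gen\<close>)
  then show "\<forall>e\<in>E. c e = 0" using amb E unfolding alg_independent_on_UNIV by blast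
qed

lemma alg_independent_reindex:
  assumes inj: "inj_on h T" and T: "finite T" and ind: "alg_independent_on V T (\<lambda>i. z (h i))"
  shows "alg_independent_on V (h ` T) z"
  unfolding alg_independent_on_def
proof (intro allI impI ballI)
  fix E c e
  assume E: "finite E \<and> E \<subseteq> exps (h ` T) \<and> (\<forall>x\<in>V. (\<Sum>e\<in>E. c e * (\<Prod>i\<in>h ` T. z i x ^ e i)) = 0)"
    and e: "e \<in> E"
  define r where "r e i = (if i \<in> T then e (h i) else 0)" for e :: "'b \<Rightarrow> nat" and i
  have rinj: "inj_on r E"
  proof (rule inj_onI)
    fix e f assume ef: "e \<in> E" "f \<in> E" "r e = r f"
    show "e = f"
    proof
      fix j show "e j = f j"
      proof (cases "j \<in> h ` T")
        case True
        then obtain i where "i \<in> T" "j = h i" by blast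
        then show ?thesis using fun_cong[OF ef(3), of i] by (simp add: r_def)
      next
        case False
        moreover have "e \<in> exps (h ` T)" "f \<in> exps (h ` T)" using ef E by blast+
        ultimately show ?thesis by (simp add: exps_def)
      qed
    qed
  qed
  have "(\<Sum>f\<in>r ` E. c (inv_into E r f) * (\<Prod>i\<in>T. z (h i) x ^ f i)) = 0" if "x \<in> V" for x
  proof -
    have "(\<Sum>f\<in>r ` E. c (inv_into E r f) * (\<Prod>i\<in>T. z (h i) x ^ f i)) =
      (\<Sum>e\<in>E. c e * (\<Prod>i\<in>h ` T. z i x ^ e i))"
      by (simp add: sum.reindex[OF rinj] inv_into_f_f[OF rinj] prod.reindex[OF inj] r_def)
    then show ?thesis using E that by simp
  qed
  moreover have "finite (r ` E)" "r ` E \<subseteq> exps T" using E by (auto simp: exps_def r_def)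
  ultimately have "c (inv_into E r (r e)) = 0"
    using alg_independent_onD[OF ind, of "r ` E" "\<lambda>f. c (inv_into E r f)" "r e"] e by blast
  then show "c e = 0" using e by (simp add: inv_into_f_f[OF rinj])
qed

lemma alg_independent_reindex':
  assumes inj: "inj_on h T" and T: "finite T" and ind: "alg_independent_on V (h ` T) z"
  shows "alg_independent_on V T (\<lambda>i. z (h i))"
proof -
  let ?g = "inv_into T h"
  have eq: "?g ` h ` T = T" using inj by (force simp: image_image inv_into_f_f)
  have "alg_independent_on V (h ` T) (\<lambda>j. z (h (?g j)))"
    using ind by (subst alg_independent_on_cong[where z' = z]) (auto simp: f_inv_into_f inj)
  from alg_independent_reindex[OF inj_on_inv_into[of "h ` T" h T] _ this] T show ?thesis
    unfolding eq by simp
qed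

subsection \<open>Dropping the dimension by one\<close>

text \<open>Restrict both functions to the line through a nonzero point of each; there they are
  nonzero polynomials in one variable.\<close>

lemma zirred_UNIV_mult:
  fixes f g :: "('a \<Rightarrow> complex) \<Rightarrow> complex"
  assumes f: "f \<in> polyfun" "f \<noteq> 0" and g: "g \<in> polyfun" "g \<noteq> 0"
  shows "f * g \<noteq> 0"
proof -
  obtain a b where ab: "f a \<noteq> 0" "g b \<noteq> 0" using f g by (auto simp: fun_eq_iff fun_apply)
  have line: "\<exists>p. \<forall>t. f (\<lambda>i. a i + t * (b i - a i)) = poly p t" if "f \<in> polyfun" for f
    using that
  proof induction
    case (pf_const c)
    show ?case by (rule exI[of _ "[:c:]"]) simp
  next
    case (pf_coord i)
    show ?case by (rule exI[of _ "[:a i, b i - a i:]"]) simp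
  next
    case (pf_add f g)
    then show ?case by (metis poly_add)
  next
    case (pf_mult f g)
    then show ?case by (metis poly_mult)
  qed
  obtain p q where pq: "\<And>t. f (\<lambda>i. a i + t * (b i - a i)) = poly p t" "\<And>t. g (\<lambda>i. a i + t * (b i - a i)) = poly q t"
    using line[OF f(1)] line[OF g(1)] by metis
  have "poly p 0 \<noteq> 0" "poly q 1 \<noteq> 0" using ab pq(1)[of 0] pq(2)[of 1] by simp_all
  then have "p * q \<noteq> 0" by auto
  then obtain t where "poly (p * q) t \<noteq> 0" using poly_all_0_iff_0 by blast
  then have "(f * g) (\<lambda>i. a i + t * (b i - a i)) \<noteq> 0" by (simp add: fun_apply pq)
  then show ?thesis by (metis zero_fun_apply)
qed

text \<open>Cut \<open>V\<close> with a hyperplane fixing coordinate \<open>i\<close> to a value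
  \<open>c\<close>. If for every \<open>c\<close> the cut made the other coordinates of
  \<open>T\<close> dependent, \<open>uncountable_relation\<close> would produce a nonzero polynomial
  in the coordinates of \<open>T\<close> vanishing on \<open>V\<close>.\<close>

lemma exists_smaller_irreducible:
  fixes V :: "('a::countable \<Rightarrow> complex) set"
  assumes V: "zirred V" and T: "finite T" "i \<in> T" and ind: "alg_independent_on V T coord"
  shows "\<exists>W. zirred W \<and> W \<subset> V \<and> alg_independent_on W (T - {i}) coord"
proof -
  \<comment> \<open>The nonzero polynomials in the remaining coordinates. A prime ideal missing all
    of them has a zero set on which these coordinates stay independent.\<close>
  define \<G> where "\<G> = {g \<in> alg (coord ` (T - {i})). g \<noteq> 0}"
  have G: "\<G> \<subseteq> polyfun" unfolding \<G>_def using alg_coord_polyfun by blast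
  have mc: "mult_closed \<G>" unfolding mult_closed_def
    using G zirred_UNIV_mult by (auto simp: \<G>_def intro: alg_1 alg_mult alg_coord_polyfun)
  have y: "coord i - (\<lambda>_. c) \<in> polyfun" for c by (intro polyfun_closed)
  have "\<exists>c. adjoin_ideal (vanishing V) (coord i - (\<lambda>_. c)) \<inter> \<G> = {}"
  proof (rule ccontr)
    assume no: "\<not> ?thesis"
    have "\<exists>g u. g \<in> \<G> \<and> u \<in> polyfun \<and> g * 1 - (coord i - (\<lambda>_. c)) * u \<in> vanishing V" for c
    proof -
      obtain p u where "p \<in> vanishing V" "u \<in> polyfun" "p + u * (coord i - (\<lambda>_. c)) \<in> \<G>"
        using no unfolding adjoin_ideal_def by blast
      then show ?thesis by (intro exI[of _ "p + u * (coord i - (\<lambda>_. c))"] exI[of _ u]) (simp add: algebra_simps)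
    qed
    then obtain g u where gu: "\<And>c. g c \<in> \<G>" "\<And>c. u c \<in> polyfun"
      "\<And>c. g c * 1 - (coord i - (\<lambda>_. c)) * u c \<in> vanishing V" by metis
    have one: "countable {1}" "{1} \<inter> vanishing V = {}" "{1} \<subseteq> (polyfun :: (('a \<Rightarrow> complex) \<Rightarrow> complex) set)"
      using prime_ideal_vanishing[OF V] polyfun_1 unfolding prime_ideal_def by auto
    have gpf: "g c \<in> polyfun" for c using gu(1) G by blast
    obtain A r where A: "finite A" "\<exists>c\<in>A. r c \<noteq> 0"
      and S: "(\<Sum>c\<in>A. (\<lambda>_. r c) * g c * (\<Prod>j\<in>A - {c}. coord i - (\<lambda>_. j))) \<in> vanishing V" (is "?S \<in> _")
      using uncountable_relation[OF prime_ideal_vanishing[OF V] polyfun_coord one gu(2) _ gpf gu(3)] by blast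
    have g_in: "g c \<in> alg (coord ` T)" for c
      using gu(1)[of c] alg_mono[of "coord ` (T - {i})" "coord ` T"] by (auto simp: \<G>_def)
    have "?S \<in> alg (coord ` T)"
      using T(2) g_in by (intro alg_sum alg_mult alg_prod alg_diff alg_const) (auto intro: alg_gen)
    then have S0: "?S = 0"
      using alg_independent_vanish[OF ind T(1)] S by (auto simp: vanishing_def)
    obtain c where c: "c \<in> A" "r c \<noteq> 0" using A by blast
    \<comment> \<open>To see that the relation is nontrivial, set coordinate \<open>i\<close> to
      \<open>c\<close>: only the summand of \<open>c\<close> survives, and the \<open>g c'\<close>
      do not involve this coordinate.\<close>
    obtain x where x: "g c x \<noteq> 0" using gu(1)[of c] by (auto simp: \<G>_def fun_eq_iff fun_apply)
    have gx: "g c' (x(i := t)) = g c' x" for c' t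
      using alg_coord_update[of "g c'" "T - {i}" i x t] gu(1)[of c'] by (auto simp: \<G>_def)
    have "0 = ?S (x(i := c))" unfolding S0 by (simp add: fun_apply)
    also have "\<dots> = (\<Sum>c'\<in>A. r c' * g c' x * (\<Prod>j\<in>A - {c'}. c - j))"
      by (simp add: fun_apply coord_def gx)
    also have "\<dots> = (\<Sum>c'\<in>{c}. r c' * g c' x * (\<Prod>j\<in>A - {c'}. c - j))"
      using A(1) c(1) by (intro sum.mono_neutral_right) auto
    finally show False using A(1) c x by auto
  qed
  then obtain c where c: "adjoin_ideal (vanishing V) (coord i - (\<lambda>_. c)) \<inter> \<G> = {}" by blast
  note adj = poly_ideal_adjoin[OF poly_ideal_vanishing[of V] y[of c]]
  from exists_maximal_disjoint_ideal[OF adj(1) mc c] obtain Q where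
    Q': "prime_ideal Q \<and> adjoin_ideal (vanishing V) (coord i - (\<lambda>_. c)) \<subseteq> Q \<and> Q \<inter> \<G> = {} \<and>
      (\<forall>J. poly_ideal J \<and> Q \<subseteq> J \<and> J \<inter> \<G> = {} \<longrightarrow> J = Q)" ..
  then have Q: "prime_ideal Q" "adjoin_ideal (vanishing V) (coord i - (\<lambda>_. c)) \<subseteq> Q" "Q \<inter> \<G> = {}"
    by simp_all
  have VQ: "vanishing V \<subseteq> Q" using adj(2) Q(2) by (rule subset_trans)
  have yQ: "coord i - (\<lambda>_. c) \<in> Q" using adj(3) Q(2) by (rule subsetD[rotated])
  have zV: "zeros (vanishing V) = V" using V zeros_vanishing unfolding zirred_def by blast
  have "zeros Q \<subseteq> zeros (vanishing V)" using VQ unfolding zeros_def by blast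
  then have sub: "zeros Q \<subseteq> V" unfolding zV .
  moreover have "zeros Q \<noteq> V"
  proof
    assume eq: "zeros Q = V"
    have "coord i - (\<lambda>_. c) = 0"
    proof (rule alg_independent_vanish[OF ind T(1)])
      show "coord i - (\<lambda>_. c) \<in> alg (coord ` T)" by (intro alg_diff alg_const alg_gen imageI T(2))
      fix x assume "x \<in> V"
      then show "(coord i - (\<lambda>_. c)) x = 0" using yQ unfolding eq[symmetric] zeros_def by blast
    qed
    then have "(coord i - (\<lambda>_. c)) (\<lambda>_. c + 1) = 0" by (metis zero_fun_apply)
    then show False by (simp add: fun_apply coord_def)
  qed
  moreover have "alg_independent_on (zeros Q) (T - {i}) coord"
  proof (rule alg_independent_onI)
    fix f assume f: "f \<in> alg (coord ` (T - {i}))" "\<And>x. x \<in> zeros Q \<Longrightarrow> f x = 0"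
    then have "f \<in> vanishing (zeros Q)" using alg_coord_polyfun[OF f(1)] by (simp add: vanishing_def)
    then have "f \<in> Q" unfolding vanishing_zeros[OF Q(1)] .
    then show "f = 0" using Q(3) f(1) by (auto simp: \<G>_def)
  qed (use T alg_independent_coord in auto)
  ultimately show ?thesis using zirred_zeros[OF Q(1)] by blast
qed

lemma zchain_extend:
  assumes "zchain W k" "W \<subset> V" "zirred V"
  shows "zchain V (Suc k)"
proof -
  obtain Z where Z: "\<And>i. i \<le> k \<Longrightarrow> zirred (Z i) \<and> Z i \<subseteq> W" "\<And>i. i < k \<Longrightarrow> Z i \<subset> Z (Suc i)"
    using assms(1) unfolding zchain_def by blast
  show ?thesis unfolding zchain_def
  proof (intro exI[of _ "Z(Suc k := V)"] conjI allI impI)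
    fix i assume "i \<le> Suc k"
    then show "zirred ((Z(Suc k := V)) i)" "(Z(Suc k := V)) i \<subseteq> V"
      using Z(1)[of i] assms(2,3) by (auto simp: le_Suc_eq)
  next
    fix i assume "i < Suc k"
    then show "(Z(Suc k := V)) i \<subset> (Z(Suc k := V)) (Suc i)"
      using Z(1)[of k] Z(2)[of i] assms(2) by (auto simp: less_Suc_eq)
  qed
qed

text \<open>Giving up one coordinate at a time produces a strictly descending chain of irreducible
  sets.\<close>

lemma independent_imp_zchain:
  fixes V :: "('a::countable \<Rightarrow> complex) set"
  shows "zirred V \<Longrightarrow> finite T \<Longrightarrow> alg_independent_on V T coord \<Longrightarrow> zchain V (card T)"
proof (induction "card T" arbitrary: V T)
  case 0
  then show ?case unfolding zchain_def by (intro exI[of _ "\<lambda>_. V"]) auto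
next
  case (Suc k)
  then obtain i where i: "i \<in> T" by (metis card.empty ex_in_conv nat.distinct(1))
  obtain W where W: "zirred W" "W \<subset> V" "alg_independent_on W (T - {i}) coord"
    using exists_smaller_irreducible[OF Suc.prems(1,2) i Suc.prems(3)] by blast
  have k: "k = card (T - {i})" using Suc.hyps(2) Suc.prems(2) i by simp
  have "zchain W k" using Suc.hyps(1)[OF k W(1) _ W(3)] Suc.prems(2) k by simp
  from zchain_extend[OF this W(2) Suc.prems(1)] show ?case using Suc.hyps(2) by simp
qed

text \<open>A retraction of the whole type onto \<open>V\<close>: composing with it turns equality on \<open>V\<close> into equality of functions.\<close>
definition retr :: "'b set \<Rightarrow> 'b \<Rightarrow> 'b" where
  "retr V x = (if x \<in> V then x else (SOME y. y \<in> V))"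

lemma retr_id: "x \<in> V \<Longrightarrow> retr V x = x"
  by (simp add: retr_def)

lemma retr_in: "V \<noteq> {} \<Longrightarrow> retr V x \<in> V"
  by (simp add: retr_def some_in_eq)

lemma range_retr: "V \<noteq> {} \<Longrightarrow> range (retr V) = V"
  using retr_in retr_id by (metis image_subset_iff rangeI subsetI subset_antisym)

lemma comp_retr_eq_0: "V \<noteq> {} \<Longrightarrow> f \<circ> retr V = 0 \<longleftrightarrow> (\<forall>x\<in>V. f x = 0)"
  unfolding fun_eq_iff by (metis comp_apply retr_id retr_in zero_fun_apply)

lemma alg_comp: "f \<in> alg ((\<lambda>i. z i \<circ> h) ` S) \<Longrightarrow> \<exists>p\<in>alg (z ` S). f = p \<circ> h"
proof (induction rule: alg.induct)
  case (alg_const c)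
  then show ?case by (intro bexI[of _ "\<lambda>_. c"]) (auto intro: alg.alg_const)
next
  case (alg_gen y)
  then obtain i where "i \<in> S" "y = z i \<circ> h" by blast
  then show ?case by (intro bexI[of _ "z i"] alg.alg_gen imageI)
next
  case (alg_add f g)
  then obtain p q where "p \<in> alg (z ` S)" "q \<in> alg (z ` S)" "f = p \<circ> h" "g = q \<circ> h" by blast
  then show ?case by (intro bexI[of _ "p + q"]) (auto simp: fun_eq_iff fun_apply intro: alg.alg_add)
next
  case (alg_mult f g)
  then obtain p q where "p \<in> alg (z ` S)" "q \<in> alg (z ` S)" "f = p \<circ> h" "g = q \<circ> h" by blast
  then show ?case by (intro bexI[of _ "p * q"]) (auto simp: fun_eq_iff fun_apply intro: alg.alg_mult)
qed

lemma no_zero_divisors_coord: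
  assumes V: "zirred V"
  shows "no_zero_divisors (alg ((\<lambda>i. coord i \<circ> retr V) ` S))"
  unfolding no_zero_divisors_def
proof (intro ballI impI)
  have ne: "V \<noteq> {}" using V unfolding zirred_def by blast
  fix f g assume f: "f \<in> alg ((\<lambda>i. coord i \<circ> retr V) ` S)" and g: "g \<in> alg ((\<lambda>i. coord i \<circ> retr V) ` S)"
    and fg: "f * g = 0"
  obtain p q where p: "p \<in> alg (coord ` S)" "f = p \<circ> retr V" and q: "q \<in> alg (coord ` S)" "g = q \<circ> retr V"
    using alg_comp[OF f] alg_comp[OF g] by blast
  have "p x * q x = 0" if "x \<in> V" for x
    using fun_cong[OF fg, of x] that by (simp add: p q fun_apply retr_id)
  then show "f = 0 \<or> g = 0"
    using zirred_no_zero_divisors[OF V, of p q] alg_coord_polyfun p q comp_retr_eq_0[OF ne] by metis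
qed

lemma comp_retr_in_alg:
  assumes "V \<noteq> {}" and S: "\<forall>x\<in>V. \<forall>i. i \<notin> S \<longrightarrow> x i = 0" and "p \<in> polyfun"
  shows "p \<circ> retr V \<in> alg ((\<lambda>i. coord i \<circ> retr V) ` S)"
  using assms(3)[unfolded polyfun_eq_alg]
proof (induction rule: alg.induct)
  case (alg_const c)
  then show ?case by (simp add: o_def alg.alg_const)
next
  case (alg_gen y)
  then obtain i where y: "y = coord i" by blast
  show ?case
  proof (cases "i \<in> S")
    case True
    then show ?thesis unfolding y by (intro alg.alg_gen) blast
  next
    case False
    have "coord i \<circ> retr V = 0"
      unfolding comp_retr_eq_0[OF assms(1)] using S False by (simp add: coord_def)
    then show ?thesis unfolding y by (simp add: alg_0)
  qed
next
  case (alg_add f g)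
  have "(f + g) \<circ> retr V = (f \<circ> retr V) + (g \<circ> retr V)" by (simp add: fun_eq_iff fun_apply)
  then show ?case using alg.alg_add[OF alg_add.IH] by (simp only:)
next
  case (alg_mult f g)
  have "(f * g) \<circ> retr V = (f \<circ> retr V) * (g \<circ> retr V)" by (simp add: fun_eq_iff fun_apply)
  then show ?case using alg.alg_mult[OF alg_mult.IH] by (simp only:)
qed

text \<open>After cancelling the lowest power of \<open>f\<close> that occurs, the lowest nonzero
  coefficient is a multiple of \<open>f\<close>. It is therefore a nonzero function that vanishes
  wherever \<open>f\<close> does.\<close>

lemma transcendental_of_vanishing:
  assumes dom: "no_zero_divisors (alg Z)" and p: "\<And>l. p l \<in> alg Z" and f: "f \<in> alg Z" "f \<noteq> 0"
    and rel: "(\<Sum>l\<le>m. p l * f ^ l) = 0" and nz: "\<exists>l\<le>m. p l \<noteq> 0"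
  shows "\<exists>l\<le>m. p l \<noteq> 0 \<and> (\<exists>q\<in>alg Z. p l = f * q)"
proof -
  define k where "k = (LEAST l. p l \<noteq> 0)"
  have k: "p k \<noteq> 0" "\<And>l. l < k \<Longrightarrow> p l = 0"
    using LeastI_ex[of "\<lambda>l. p l \<noteq> 0"] nz not_less_Least[of _ "\<lambda>l. p l \<noteq> 0"] unfolding k_def by blast+
  have km: "k \<le> m" using nz k(2) by (meson not_le_imp_less order_trans less_imp_le)
  define q where "q = (\<Sum>l\<in>{Suc k..m}. p l * f ^ (l - Suc k))"
  have q: "q \<in> alg Z" unfolding q_def using p f(1) by (intro alg_sum alg_mult alg_power)
  have "(\<Sum>l\<le>m. p l * f ^ l) = (\<Sum>l\<in>{k..m}. p l * f ^ l)"
    using k(2) by (intro sum.mono_neutral_right) auto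
  also have "\<dots> = p k * f ^ k + (\<Sum>l\<in>{Suc k..m}. p l * f ^ l)"
    using km by (simp add: sum.atLeast_Suc_atMost)
  also have "(\<Sum>l\<in>{Suc k..m}. p l * f ^ l) = f ^ k * (f * q)"
    unfolding q_def sum_distrib_left
  proof (intro sum.cong refl)
    fix l assume "l \<in> {Suc k..m}"
    then have "l = k + Suc (l - Suc k)" by simp
    then have "f ^ l = f ^ k * (f * f ^ (l - Suc k))" by (metis power_Suc power_add)
    then show "p l * f ^ l = f ^ k * (f * (p l * f ^ (l - Suc k)))" by (simp add: algebra_simps)
  qed
  finally have "f ^ k * (p k + f * q) = 0" using rel by (simp add: algebra_simps)
  moreover have "p k + f * q \<in> alg Z" using p f(1) q by (intro alg_add alg_mult)
  ultimately have "p k + f * q = 0"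
    using dom no_zero_divisors_power[OF dom f, of k] alg_power[OF f(1), of k] unfolding no_zero_divisors_def by blast
  then have "p k = f * (- q)" by (simp add: eq_neg_iff_add_eq_0)
  then show ?thesis using k(1) km alg_uminus[OF q] by blast
qed

lemma irreducible_basis:
  assumes V: "zirred V" and S: "finite S"
  shows "\<exists>T\<subseteq>S. alg_independent_on V T coord \<and> growth (alg ((\<lambda>i. coord i \<circ> retr V) ` S)) (card T)"
proof -
  have ne: "V \<noteq> {}" using V unfolding zirred_def by blast
  show ?thesis
    using growth_basis[OF S no_zero_divisors_coord[OF V, of S]] alg_independent_on_pullback[OF range_retr[OF ne], of _ coord]
    by blast
qed

text \<open>Choose \<open>f\<close> vanishing on \<open>Z\<close> but not on \<open>Z'\<close>. A
  relation between \<open>f\<close> and the coordinates in \<open>T\<close> on \<open>Z'\<close>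
  would have a nonzero coefficient divisible by \<open>f\<close>, that is, a polynomial in
  \<open>T\<close> vanishing on \<open>Z\<close>. So \<open>f\<close> and \<open>T\<close> are
  independent together, and a basis of coordinates on \<open>Z'\<close> has more than
  \<open>card T\<close> members.\<close>

lemma larger_independent_set:
  assumes Z: "zirred Z" and Z': "zirred Z'" and sub: "Z \<subset> Z'" and S: "finite S"
    and off: "\<forall>x\<in>Z'. \<forall>i. i \<notin> S \<longrightarrow> x i = 0" and T: "T \<subseteq> S" "alg_independent_on Z T coord"
  shows "\<exists>T'\<subseteq>S. alg_independent_on Z' T' coord \<and> card T' = Suc (card T)"
proof -
  have ne: "Z' \<noteq> {}" and neZ: "Z \<noteq> {}" using Z Z' unfolding zirred_def by blast+
  have finT: "finite T" using T(1) S finite_subset by blast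
  obtain x0 where x0: "x0 \<in> Z'" "x0 \<notin> Z" using sub by blast
  obtain f where f: "f \<in> polyfun" "\<forall>x\<in>Z. f x = 0" "f x0 \<noteq> 0"
    using not_in_zclosed[of Z x0] Z x0 unfolding zirred_def by blast
  define zz where "zz i = coord i \<circ> retr Z'" for i :: 'a
  have zin: "zz i \<in> alg (zz ` A)" if "i \<in> A" for i A using that by (intro alg_gen imageI)
  have dom: "no_zero_divisors (alg (zz ` A))" for A
    unfolding zz_def by (rule no_zero_divisors_coord[OF Z'])
  obtain T' where T': "T' \<subseteq> S" "alg_independent_on Z' T' coord" "growth (alg (zz ` S)) (card T')"
    using irreducible_basis[OF Z' S] unfolding zz_def by blast
  have "card T < card T'"
  proof (rule ccontr)
    assume "\<not> ?thesis"
    then have le: "card T' \<le> card T" by simp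
    \<comment> \<open>The option type makes room for one function besides the coordinates:
      \<open>None\<close> stands for \<open>f\<close>.\<close>
    define w where "w j = (case j of None \<Rightarrow> f \<circ> retr Z' | Some i \<Rightarrow> zz i)" for j
    define J where "J = insert None (Some ` T)"
    have cJ: "finite J" "card J = Suc (card T)" unfolding J_def using finT by (simp_all add: card_image)
    have fin: "f \<circ> retr Z' \<in> alg (zz ` S)"
      unfolding zz_def by (rule comp_retr_in_alg[OF ne off f(1)])
    have "w j \<in> alg (zz ` S)" if "j \<in> J" for j
      using that fin T(1) by (auto simp: J_def w_def intro!: zin)
    then have "\<not> alg_independent_on UNIV J w"
      using growth_imp_dependent[OF T'(3) dom cJ(1)] cJ(2) le by simp
    moreover have "alg_independent_on UNIV J w"
      unfolding J_def
    proof (rule alg_independent_insert[where Z = "zz ` T"])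
      have "alg_independent_on Z' T coord" using alg_independent_on_mono[OF T(2)] sub by blast
      then have "alg_independent_on UNIV T zz"
        unfolding zz_def using alg_independent_on_pullback[OF range_retr[OF ne], of T coord] by blast
      then have "alg_independent_on UNIV T (\<lambda>i. w (Some i))" by (simp add: w_def)
      then show "alg_independent_on UNIV (Some ` T) w" by (intro alg_independent_reindex[of Some T UNIV w] finT) simp_all
      show "finite (Some ` T)" "None \<notin> Some ` T" using finT by auto
      show "w j \<in> alg (zz ` T)" if "j \<in> Some ` T" for j using that by (auto simp: w_def intro!: zin)
      show "\<not> algebraic_over (alg (zz ` T)) (w None)"
      proof
        assume "algebraic_over (alg (zz ` T)) (w None)"
        then obtain p m where p: "\<And>l. p l \<in> alg (zz ` T)" "\<exists>l\<le>m. p l \<noteq> 0"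
          "(\<Sum>l\<le>m. p l * (f \<circ> retr Z') ^ l) = 0" unfolding algebraic_over_def w_def by auto
        have p': "p l \<in> alg (zz ` S)" for l using p(1)[of l] alg_mono[of "zz ` T" "zz ` S"] T(1) by blast
        have f0: "f \<circ> retr Z' \<noteq> 0" unfolding comp_retr_eq_0[OF ne] using f(3) x0(1) by blast
        obtain l q where l: "p l \<noteq> 0" "p l = (f \<circ> retr Z') * q"
          using transcendental_of_vanishing[OF dom p' fin f0 p(3,2)] by blast
        obtain h where h: "h \<in> alg (coord ` T)" "p l = h \<circ> retr Z'"
          using alg_comp p(1)[of l] unfolding zz_def by blast
        have "h x = 0" if "x \<in> Z" for x
        proof -
          have "x \<in> Z'" using that sub by blast
          then show ?thesis using fun_cong[OF trans[OF h(2)[symmetric] l(2)], of x] f(2) that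
            by (simp add: fun_apply retr_id)
        qed
        then have "h = 0" using alg_independent_vanish[OF T(2) finT h(1)] by blast
        then have "p l = 0" unfolding h(2) by (simp add: fun_eq_iff fun_apply)
        then show False using l(1) by contradiction
      qed
    qed
    ultimately show False by blast
  qed
  then obtain T'' where T'': "T'' \<subseteq> T'" "card T'' = Suc (card T)"
    by (meson Suc_leI obtain_subset_with_card_n)
  have "finite T'" using T'(1) S finite_subset by blast
  then have "alg_independent_on Z' T'' coord" using alg_independent_on_subset[OF T'(2) T''(1)] by blast
  then show ?thesis using T'' T'(1) by blast
qed

lemma zchain_imp_independent:
  assumes S: "finite S" and off: "\<forall>x\<in>V. \<forall>i. i \<notin> S \<longrightarrow> x i = 0" and ch: "zchain V k"
  shows "\<exists>T\<subseteq>S. alg_independent_on V T coord \<and> card T = k"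
proof -
  obtain Z where Z: "\<And>i. i \<le> k \<Longrightarrow> zirred (Z i) \<and> Z i \<subseteq> V" "\<And>i. i < k \<Longrightarrow> Z i \<subset> Z (Suc i)"
    using ch unfolding zchain_def by blast
  have "j \<le> k \<Longrightarrow> \<exists>T\<subseteq>S. alg_independent_on (Z j) T coord \<and> card T = j" for j
  proof (induction j)
    case 0
    have "Z 0 \<noteq> {}" using Z(1)[of 0] unfolding zirred_def by blast
    then show ?case using alg_independent_empty[of "Z 0" coord] by (intro exI[of _ "{}"]) simp
  next
    case (Suc j)
    then obtain T where T: "T \<subseteq> S" "alg_independent_on (Z j) T coord" "card T = j" by auto
    have "zirred (Z j)" "zirred (Z (Suc j))" "Z j \<subset> Z (Suc j)" using Z(1)[of j] Z(1)[of "Suc j"] Z(2)[of j] Suc.prems by auto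
    moreover have "\<forall>x\<in>Z (Suc j). \<forall>i. i \<notin> S \<longrightarrow> x i = 0"
      using off Z(1)[OF Suc.prems] by blast
    ultimately show ?case using larger_independent_set[of "Z j" "Z (Suc j)" S T] S T by blast
  qed
  from this[of k] obtain T where "T \<subseteq> S" "alg_independent_on (Z k) T coord" "card T = k" by blast
  moreover have "Z k \<subseteq> V" using Z(1)[of k] by blast
  ultimately show ?thesis using alg_independent_on_mono by blast
qed

text \<open>Dimension becomes the maximal number of independent coordinates. The finite set
  \<open>S\<close> bounds the length of chains, which makes \<open>GREATEST\<close> meaningful even
  when the ambient space has infinitely many coordinates.\<close>

theorem zdim_eq_independent:
  fixes V :: "('a::countable \<Rightarrow> complex) set"
  assumes V: "zirred V" and S: "finite S" and off: "\<forall>x\<in>V. \<forall>i. i \<notin> S \<longrightarrow> x i = 0"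
  shows "\<exists>T\<subseteq>S. alg_independent_on V T coord \<and> card T = zdim V"
    and "finite T \<Longrightarrow> alg_independent_on V T coord \<Longrightarrow> card T \<le> zdim V"
proof -
  have bound: "k \<le> card S" if "zchain V k" for k
    using zchain_imp_independent[OF S off that] S card_mono by blast
  have "zchain V 0" using independent_imp_zchain[OF V, of "{}"] alg_independent_empty[of V coord] V
    unfolding zirred_def by auto
  then have "zchain V (zdim V)" unfolding zdim_def by (rule GreatestI_nat) (rule bound)
  then show "\<exists>T\<subseteq>S. alg_independent_on V T coord \<and> card T = zdim V"
    using zchain_imp_independent[OF S off] by blast
  show "card T \<le> zdim V" if "finite T" "alg_independent_on V T coord"
    unfolding zdim_def using independent_imp_zchain[OF V that] bound
    by (intro Greatest_le_nat[where P = "zchain V" and b = "card S"])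
qed

section \<open>Linear algebra over a domain of functions\<close>

text \<open>A nonzero element is demanded instead of the function 1: elements of
  \<open>regfun X\<close> are zero outside \<open>X\<close>, so 1 usually is not among them.\<close>

locale function_domain =
  fixes A :: "('b \<Rightarrow> complex) set"
  assumes zero_in: "0 \<in> A" and add_in: "f \<in> A \<Longrightarrow> g \<in> A \<Longrightarrow> f + g \<in> A"
    and uminus_in: "f \<in> A \<Longrightarrow> - f \<in> A" and mult_in: "f \<in> A \<Longrightarrow> g \<in> A \<Longrightarrow> f * g \<in> A"
    and nonzero_ex: "\<exists>u\<in>A. u \<noteq> 0"
    and mult_eq_0: "f \<in> A \<Longrightarrow> g \<in> A \<Longrightarrow> f * g = 0 \<Longrightarrow> f = 0 \<or> g = 0"
begin

lemma diff_in: "f \<in> A \<Longrightarrow> g \<in> A \<Longrightarrow> f - g \<in> A"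
  using add_in[of f "- g"] uminus_in by simp

lemma sum_in: "(\<And>i. i \<in> I \<Longrightarrow> f i \<in> A) \<Longrightarrow> (\<Sum>i\<in>I. f i) \<in> A"
  by (induction I rule: infinite_finite_induct) (auto intro: zero_in add_in)

lemma mult_nonzero: "f \<in> A \<Longrightarrow> g \<in> A \<Longrightarrow> f \<noteq> 0 \<Longrightarrow> g \<noteq> 0 \<Longrightarrow> f * g \<noteq> 0"
  using mult_eq_0 by blast

lemmas closed = zero_in add_in uminus_in mult_in diff_in sum_in

text \<open>Fraction-free Gaussian elimination of column \<open>\<gamma>\<close> with pivot
  \<open>M w0 \<gamma>\<close>.\<close>

definition eliminate :: "('w \<Rightarrow> 'j \<Rightarrow> 'b \<Rightarrow> complex) \<Rightarrow> 'w \<Rightarrow> 'j \<Rightarrow> 'w \<Rightarrow> 'j \<Rightarrow> 'b \<Rightarrow> complex" where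
  "eliminate M w0 \<gamma> w j = M w0 \<gamma> * M w j - M w \<gamma> * M w0 j"

text \<open>Back substitution: the entry at \<open>\<gamma>\<close> is determined by the pivot row
  after the other entries have been scaled by the pivot.\<close>

lemma eliminate_kernel:
  assumes "finite E" "\<gamma> \<in> E"
    and v: "(\<Sum>j\<in>E - {\<gamma>}. v j * eliminate M w0 \<gamma> w j) = 0"
  shows "(\<Sum>j\<in>E. (if j = \<gamma> then - (\<Sum>k\<in>E - {\<gamma>}. v k * M w0 k) else M w0 \<gamma> * v j) * M w j) = 0"
proof -
  have "(\<Sum>j\<in>E. (if j = \<gamma> then - (\<Sum>k\<in>E - {\<gamma>}. v k * M w0 k) else M w0 \<gamma> * v j) * M w j) =
    - (\<Sum>k\<in>E - {\<gamma>}. v k * M w0 k) * M w \<gamma> + (\<Sum>j\<in>E - {\<gamma>}. M w0 \<gamma> * v j * M w j)"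
    using assms(1,2) by (simp add: sum.remove[of E \<gamma>])
  also have "\<dots> = (\<Sum>j\<in>E - {\<gamma>}. v j * eliminate M w0 \<gamma> w j)"
    by (simp add: eliminate_def sum_distrib_left sum_distrib_right sum_subtractf algebra_simps)
  finally show ?thesis using v by simp
qed

text \<open>Over the fraction field: the coordinate functional at \<open>\<beta>\<close> either
  takes a nonzero value on the kernel or lies in the row space. Columns other than
  \<open>\<beta>\<close> are eliminated one by one, with denominators cleared; although
  \<open>W\<close> may be infinite, only finitely many rows are combined.\<close>

lemma kernel_or_row_combination:
  assumes "finite E" "\<beta> \<in> E" "\<forall>w\<in>W. \<forall>j\<in>E. M w j \<in> A"
  shows "(\<exists>v. (\<forall>j\<in>E. v j \<in> A) \<and> (\<forall>w\<in>W. (\<Sum>j\<in>E. v j * M w j) = 0) \<and> v \<beta> \<noteq> 0) \<or>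
    (\<exists>W0 a. finite W0 \<and> W0 \<subseteq> W \<and> (\<forall>w\<in>W0. a w \<in> A) \<and> (\<forall>j\<in>E - {\<beta>}. (\<Sum>w\<in>W0. a w * M w j) = 0) \<and>
      (\<Sum>w\<in>W0. a w * M w \<beta>) \<noteq> 0)"
  using assms
proof (induction "card E" arbitrary: E M)
  case 0
  then show ?case by auto
next
  case (Suc n)
  note M = Suc.prems(3)
  show ?case
  proof (cases "E = {\<beta>}")
    case True
    obtain u where u: "u \<in> A" "u \<noteq> 0" using nonzero_ex by blast
    show ?thesis
    proof (cases "\<forall>w\<in>W. M w \<beta> = 0")
      case True
      then show ?thesis using u \<open>E = {\<beta>}\<close> by (intro disjI1 exI[of _ "\<lambda>_. u"]) auto
    next
      case False
      then obtain w where w: "w \<in> W" "M w \<beta> \<noteq> 0" by blast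
      then have "u * M w \<beta> \<noteq> 0" using mult_nonzero u M Suc.prems(2) by blast
      then show ?thesis using w u \<open>E = {\<beta>}\<close>
        by (intro disjI2 exI[of _ "{w}"] exI[of _ "\<lambda>_. u"]) auto
    qed
  next
    case False
    then obtain \<gamma> where \<gamma>: "\<gamma> \<in> E" "\<gamma> \<noteq> \<beta>" using Suc.prems(2) by blast
    have card: "n = card (E - {\<gamma>})" using Suc.hyps(2) Suc.prems(1) \<gamma>(1) by simp
    have fin: "finite (E - {\<gamma>})" "\<beta> \<in> E - {\<gamma>}" using Suc.prems \<gamma> by auto
    show ?thesis
    proof (cases "\<forall>w\<in>W. M w \<gamma> = 0")
      case True
      have "\<forall>w\<in>W. \<forall>j\<in>E - {\<gamma>}. M w j \<in> A" using M by blast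
      from Suc.hyps(1)[of "E - {\<gamma>}" M, OF card fin this] show ?thesis
      proof (elim disjE exE conjE)
        fix v assume v: "\<forall>j\<in>E - {\<gamma>}. v j \<in> A" "\<forall>w\<in>W. (\<Sum>j\<in>E - {\<gamma>}. v j * M w j) = 0" "v \<beta> \<noteq> 0"
        have "(\<Sum>j\<in>E. (v(\<gamma> := 0)) j * M w j) = 0" if "w \<in> W" for w
          using v(2) that Suc.prems(1) \<gamma>(1) by (simp add: sum.remove[of E \<gamma>])
        then show ?thesis using v(1,3) \<gamma> zero_in by (intro disjI1 exI[of _ "v(\<gamma> := 0)"]) auto
      next
        fix W0 a assume "finite W0" "W0 \<subseteq> W" "\<forall>w\<in>W0. a w \<in> A"
          "\<forall>j\<in>E - {\<gamma>} - {\<beta>}. (\<Sum>w\<in>W0. a w * M w j) = 0" "(\<Sum>w\<in>W0. a w * M w \<beta>) \<noteq> 0"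
        moreover have "(\<Sum>w\<in>W0. a w * M w \<gamma>) = 0" using True \<open>W0 \<subseteq> W\<close> by (intro sum.neutral) auto
        ultimately show ?thesis by (intro disjI2 exI[of _ W0] exI[of _ a]) auto
      qed
    next
      case False
      then obtain w0 where w0: "w0 \<in> W" "M w0 \<gamma> \<noteq> 0" by blast
      define \<pi> where "\<pi> = M w0 \<gamma>"
      have \<pi>: "\<pi> \<in> A" "\<pi> \<noteq> 0" using w0 M \<gamma> by (auto simp: \<pi>_def)
      have "\<forall>w\<in>W. \<forall>j\<in>E - {\<gamma>}. eliminate M w0 \<gamma> w j \<in> A"
        unfolding eliminate_def using M w0 \<gamma>(1) by (intro ballI diff_in mult_in) auto
      from Suc.hyps(1)[of "E - {\<gamma>}" "eliminate M w0 \<gamma>", OF card fin this] show ?thesis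
      proof (elim disjE exE conjE)
        fix v assume v: "\<forall>j\<in>E - {\<gamma>}. v j \<in> A" "\<forall>w\<in>W. (\<Sum>j\<in>E - {\<gamma>}. v j * eliminate M w0 \<gamma> w j) = 0" "v \<beta> \<noteq> 0"
        define v' where "v' j = (if j = \<gamma> then - (\<Sum>k\<in>E - {\<gamma>}. v k * M w0 k) else M w0 \<gamma> * v j)" for j
        have "(\<Sum>j\<in>E. v' j * M w j) = 0" if "w \<in> W" for w
          unfolding v'_def by (rule eliminate_kernel[OF Suc.prems(1) \<gamma>(1)]) (use v(2) that in blast)
        moreover have "v' j \<in> A" if "j \<in> E" for j
          unfolding v'_def using that v(1) w0(1) M \<gamma>(1) by (auto intro!: uminus_in sum_in mult_in)
        moreover have "v' \<beta> \<noteq> 0"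
          using mult_nonzero[OF \<pi>(1) _ \<pi>(2) v(3)] v(1) fin(2) \<gamma>(2) by (simp add: v'_def \<pi>_def)
        ultimately show ?thesis by (intro disjI1 exI[of _ v']) blast
      next
        fix W0 a assume W0: "finite W0" "W0 \<subseteq> W" "\<forall>w\<in>W0. a w \<in> A"
          and a0: "\<forall>j\<in>E - {\<gamma>} - {\<beta>}. (\<Sum>w\<in>W0. a w * eliminate M w0 \<gamma> w j) = 0"
          and nz: "(\<Sum>w\<in>W0. a w * eliminate M w0 \<gamma> w \<beta>) \<noteq> 0"
        define s where "s = (\<Sum>w\<in>W0. a w * M w \<gamma>)"
        \<comment> \<open>Each eliminated row is the pivot times row \<open>w\<close> minus a
          multiple of row \<open>w0\<close>; these multiples add up to \<open>s\<close>. The two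
          parts are kept additive because \<open>w0\<close> may already belong to
          \<open>W0\<close>.\<close>
        define a' where "a' w = (if w \<in> W0 then \<pi> * a w else 0) - (if w = w0 then s else 0)" for w
        have s: "s \<in> A" unfolding s_def using W0 M \<gamma>(1) by (intro sum_in mult_in) auto
        have eq: "(\<Sum>w\<in>insert w0 W0. a' w * M w j) = (\<Sum>w\<in>W0. a w * eliminate M w0 \<gamma> w j)" for j
        proof -
          have "(\<Sum>w\<in>insert w0 W0. a' w * M w j) =
            (\<Sum>w\<in>insert w0 W0. (if w \<in> W0 then \<pi> * a w * M w j else 0)) - (\<Sum>w\<in>insert w0 W0. if w = w0 then s * M w j else 0)"
            unfolding a'_def sum_subtractf[symmetric] by (intro sum.cong refl) (auto simp: left_diff_distrib)
          also have "(\<Sum>w\<in>insert w0 W0. (if w \<in> W0 then \<pi> * a w * M w j else 0)) = (\<Sum>w\<in>W0. \<pi> * a w * M w j)"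
            using W0(1) by (intro sum.mono_neutral_cong_right) auto
          also have "(\<Sum>w\<in>insert w0 W0. if w = w0 then s * M w j else 0) = s * M w0 j"
            using W0(1) by (simp add: sum.delta)
          finally show ?thesis
            by (simp add: s_def \<pi>_def eliminate_def sum_distrib_left sum_distrib_right sum_subtractf algebra_simps)
        qed
        have "(\<Sum>w\<in>insert w0 W0. a' w * M w \<gamma>) = 0" unfolding eq by (intro sum.neutral) (simp add: eliminate_def algebra_simps)
        then have "(\<Sum>w\<in>insert w0 W0. a' w * M w j) = 0" if "j \<in> E - {\<beta>}" for j
        proof (cases "j = \<gamma>")
          case False
          then show ?thesis using a0 that unfolding eq by blast
        qed simp
        moreover have "(\<Sum>w\<in>insert w0 W0. a' w * M w \<beta>) \<noteq> 0" unfolding eq by (rule nz)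
        moreover have "a' w \<in> A" if "w \<in> insert w0 W0" for w
          unfolding a'_def using W0(3) \<pi>(1) s by (auto intro!: diff_in mult_in zero_in uminus_in)
        ultimately show ?thesis using W0 w0 by (intro disjI2 exI[of _ "insert w0 W0"] exI[of _ a']) blast
      qed
    qed
  qed
qed

text \<open>This is lower semicontinuity of the rank of the matrix \<open>M\<close>.\<close>
lemma kernel_specialises:
  assumes "finite E" "\<forall>w\<in>W. \<forall>j\<in>E. M w j \<in> A"
    "\<forall>j\<in>E. v j \<in> A" "\<forall>w\<in>W. (\<Sum>j\<in>E. v j * M w j) = 0" "\<exists>j\<in>E. v j \<noteq> 0"
  shows "\<exists>f :: 'j \<Rightarrow> complex. (\<exists>j\<in>E. f j \<noteq> 0) \<and> (\<forall>w\<in>W. (\<Sum>j\<in>E. f j * M w j x) = 0)"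
  using assms
proof (induction "card E" arbitrary: E M)
  case 0
  then show ?case by auto
next
  case (Suc n)
  note M = Suc.prems(2) and v = Suc.prems(3-5)
  show ?case
  proof (cases "\<forall>w\<in>W. \<forall>j\<in>E. M w j x = 0")
    case True
    then show ?thesis using v(3) by (intro exI[of _ "\<lambda>_. 1"]) auto
  next
    case False
    then obtain w0 \<gamma> where w0: "w0 \<in> W" "\<gamma> \<in> E" "M w0 \<gamma> x \<noteq> 0" by blast
    have \<pi>: "M w0 \<gamma> \<in> A" "M w0 \<gamma> \<noteq> 0" using w0 M by (auto simp: fun_apply)
    have card: "n = card (E - {\<gamma>})" and fin: "finite (E - {\<gamma>})" using Suc.hyps(2) Suc.prems(1) w0(2) by auto
    have split: "(\<Sum>j\<in>E - {\<gamma>}. v j * M w j) = - (v \<gamma> * M w \<gamma>)" if "w \<in> W" for w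
      using bspec[OF v(2) that] Suc.prems(1) w0(2) by (simp add: sum.remove[of E \<gamma>] eq_neg_iff_add_eq_0 add.commute)
    have el: "\<forall>w\<in>W. \<forall>j\<in>E - {\<gamma>}. eliminate M w0 \<gamma> w j \<in> A"
      unfolding eliminate_def using M w0 by (intro ballI diff_in mult_in) auto
    have ker: "\<forall>w\<in>W. (\<Sum>j\<in>E - {\<gamma>}. v j * eliminate M w0 \<gamma> w j) = 0"
    proof
      fix w assume w: "w \<in> W"
      have "(\<Sum>j\<in>E - {\<gamma>}. v j * eliminate M w0 \<gamma> w j) =
        M w0 \<gamma> * (\<Sum>j\<in>E - {\<gamma>}. v j * M w j) - M w \<gamma> * (\<Sum>j\<in>E - {\<gamma>}. v j * M w0 j)"
        by (simp add: eliminate_def sum_distrib_left sum_subtractf algebra_simps)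
      then show "(\<Sum>j\<in>E - {\<gamma>}. v j * eliminate M w0 \<gamma> w j) = 0"
        using split[OF w] split[OF w0(1)] by (simp add: algebra_simps)
    qed
    \<comment> \<open>If only the entry at \<open>\<gamma>\<close> were nonzero, the pivot row would
      say that its product with the pivot is zero.\<close>
    have nz: "\<exists>j\<in>E - {\<gamma>}. v j \<noteq> 0"
    proof (rule ccontr)
      assume no: "\<not> ?thesis"
      then have "v \<gamma> \<noteq> 0" using v(3) by blast
      have "(\<Sum>j\<in>E - {\<gamma>}. v j * M w0 j) = 0" using no by (intro sum.neutral) auto
      then have "v \<gamma> * M w0 \<gamma> = 0" using split[OF w0(1)] by simp
      then show False using mult_nonzero[OF bspec[OF v(1) w0(2)] \<pi>(1) \<open>v \<gamma> \<noteq> 0\<close> \<pi>(2)] by blast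
    qed
    have v': "\<forall>j\<in>E - {\<gamma>}. v j \<in> A" using v(1) by blast
    from Suc.hyps(1)[of "E - {\<gamma>}" "eliminate M w0 \<gamma>", OF card fin el v' ker nz] obtain f :: "'j \<Rightarrow> complex" where
      f: "\<exists>j\<in>E - {\<gamma>}. f j \<noteq> 0" "\<And>w. w \<in> W \<Longrightarrow> (\<Sum>j\<in>E - {\<gamma>}. f j * eliminate M w0 \<gamma> w j x) = 0" by auto
    define f' where "f' j = (if j = \<gamma> then - (\<Sum>k\<in>E - {\<gamma>}. f k * M w0 k x) else M w0 \<gamma> x * f j)" for j
    have "(\<Sum>j\<in>E. f' j * M w j x) = 0" if "w \<in> W" for w
    proof -
      \<comment> \<open>The values at \<open>x\<close> are fed back as constant functions, so that
        the same identity performs the back substitution at the point.\<close>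
      have "(\<Sum>j\<in>E - {\<gamma>}. (\<lambda>_. f j) * eliminate (\<lambda>w j _. M w j x) w0 \<gamma> w j) = (0 :: 'b \<Rightarrow> complex)"
        by (rule ext) (use f(2)[OF that] in \<open>simp add: fun_apply eliminate_def\<close>)
      from fun_cong[OF eliminate_kernel[OF Suc.prems(1) w0(2) this], of x]
      show ?thesis by (simp add: fun_apply f'_def if_distrib[of "\<lambda>g. g _"] cong: if_cong)
    qed
    moreover have "\<exists>j\<in>E. f' j \<noteq> 0" using f(1) w0(3) by (auto simp: f'_def)
    ultimately show ?thesis by (intro exI[of _ f']) blast
  qed
qed

end

section \<open>Derivations on the ring of regular functions\<close>

definition rst :: "('a \<Rightarrow> complex) set \<Rightarrow> (('a \<Rightarrow> complex) \<Rightarrow> complex) \<Rightarrow> ('a \<Rightarrow> complex) \<Rightarrow> complex" where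
  "rst X p x = (if x \<in> X then p x else 0)"

lemma regfun_eq: "regfun X = rst X ` polyfun"
  unfolding regfun_def rst_def by (auto simp: fun_eq_iff image_iff)

lemma rst_in: "p \<in> polyfun \<Longrightarrow> rst X p \<in> regfun X"
  unfolding regfun_eq by blast

lemma regfunE: "f \<in> regfun X \<Longrightarrow> (\<And>p. p \<in> polyfun \<Longrightarrow> f = rst X p \<Longrightarrow> thesis) \<Longrightarrow> thesis"
  unfolding regfun_eq by blast

lemma rst_0: "rst X 0 = 0" and rst_add: "rst X (f + g) = rst X f + rst X g"
  and rst_mult: "rst X (f * g) = rst X f * rst X g" and rst_uminus: "rst X (- f) = - rst X f"
  and rst_scale: "rst X ((\<lambda>_. c) * f) = (\<lambda>_. c) * rst X f"
  by (auto simp: rst_def fun_eq_iff fun_apply)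

lemma rst_eq_0: "rst X p = 0 \<longleftrightarrow> (\<forall>x\<in>X. p x = 0)"
  by (auto simp: rst_def fun_eq_iff fun_apply)

lemma regfun_outside: "f \<in> regfun X \<Longrightarrow> x \<notin> X \<Longrightarrow> f x = 0"
  by (auto simp: regfun_eq rst_def)

lemma regfun_eq_0: "f \<in> regfun X \<Longrightarrow> f = 0 \<longleftrightarrow> (\<forall>x\<in>X. f x = 0)"
  using regfun_outside[of f X] by (auto simp: fun_eq_iff fun_apply)

lemma derivationD:
  assumes D: "derivation X D" and f: "f \<in> regfun X" and g: "g \<in> regfun X"
  shows "D f \<in> regfun X" "D (f + g) = D f + D g" "D ((\<lambda>_. c) * f) = (\<lambda>_. c) * D f"
    "D (f * g) = f * D g + g * D f"
proof -
  note d = conjunct2[OF D[unfolded derivation_def]]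
  note add = conjunct1[OF conjunct2[OF d]] and scale = conjunct1[OF conjunct2[OF conjunct2[OF d]]]
    and mult = conjunct2[OF conjunct2[OF conjunct2[OF d]]]
  show "D f \<in> regfun X" using conjunct1[OF d] f by (rule bspec)
  show "D (f + g) = D f + D g" using bspec[OF bspec[OF add f] g] unfolding plus_fun_def .
  show "D ((\<lambda>_. c) * f) = (\<lambda>_. c) * D f" using bspec[OF spec[OF scale] f] unfolding times_fun_def .
  show "D (f * g) = f * D g + g * D f"
    using bspec[OF bspec[OF mult f] g] unfolding times_fun_def plus_fun_def .
qed

locale foliated =
  fixes X :: "('n::finite \<Rightarrow> complex) set"
    and Fs :: "((('n \<Rightarrow> complex) \<Rightarrow> complex) \<Rightarrow> (('n \<Rightarrow> complex) \<Rightarrow> complex)) set"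
  assumes irr: "zirred X" and der: "D \<in> Fs \<Longrightarrow> derivation X D"
begin

abbreviation A where "A \<equiv> regfun X"

lemma X_nonempty: "X \<noteq> {}" and X_closed: "zclosed X"
  using irr unfolding zirred_def by auto

lemma A_add: "f \<in> A \<Longrightarrow> g \<in> A \<Longrightarrow> f + g \<in> A"
  by (elim regfunE) (auto simp: rst_add[symmetric] intro: rst_in polyfun_closed)

lemma A_mult: "f \<in> A \<Longrightarrow> g \<in> A \<Longrightarrow> f * g \<in> A"
  by (elim regfunE) (auto simp: rst_mult[symmetric] intro: rst_in polyfun_closed)

lemma A_scale: "f \<in> A \<Longrightarrow> (\<lambda>_. c) * f \<in> A"
  by (elim regfunE) (auto simp: rst_scale[symmetric] intro: rst_in polyfun_closed)

lemma A_0: "0 \<in> A"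
  using rst_in[OF polyfun_0, of X] by (simp add: rst_0)

lemma A_uminus: "f \<in> A \<Longrightarrow> - f \<in> A"
  by (elim regfunE) (auto simp: rst_uminus[symmetric] intro: rst_in polyfun_closed)

lemma A_domain: "f \<in> A \<Longrightarrow> g \<in> A \<Longrightarrow> f * g = 0 \<Longrightarrow> f = 0 \<or> g = 0"
proof (elim regfunE)
  fix p q assume pq: "p \<in> polyfun" "q \<in> polyfun" "f = rst X p" "g = rst X q" "f * g = 0"
  then have "rst X (p * q) = 0" by (simp add: rst_mult)
  then show ?thesis using zirred_no_zero_divisors[OF irr pq(1,2)] pq(3,4)
    unfolding rst_eq_0 times_fun_def by (auto simp: rst_eq_0)
qed

abbreviation unit where "unit \<equiv> rst X 1"

lemma unit_in: "unit \<in> A" by (rule rst_in[OF polyfun_1])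

lemma unit_nonzero: "unit \<noteq> 0"
  using X_nonempty unfolding rst_eq_0 by (auto simp: fun_apply)

lemma unit_mult: "f \<in> A \<Longrightarrow> unit * f = f"
  by (auto simp: fun_eq_iff fun_apply rst_def regfun_outside)

sublocale function_domain A
proof
  show "\<exists>u\<in>A. u \<noteq> 0" by (intro bexI[of _ unit] unit_nonzero unit_in)
  show "0 \<in> A" by (fact A_0)
  fix f g assume f: "f \<in> A" and g: "g \<in> A"
  show "f + g \<in> A" "f * g \<in> A" "- f \<in> A" by (fact A_add[OF f g] A_mult[OF f g] A_uminus[OF f])+
  show "f * g = 0 \<Longrightarrow> f = 0 \<or> g = 0" by (fact A_domain[OF f g])
qed

lemma
  assumes D: "D \<in> Fs" and f: "f \<in> A"
  shows D_in: "D f \<in> A"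
    and D_add: "g \<in> A \<Longrightarrow> D (f + g) = D f + D g"
    and D_scale: "D ((\<lambda>_. c) * f) = (\<lambda>_. c) * D f"
    and D_mult: "g \<in> A \<Longrightarrow> D (f * g) = f * D g + g * D f"
proof -
  show "D f \<in> A" by (fact derivationD(1)[OF der[OF D] f f])
  show "D ((\<lambda>_. c) * f) = (\<lambda>_. c) * D f" by (fact derivationD(3)[OF der[OF D] f f])
  assume g: "g \<in> A"
  show "D (f + g) = D f + D g" by (fact derivationD(2)[OF der[OF D] f g])
  show "D (f * g) = f * D g + g * D f" by (fact derivationD(4)[OF der[OF D] f g])
qed

lemma D_0: "D \<in> Fs \<Longrightarrow> D 0 = 0"
  using D_add[of D 0 0] A_0 by simp

lemma D_sum: "D \<in> Fs \<Longrightarrow> (\<And>i. i \<in> I \<Longrightarrow> f i \<in> A) \<Longrightarrow> D (\<Sum>i\<in>I. f i) = (\<Sum>i\<in>I. D (f i))"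
  by (induction I rule: infinite_finite_induct) (auto simp: D_0 D_add sum_in)

lemma D_unit: "D \<in> Fs \<Longrightarrow> D unit = 0"
  using D_mult[of D unit unit] D_in[of D unit] unit_in by (simp add: unit_mult)

section \<open>Words of derivations and the ideal I(F,x)\<close>

definition apply_word where "apply_word w f = foldr (\<lambda>D. D) w f"

lemma apply_word_Nil [simp]: "apply_word [] f = f"
  and apply_word_Cons [simp]: "apply_word (D # w) f = D (apply_word w f)"
  and apply_word_snoc: "apply_word (w @ [D]) f = apply_word w (D f)"
  by (simp_all add: apply_word_def)

lemma apply_word_in: "w \<in> lists Fs \<Longrightarrow> f \<in> A \<Longrightarrow> apply_word w f \<in> A"
proof (induction w)
  case (Cons D w)
  then show ?case using D_in[of D "apply_word w f"] by simp
qed simp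

lemma apply_word_add: "w \<in> lists Fs \<Longrightarrow> f \<in> A \<Longrightarrow> g \<in> A \<Longrightarrow> apply_word w (f + g) = apply_word w f + apply_word w g"
proof (induction w)
  case (Cons D w)
  then show ?case using D_add[of D "apply_word w f" "apply_word w g"] apply_word_in[of w] by simp
qed simp

lemma apply_word_0: "w \<in> lists Fs \<Longrightarrow> apply_word w 0 = 0"
proof (induction w)
  case (Cons D w)
  then show ?case using D_0[of D] by simp
qed simp

lemma apply_word_scale: "w \<in> lists Fs \<Longrightarrow> f \<in> A \<Longrightarrow> apply_word w ((\<lambda>_. c) * f) = (\<lambda>_. c) * apply_word w f"
proof (induction w)
  case (Cons D w)
  then show ?case using D_scale[of D "apply_word w f" c] apply_word_in[of w] by simp
qed simp

lemma apply_word_lincomb: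
  assumes "w \<in> lists Fs" "\<And>i. i \<in> I \<Longrightarrow> f i \<in> A"
  shows "apply_word w (\<Sum>i\<in>I. (\<lambda>_. c i) * f i) = (\<Sum>i\<in>I. (\<lambda>_. c i) * apply_word w (f i))"
  using assms(2)
proof (induction I rule: infinite_finite_induct)
  case (insert i I)
  then show ?case
    using apply_word_add[OF assms(1) A_scale[of "f i" "c i"] sum_in[of I "\<lambda>i. (\<lambda>_. c i) * f i"]]
    by (simp add: apply_word_scale[OF assms(1)] A_scale)
qed (simp_all add: apply_word_0[OF assms(1)])

definition Iw :: "('n \<Rightarrow> complex) \<Rightarrow> (('n \<Rightarrow> complex) \<Rightarrow> complex) set" where
  "Iw x = {f \<in> A. \<forall>w\<in>lists Fs. apply_word w f x = 0}"

lemma IwD: "f \<in> Iw x \<Longrightarrow> w \<in> lists Fs \<Longrightarrow> apply_word w f x = 0"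
  and Iw_in: "f \<in> Iw x \<Longrightarrow> f \<in> A"
  by (auto simp: Iw_def)

definition invariant_ideal :: "(('n \<Rightarrow> complex) \<Rightarrow> complex) set \<Rightarrow> bool" where
  "invariant_ideal I \<longleftrightarrow> I \<subseteq> A \<and> 0 \<in> I \<and> (\<forall>f\<in>I. \<forall>g\<in>I. f + g \<in> I) \<and> (\<forall>f\<in>I. \<forall>g\<in>A. g * f \<in> I) \<and>
     (\<forall>D\<in>Fs. D ` I \<subseteq> I)"

lemma invariant_idealI:
  assumes "I \<subseteq> A" "0 \<in> I" "\<And>f g. f \<in> I \<Longrightarrow> g \<in> I \<Longrightarrow> f + g \<in> I"
    "\<And>f g. f \<in> I \<Longrightarrow> g \<in> A \<Longrightarrow> g * f \<in> I" "\<And>D. D \<in> Fs \<Longrightarrow> D ` I \<subseteq> I"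
  shows "invariant_ideal I"
  unfolding invariant_ideal_def
proof (intro conjI ballI)
  show "I \<subseteq> A" by (fact assms(1))
  show "0 \<in> I" by (fact assms(2))
  fix f assume f: "f \<in> I"
  show "f + g \<in> I" if "g \<in> I" for g by (fact assms(3)[OF f that])
  show "g * f \<in> I" if "g \<in> A" for g by (fact assms(4)[OF f that])
next
  fix D assume "D \<in> Fs"
  then show "D ` I \<subseteq> I" by (fact assms(5))
qed

lemma invariant_ideal_D:
  assumes I: "invariant_ideal I" and D: "D \<in> Fs" and f: "f \<in> I"
  shows "D f \<in> I"
proof -
  have "D ` I \<subseteq> I" using I D unfolding invariant_ideal_def by simp
  then show ?thesis using f by (simp add: image_subset_iff)
qed

text \<open>Leibniz's rule, by induction on the innermost letter of the word: both terms of
  \<open>D (g * f)\<close> are again products of a ring element with a member of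
  \<open>Iw x\<close>, and the remaining word is shorter.\<close>

lemma Iw_mult:
  assumes "f \<in> Iw x" "g \<in> A"
  shows "g * f \<in> Iw x"
proof -
  have "apply_word w (g * f) x = 0" if "w \<in> lists Fs" "f \<in> Iw x" "g \<in> A" for w f g
    using that
  proof (induction w arbitrary: f g rule: rev_induct)
    case Nil
    then show ?case by (auto simp: Iw_def fun_apply dest: bspec[of _ _ "[]"])
  next
    case (snoc D w)
    have D: "D \<in> Fs" and w: "w \<in> lists Fs" using snoc.prems by auto
    have f: "f \<in> A" using snoc.prems by (simp add: Iw_def)
    have Df: "D f \<in> Iw x"
      unfolding Iw_def
    proof (intro CollectI conjI ballI)
      show "D f \<in> A" by (rule D_in[OF D f])
      fix w' assume "w' \<in> lists Fs"
      then have "w' @ [D] \<in> lists Fs" using D by simp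
      from IwD[OF snoc.prems(2) this] show "apply_word w' (D f) x = 0" by (simp only: apply_word_snoc)
    qed
    have Dg: "D g \<in> A" by (rule D_in[OF D snoc.prems(3)])
    have eq: "apply_word (w @ [D]) (g * f) = apply_word w (g * D f) + apply_word w (D g * f)"
      unfolding apply_word_snoc D_mult[OF D snoc.prems(3) f] mult.commute[of f]
      by (rule apply_word_add[OF w]) (use Dg f snoc.prems(3) Df in \<open>auto intro: A_mult simp: Iw_def\<close>)
    show ?case using fun_cong[OF eq, of x] snoc.IH[OF w Df snoc.prems(3)] snoc.IH[OF w snoc.prems(2) Dg]
      unfolding plus_fun_apply by simp
  qed
  then show ?thesis using assms by (auto simp: Iw_def intro: A_mult)
qed

lemma invariant_ideal_Iw: "invariant_ideal (Iw x)"
proof (rule invariant_idealI)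
  show "Iw x \<subseteq> A" by (auto simp: Iw_def)
  have "apply_word w 0 x = 0" if "w \<in> lists Fs" for w
    unfolding apply_word_0[OF that] by (rule zero_fun_apply)
  then show "0 \<in> Iw x" by (simp add: Iw_def A_0)
  fix f g assume f: "f \<in> Iw x"
  show "f + g \<in> Iw x" if g: "g \<in> Iw x"
  proof -
    have "apply_word w (f + g) x = 0" if w: "w \<in> lists Fs" for w
      unfolding apply_word_add[OF w Iw_in[OF f] Iw_in[OF g]] plus_fun_apply
      using IwD[OF f w] IwD[OF g w] by simp
    then show ?thesis using A_add[OF Iw_in[OF f] Iw_in[OF g]] by (simp add: Iw_def)
  qed
  show "g * f \<in> Iw x" if "g \<in> A" by (rule Iw_mult[OF f that])
next
  fix D assume D: "D \<in> Fs"
  show "D ` Iw x \<subseteq> Iw x"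
  proof (rule image_subsetI)
    fix f assume f: "f \<in> Iw x"
    have "apply_word w (D f) x = 0" if "w \<in> lists Fs" for w
    proof -
      have "w @ [D] \<in> lists Fs" using that D by simp
      from IwD[OF f this] show ?thesis by (simp only: apply_word_snoc)
    qed
    then show "D f \<in> Iw x" using D_in[OF D Iw_in[OF f]] by (simp add: Iw_def)
  qed
qed

lemma Iw_maximal:
  assumes I: "invariant_ideal I" and x: "\<And>f. f \<in> I \<Longrightarrow> f x = 0"
  shows "I \<subseteq> Iw x"
proof
  fix f assume f: "f \<in> I"
  have "apply_word w f \<in> I" if "w \<in> lists Fs" for w
    using that
  proof (induction w)
    case (Cons D w)
    then have D: "D \<in> Fs" and IH: "apply_word w f \<in> I" by simp_all
    show ?case using invariant_ideal_D[OF I D IH] by (simp only: apply_word_Cons)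
  qed (use f in simp)
  moreover have "f \<in> A" using f I unfolding invariant_ideal_def by (elim conjE) (rule subsetD)
  ultimately show "f \<in> Iw x" using x by (simp add: Iw_def)
qed

lemma Iw_vanish: "f \<in> Iw x \<Longrightarrow> f x = 0"
  by (auto simp: Iw_def dest: bspec[of _ _ "[]"])

lemma inv_ideal_eq_Iw: "inv_ideal X Fs {x} = Iw x"
proof -
  have eq: "ideal_of X I \<and> I \<subseteq> vanishing_ideal X {x} \<and> (\<forall>D\<in>Fs. \<forall>f\<in>I. D f \<in> I) \<longleftrightarrow>
    invariant_ideal I \<and> (\<forall>f\<in>I. f x = 0)" for I
  proof -
    have "I \<subseteq> A \<Longrightarrow> I \<subseteq> vanishing_ideal X {x} \<longleftrightarrow> (\<forall>f\<in>I. f x = 0)"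
      unfolding vanishing_ideal_def by auto
    then show ?thesis
      unfolding ideal_of_def invariant_ideal_def plus_fun_def times_fun_def zero_fun_def image_subset_iff by argo
  qed
  show ?thesis unfolding inv_ideal_def eq
  proof (intro subset_antisym subsetI)
    fix f assume "f \<in> \<Union>{I. invariant_ideal I \<and> (\<forall>f\<in>I. f x = 0)}"
    then obtain I where "invariant_ideal I" "\<forall>f\<in>I. f x = 0" "f \<in> I" by auto
    then show "f \<in> Iw x" using Iw_maximal[of I x] by auto
  next
    fix f assume "f \<in> Iw x"
    then show "f \<in> \<Union>{I. invariant_ideal I \<and> (\<forall>f\<in>I. f x = 0)}"
      by (intro UnionI[of "Iw x"]) (simp_all add: invariant_ideal_Iw Iw_vanish)
  qed
qed

lemma Iw_0: "0 \<in> Iw x" and Iw_add: "f \<in> Iw x \<Longrightarrow> g \<in> Iw x \<Longrightarrow> f + g \<in> Iw x"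
  using invariant_ideal_Iw[of x] unfolding invariant_ideal_def by simp_all

lemma Iw_D:
  assumes "D \<in> Fs" "f \<in> Iw x"
  shows "D f \<in> Iw x"
  by (fact invariant_ideal_D[OF invariant_ideal_Iw assms])

lemma Iw_uminus: "f \<in> Iw x \<Longrightarrow> - f \<in> Iw x"
  using Iw_mult[of f x "- unit"] A_uminus[OF unit_in] unit_mult[OF Iw_in[of f x]] by simp

lemma Iw_diff: "f \<in> Iw x \<Longrightarrow> g \<in> Iw x \<Longrightarrow> f - g \<in> Iw x"
  using Iw_add[of f x "- g"] Iw_uminus[of g x] by simp

lemma Iw_sum: "(\<And>i. i \<in> K \<Longrightarrow> h i \<in> Iw x) \<Longrightarrow> (\<Sum>i\<in>K. h i) \<in> Iw x"
  by (induction K rule: infinite_finite_induct) (simp_all add: Iw_0 Iw_add)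

lemma Iw_of_nat: "f \<in> Iw x \<Longrightarrow> of_nat c * f \<in> Iw x"
  by (induction c) (simp_all add: Iw_0 Iw_add distrib_right)

lemma Iw_scale: "f \<in> Iw x \<Longrightarrow> (\<lambda>_. c) * f \<in> Iw x"
  using Iw_mult[of f x "(\<lambda>_. c) * unit"] A_scale[OF unit_in, of c] unit_mult[OF Iw_in[of f x]]
  by (simp add: mult.assoc)

section \<open>Radicality and primality of I(F,x)\<close>

lemma A_power: "f \<in> A \<Longrightarrow> f ^ Suc n \<in> A"
  by (induction n) (simp_all add: A_mult)

lemma D_power:
  assumes D: "D \<in> Fs" and f: "f \<in> A"
  shows "D (f ^ Suc m) = of_nat (Suc m) * (f ^ m * D f)"
proof (induction m)
  case (Suc m)
  have "D (f ^ Suc (Suc m)) = f * D (f ^ Suc m) + f ^ Suc m * D f"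
    using D_mult[OF D f A_power[OF f, of m]] by simp
  then show ?case unfolding Suc by (simp add: algebra_simps)
qed simp

lemma Iw_power_mono:
  assumes f: "f \<in> A" "f ^ Suc n \<in> Iw x" and m: "Suc n \<le> m"
  shows "f ^ m \<in> Iw x"
proof (cases "m = Suc n")
  case False
  then have "m = Suc (m - Suc n - 1) + Suc n" using m by simp
  then show ?thesis using Iw_mult[OF f(2) A_power[OF f(1), of "m - Suc n - 1"]] by (metis power_add)
qed (use f in simp)

text \<open>In each term of the binomial expansion either \<open>f\<close> has exponent at least
  \<open>Suc n\<close> or \<open>g\<close> has exponent at least \<open>Suc m\<close>.\<close>

lemma Iw_radical_add:
  assumes f: "f \<in> A" "f ^ Suc n \<in> Iw x" and g: "g \<in> A" "g ^ Suc m \<in> Iw x"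
  shows "(f + g) ^ Suc (n + m + 1) \<in> Iw x"
  unfolding binomial_ring
proof (rule Iw_sum)
  fix k assume "k \<in> {..Suc (n + m + 1)}"
  let ?l = "Suc (n + m + 1) - k"
  have "f ^ k * g ^ ?l \<in> Iw x"
  proof (cases "Suc n \<le> k")
    case True
    have fk: "f ^ k \<in> Iw x" by (rule Iw_power_mono[OF f True])
    then show ?thesis
    \<comment> \<open>The zeroth power is the function 1, which need not belong to \<open>A\<close>;
      hence it is treated apart.\<close>
    proof (cases ?l)
      case (Suc l)
      show ?thesis unfolding Suc mult.commute[of "f ^ k"] by (rule Iw_mult[OF fk A_power[OF g(1)]])
    qed simp
  next
    case False
    have gl: "g ^ ?l \<in> Iw x" by (rule Iw_power_mono[OF g]) (use False in simp)
    then show ?thesis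
    proof (cases k)
      case (Suc l)
      show ?thesis unfolding Suc by (rule Iw_mult[OF gl[unfolded Suc] A_power[OF f(1)]])
    qed simp
  qed
  from Iw_of_nat[OF this] show "of_nat (Suc (n + m + 1) choose k) * f ^ k * g ^ ?l \<in> Iw x"
    by (simp only: mult.assoc)
qed

text \<open>Differentiating \<open>f ^ (n - k) * (D f) ^ (2 * k)\<close> and multiplying by \<open>D f\<close> trades one factor \<open>f\<close>
  for two factors \<open>D f\<close>, modulo the ideal.\<close>
lemma Iw_radical_D:
  assumes f: "f \<in> A" "f ^ Suc n \<in> Iw x" and D: "D \<in> Fs"
  shows "D f ^ Suc (2 * n + 1) \<in> Iw x"
proof -
  have Df: "D f \<in> A" and DDf: "D (D f) \<in> A" using D_in[OF D f(1)] D_in[OF D D_in[OF D f(1)]] by simp_all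
  have "k \<le> Suc n \<Longrightarrow> f ^ (Suc n - k) * D f ^ (2 * k) \<in> Iw x" for k
  proof (induction k)
    case 0
    then show ?case using f by simp
  next
    case (Suc k)
    define j where "j = n - k"
    have j: "Suc n - k = Suc j" "Suc n - Suc k = j" using Suc.prems by (auto simp: j_def)
    define g where "g = f ^ Suc j * D f ^ (2 * k)"
    define h where "h = f ^ j * D f ^ (2 * Suc k)"
    have g: "g \<in> Iw x" using Suc j by (simp add: g_def)
    have hA: "h \<in> A"
    proof (cases j)
      case 0
      then show ?thesis using A_power[OF Df, of "2 * k + 1"] by (simp add: h_def)
    next
      case (Suc i)
      then show ?thesis using A_mult[OF A_power[OF f(1), of i] A_power[OF Df, of "2 * k + 1"]] by (simp add: h_def)
    qed
    have eq: "D f * D g = of_nat (Suc j) * h + of_nat (2 * k) * (D (D f) * g)"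
    proof (cases k)
      case 0
      then show ?thesis using D_power[OF D f(1), of j] by (simp add: g_def h_def power2_eq_square algebra_simps)
    next
      case (Suc i)
      have e: "2 * k = Suc (2 * i + 1)" using Suc by simp
      have "D g = f ^ Suc j * D (D f ^ (2 * k)) + D f ^ (2 * k) * D (f ^ Suc j)"
        using D_mult[OF D A_power[OF f(1), of j] A_power[OF Df, of "2 * i + 1"]] unfolding g_def e .
      also have "D (D f ^ (2 * k)) = of_nat (2 * k) * (D f ^ (2 * i + 1) * D (D f))"
        unfolding e by (rule D_power[OF D Df])
      finally have "D f * D g =
        of_nat (2 * k) * (D (D f) * (f ^ Suc j * (D f * D f ^ (2 * i + 1)))) +
        of_nat (Suc j) * (f ^ j * (D f * D f * D f ^ (2 * k)))"
        unfolding D_power[OF D f(1)] by (simp only: algebra_simps)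
      moreover have "D f * D f ^ (2 * i + 1) = D f ^ (2 * k)" unfolding e by simp
      moreover have "D f * D f * D f ^ (2 * k) = D f ^ (2 * Suc k)" by simp
      ultimately show ?thesis unfolding g_def h_def by (simp only: add.commute)
    qed
    have "of_nat (Suc j) * h = D f * D g - of_nat (2 * k) * (D (D f) * g)" unfolding eq by simp
    also have "\<dots> \<in> Iw x"
      by (intro Iw_diff Iw_of_nat Iw_mult[OF Iw_D[OF D g] Df] Iw_mult[OF g DDf])
    \<comment> \<open>Dividing by \<open>Suc j\<close> is where characteristic zero enters.\<close>
    finally have "(\<lambda>_. 1 / of_nat (Suc j)) * (of_nat (Suc j) * h) \<in> Iw x" by (rule Iw_scale)
    moreover have "(\<lambda>_. 1 / of_nat (Suc j)) * (of_nat (Suc j) * h) = h"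
    proof -
      have ofn: "(of_nat c :: ('n \<Rightarrow> complex) \<Rightarrow> complex) = (\<lambda>_. of_nat c)" for c
        by (induction c) (auto simp: fun_eq_iff fun_apply)
      show ?thesis unfolding ofn by (rule ext) (simp add: fun_apply del: of_nat_Suc)
    qed
    ultimately have "h \<in> Iw x" by (simp only:)
    then show ?case unfolding j(2) h_def .
  qed
  from this[of "Suc n"] show ?thesis by simp
qed

text \<open>The radical is again an invariant ideal, and its members vanish at \<open>x\<close>;
  maximality of \<open>Iw x\<close> then leaves no room for it to be larger.\<close>

lemma Iw_radical:
  assumes f: "f \<in> A" "f ^ Suc n \<in> Iw x"
  shows "f \<in> Iw x"
proof -
  define N where "N = {f \<in> A. \<exists>n. f ^ Suc n \<in> Iw x}"
  have NI: "f \<in> N" if "f \<in> A" "f ^ Suc n \<in> Iw x" for f n unfolding N_def using that by blast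
  have NE: "\<exists>n. f ^ Suc n \<in> Iw x" "f \<in> A" if "f \<in> N" for f using that unfolding N_def by blast+
  have "invariant_ideal N"
  proof (rule invariant_idealI)
    show "N \<subseteq> A" by (auto simp: N_def)
    show "0 \<in> N" by (rule NI[of 0 0]) (simp_all add: A_0 Iw_0)
    fix f g assume fN: "f \<in> N"
    then obtain n where f: "f ^ Suc n \<in> Iw x" using NE(1) by blast
    {
      assume gN: "g \<in> N"
      then obtain m where g: "g ^ Suc m \<in> Iw x" using NE(1) by blast
      show "f + g \<in> N"
        by (rule NI[OF A_add[OF NE(2)[OF fN] NE(2)[OF gN]] Iw_radical_add[OF NE(2)[OF fN] f NE(2)[OF gN] g]])
    next
      assume g: "g \<in> A"
      have "(g * f) ^ Suc n \<in> Iw x"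
        unfolding power_mult_distrib by (rule Iw_mult[OF f A_power[OF g]])
      then show "g * f \<in> N" by (rule NI[OF A_mult[OF g NE(2)[OF fN]]])
    }
  next
    fix D assume D: "D \<in> Fs"
    show "D ` N \<subseteq> N"
    proof (rule image_subsetI)
      fix f assume fN: "f \<in> N"
      obtain n where f: "f ^ Suc n \<in> Iw x" using NE(1)[OF fN] by (elim exE)
      show "D f \<in> N"
        by (rule NI[OF D_in[OF D NE(2)[OF fN]] Iw_radical_D[OF NE(2)[OF fN] f D]])
    qed
  qed
  moreover have "f x = 0" if fN: "f \<in> N" for f
  proof -
    obtain n where "f ^ Suc n \<in> Iw x" using NE(1)[OF fN] by blast
    from Iw_vanish[OF this] show ?thesis by (auto simp only: power_fun_apply power_eq_0_iff)
  qed
  ultimately have "N \<subseteq> Iw x" by (rule Iw_maximal)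
  then show ?thesis using NI[OF f] by blast
qed

text \<open>For the radical ideal \<open>Iw x\<close> the colon ideals \<open>J = (Iw x : f)\<close> and \<open>K = (Iw x : J)\<close> are again invariant; by
  maximality neither vanishes at \<open>x\<close>, although their product does.\<close>
lemma Iw_prime:
  assumes f: "f \<in> A" and g: "g \<in> A" and fg: "f * g \<in> Iw x"
  shows "f \<in> Iw x \<or> g \<in> Iw x"
proof (rule ccontr)
  assume no: "\<not> ?thesis"
  define J where "J = {h \<in> A. h * f \<in> Iw x}"
  have JI: "h \<in> J" if "h \<in> A" "h * f \<in> Iw x" for h using that by (simp add: J_def)
  have JE: "h \<in> A" "h * f \<in> Iw x" if "h \<in> J" for h using that by (simp_all add: J_def)
  have J: "invariant_ideal J"
  proof (rule invariant_idealI)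
    show "J \<subseteq> A" using JE by blast
    show "0 \<in> J" by (rule JI) (simp_all add: A_0 Iw_0)
    fix h k assume h: "h \<in> J"
    show "h + k \<in> J" if k: "k \<in> J"
      by (rule JI[OF A_add[OF JE(1)[OF h] JE(1)[OF k]]])
        (simp only: distrib_right Iw_add[OF JE(2)[OF h] JE(2)[OF k]])
    show "k * h \<in> J" if k: "k \<in> A"
      by (rule JI[OF A_mult[OF k JE(1)[OF h]]]) (simp only: mult.assoc Iw_mult[OF JE(2)[OF h] k])
  next
    fix D assume D: "D \<in> Fs"
    show "D ` J \<subseteq> J"
    proof (rule image_subsetI)
    fix h assume h: "h \<in> J"
    note hA = JE(1)[OF h] and hf = JE(2)[OF h]
    have Dh: "D h \<in> A" and Df: "D f \<in> A" by (fact D_in[OF D hA] D_in[OF D f])+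
    have "f * (h * D f + f * D h) \<in> Iw x"
      using Iw_mult[OF Iw_D[OF D hf] f] unfolding D_mult[OF D hA f] .
    then have "f * (h * D f + f * D h) - D f * (h * f) \<in> Iw x" by (rule Iw_diff[OF _ Iw_mult[OF hf Df]])
    moreover have "f * (h * D f + f * D h) - D f * (h * f) = f * (f * D h)" by (simp add: algebra_simps)
    ultimately have "f * (f * D h) \<in> Iw x" by (simp only:)
    from Iw_mult[OF this Dh] have "D h * (f * (f * D h)) \<in> Iw x" .
    \<comment> \<open>The product rule controls \<open>D h * f\<close> only after multiplication by
      \<open>f\<close>; this suffices for its square, and radicality does the rest.\<close>
    moreover have "D h * (f * (f * D h)) = (D h * f) ^ Suc 1" by (simp add: algebra_simps)
    ultimately have "(D h * f) ^ Suc 1 \<in> Iw x" by (simp only:)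
    from Iw_radical[OF A_mult[OF Dh f] this] show "D h \<in> J" by (rule JI[OF Dh])
    qed
  qed
  define K where "K = {h \<in> A. \<forall>j\<in>J. h * j \<in> Iw x}"
  have KI: "h \<in> K" if "h \<in> A" "\<And>j. j \<in> J \<Longrightarrow> h * j \<in> Iw x" for h using that by (simp add: K_def)
  have KE: "h \<in> A" "j \<in> J \<Longrightarrow> h * j \<in> Iw x" if "h \<in> K" for h j using that by (simp_all add: K_def)
  have K: "invariant_ideal K"
  proof (rule invariant_idealI)
    show "K \<subseteq> A" using KE(1) by blast
    show "0 \<in> K" by (rule KI) (simp_all add: A_0 Iw_0)
    fix h k assume h: "h \<in> K"
    show "h + k \<in> K" if k: "k \<in> K"
      by (rule KI[OF A_add[OF KE(1)[OF h] KE(1)[OF k]]]) (simp only: distrib_right Iw_add KE(2)[OF h] KE(2)[OF k])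
    show "k * h \<in> K" if k: "k \<in> A"
      by (rule KI[OF A_mult[OF k KE(1)[OF h]]]) (simp only: mult.assoc Iw_mult[OF KE(2)[OF h] k])
  next
    fix D assume D: "D \<in> Fs"
    show "D ` K \<subseteq> K"
    proof (rule image_subsetI)
    fix h assume h: "h \<in> K"
    show "D h \<in> K"
    proof (rule KI[OF D_in[OF D KE(1)[OF h]]])
      fix j assume j: "j \<in> J"
      have "D (h * j) - h * D j \<in> Iw x"
        by (rule Iw_diff[OF Iw_D[OF D KE(2)[OF h j]] KE(2)[OF h invariant_ideal_D[OF J D j]]])
      then show "D h * j \<in> Iw x"
        unfolding D_mult[OF D KE(1)[OF h] JE(1)[OF j]] by (simp add: mult.commute)
    qed
    qed
  qed
  \<comment> \<open>\<open>K\<close> contains \<open>f\<close> and \<open>J\<close> contains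
    \<open>g\<close>, so neither is contained in \<open>Iw x\<close>; by maximality each has a
    member that does not vanish at \<open>x\<close>.\<close>
  have "f \<in> K" by (rule KI[OF f]) (simp only: mult.commute[of f] JE(2))
  then obtain k where k: "k \<in> K" "k x \<noteq> 0" using Iw_maximal[OF K, of x] no by blast
  have "g \<in> J" by (rule JI[OF g]) (simp only: mult.commute[of g] fg)
  then obtain j where j: "j \<in> J" "j x \<noteq> 0" using Iw_maximal[OF J, of x] no by blast
  from Iw_vanish[OF KE(2)[OF k(1) j(1)]] show False using k(2) j(2) unfolding times_fun_apply by simp
qed

end

definition mo :: "('n::finite \<Rightarrow> nat) \<Rightarrow> ('n \<Rightarrow> complex) \<Rightarrow> complex" where
  "mo e = (\<Prod>i\<in>UNIV. coord i ^ e i)"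

lemma mo_exps: "e \<in> exps T \<Longrightarrow> (\<Prod>i\<in>T. coord i x ^ e i) = mo e x"
  unfolding mo_def prod_fun_apply power_fun_apply
  by (intro prod.mono_neutral_left) (auto simp: exps_def)

lemma polyfun_mo: "mo e \<in> polyfun"
  unfolding mo_def by (intro polyfun_prod polyfun_power polyfun_coord)

lemma polyfun_explicit:
  fixes p :: "('n::finite \<Rightarrow> complex) \<Rightarrow> complex"
  assumes "p \<in> polyfun"
  shows "\<exists>E c. finite E \<and> p = (\<Sum>e\<in>E. (\<lambda>_. c e) * mo e)"
  using alg_explicit[of UNIV p coord] assms unfolding polyfun_eq_alg mo_def by auto

lemma polyfun_lincomb: "(\<Sum>e\<in>E. (\<lambda>_. c e) * mo e) \<in> polyfun"
  by (intro polyfun_sum polyfun_mult polyfun_const polyfun_mo)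

lemma lincomb_mo_apply: "(\<Sum>e\<in>E. (\<lambda>_. c e) * mo e) x = (\<Sum>e\<in>E. c e * mo e x)"
  by (simp add: sum_fun_apply times_fun_apply)

lemma alg_independent_mo:
  "alg_independent_on V T coord \<longleftrightarrow>
    (\<forall>E c. finite E \<and> E \<subseteq> exps T \<and> (\<forall>x\<in>V. (\<Sum>e\<in>E. c e * mo e x) = 0) \<longrightarrow> (\<forall>e\<in>E. c e = 0))"
proof -
  have "(\<Sum>e\<in>E. c e * (\<Prod>i\<in>T. coord i x ^ e i)) = (\<Sum>e\<in>E. c e * mo e x)" if "E \<subseteq> exps T" for E c x
    using that by (intro sum.cong refl) (simp add: mo_exps subset_iff)
  then show ?thesis unfolding alg_independent_on_def by (simp cong: conj_cong)
qed

lemma rst_sum: "rst X (\<Sum>i\<in>I. f i) = (\<Sum>i\<in>I. rst X (f i))"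
  by (induction I rule: infinite_finite_induct) (simp_all add: rst_0 rst_add)

lemma rst_apply: "x \<in> X \<Longrightarrow> rst X p x = p x"
  by (simp add: rst_def)

context foliated
begin

section \<open>The ideal of \<open>V(F,x)\<close>\<close>

text \<open>The preimage of I(F,x) in the polynomial ring of the ambient space, where the
  Nullstellensatz is available.\<close>

definition PI :: "('n \<Rightarrow> complex) \<Rightarrow> (('n \<Rightarrow> complex) \<Rightarrow> complex) set" where
  "PI x = {p \<in> polyfun. rst X p \<in> Iw x}"

lemma prime_ideal_PI:
  assumes x: "x \<in> X"
  shows "prime_ideal (PI x)"
  unfolding prime_ideal_def
proof (intro conjI ballI impI)
  show "poly_ideal (PI x)"
    unfolding poly_ideal_def
    by (auto simp: PI_def rst_0 rst_add rst_mult intro: Iw_0 Iw_add Iw_mult rst_in polyfun_closed)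
  show "1 \<notin> PI x"
    using Iw_vanish[of unit x] x by (auto simp: PI_def rst_apply one_fun_apply)
  fix f g :: "('n \<Rightarrow> complex) \<Rightarrow> complex"
  assume fg: "f \<in> polyfun" "g \<in> polyfun" "f * g \<in> PI x"
  then have "rst X f * rst X g \<in> Iw x" by (simp add: PI_def rst_mult)
  from Iw_prime[OF rst_in[OF fg(1)] rst_in[OF fg(2)] this]
  show "f \<in> PI x \<or> g \<in> PI x" using fg by (simp add: PI_def)
qed

text \<open>Polynomials vanishing on \<open>X\<close> restrict to 0 and so belong to
  \<open>PI x\<close>; this forces the zeros of \<open>PI x\<close> to lie in
  \<open>X\<close>.\<close>

lemma Vset_eq_zeros: "Vset X Fs {x} = zeros (PI x)"
proof (intro subset_antisym subsetI)
  fix y assume y: "y \<in> Vset X Fs {x}"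
  then have yX: "y \<in> X" by (simp add: Vset_def)
  have "p y = 0" if "p \<in> PI x" for p
  proof -
    have "rst X p y = 0" using y that unfolding Vset_def inv_ideal_eq_Iw PI_def by blast
    then show ?thesis using yX by (simp add: rst_apply)
  qed
  then show "y \<in> zeros (PI x)" by (simp add: zeros_def)
next
  fix y assume y: "y \<in> zeros (PI x)"
  have "vanishing X \<subseteq> PI x"
  proof
    fix p assume "p \<in> vanishing X"
    then have "p \<in> polyfun" "rst X p = 0" unfolding rst_eq_0 vanishing_def by simp_all
    then show "p \<in> PI x" using Iw_0[of x] unfolding PI_def by simp
  qed
  then have "y \<in> zeros (vanishing X)" using y unfolding zeros_def by blast
  then have yX: "y \<in> X" by (simp add: zeros_vanishing[OF X_closed])
  have "f y = 0" if f: "f \<in> Iw x" for f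
  proof -
    obtain p where p: "p \<in> polyfun" "f = rst X p" using Iw_in[OF f] by (rule regfunE)
    then have "p \<in> PI x" using f by (simp add: PI_def)
    then show ?thesis using y p yX by (simp add: zeros_def rst_apply)
  qed
  then show "y \<in> Vset X Fs {x}" using yX unfolding Vset_def inv_ideal_eq_Iw by simp
qed

lemma zirred_Vset: "x \<in> X \<Longrightarrow> zirred (Vset X Fs {x})"
  unfolding Vset_eq_zeros by (rule zirred_zeros[OF prime_ideal_PI])

lemma vanishing_Vset: "x \<in> X \<Longrightarrow> vanishing (Vset X Fs {x}) = PI x"
  unfolding Vset_eq_zeros by (rule vanishing_zeros[OF prime_ideal_PI])

abbreviation m :: "('n \<Rightarrow> nat) \<Rightarrow> ('n \<Rightarrow> complex) \<Rightarrow> complex" where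
  "m e \<equiv> rst X (mo e)"

lemma m_in: "m e \<in> A"
  by (rule rst_in[OF polyfun_mo])

lemma word_m_in: "w \<in> lists Fs \<Longrightarrow> apply_word w (m e) \<in> A"
  by (rule apply_word_in[OF _ m_in])

definition kernel_at :: "('n \<Rightarrow> nat) set \<Rightarrow> (('n \<Rightarrow> nat) \<Rightarrow> complex) \<Rightarrow> ('n \<Rightarrow> complex) \<Rightarrow> bool" where
  "kernel_at E f x \<longleftrightarrow> (\<forall>w\<in>lists Fs. (\<Sum>e\<in>E. f e * apply_word w (m e) x) = 0)"

lemma kernel_at_iff: "(\<Sum>e\<in>E. (\<lambda>_. c e) * mo e) \<in> PI x \<longleftrightarrow> kernel_at E c x"
proof -
  have eq: "rst X (\<Sum>e\<in>E. (\<lambda>_. c e) * mo e) = (\<Sum>e\<in>E. (\<lambda>_. c e) * m e)"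
    by (simp add: rst_sum rst_scale)
  have "apply_word w (\<Sum>e\<in>E. (\<lambda>_. c e) * m e) x = (\<Sum>e\<in>E. c e * apply_word w (m e) x)" if "w \<in> lists Fs" for w
    unfolding apply_word_lincomb[OF that m_in] by (simp add: sum_fun_apply times_fun_apply)
  moreover have "(\<Sum>e\<in>E. (\<lambda>_. c e) * m e) \<in> A" by (intro sum_in A_scale m_in)
  ultimately show ?thesis
    unfolding PI_def kernel_at_def by (simp add: eq Iw_def polyfun_lincomb)
qed

lemma kernel_at_vanish:
  assumes "x \<in> X"
  shows "kernel_at E c x \<longleftrightarrow> (\<forall>y\<in>Vset X Fs {x}. (\<Sum>e\<in>E. c e * mo e y) = 0)"
  unfolding kernel_at_iff[symmetric] vanishing_Vset[OF assms, symmetric]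
  by (simp add: vanishing_def polyfun_lincomb lincomb_mo_apply)

text \<open>The kernel over the function field, with the denominators cleared so that the entries
  are regular.\<close>

definition ker :: "('n \<Rightarrow> nat) set \<Rightarrow> (('n \<Rightarrow> nat) \<Rightarrow> ('n \<Rightarrow> complex) \<Rightarrow> complex) \<Rightarrow> bool" where
  "ker E v \<longleftrightarrow> (\<forall>e\<in>E. v e \<in> A) \<and> (\<forall>w\<in>lists Fs. (\<Sum>e\<in>E. v e * apply_word w (m e)) = 0)"

lemma kerD: "ker E v \<Longrightarrow> e \<in> E \<Longrightarrow> v e \<in> A"
  and ker_word: "ker E v \<Longrightarrow> w \<in> lists Fs \<Longrightarrow> (\<Sum>e\<in>E. v e * apply_word w (m e)) = 0"
  by (simp_all add: ker_def)

lemma ker_sum: "ker E v \<Longrightarrow> x \<in> X \<Longrightarrow> (\<Sum>e\<in>E. v e x * mo e x) = 0"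
  using fun_cong[OF ker_word[of E v "[]"], of x]
  by (simp add: sum_fun_apply times_fun_apply zero_fun_apply rst_apply)

lemma ker_imp_kernel_at: "ker E v \<Longrightarrow> kernel_at E (\<lambda>e. v e x) x"
  unfolding kernel_at_def
proof
  fix w assume "ker E v" "w \<in> lists Fs"
  from fun_cong[OF ker_word[OF this], of x]
  show "(\<Sum>e\<in>E. v e x * apply_word w (m e) x) = 0" by (simp add: sum_fun_apply times_fun_apply zero_fun_apply)
qed

lemma ker_comb:
  assumes u: "ker E u" and v: "ker E v" and a: "a \<in> A" and b: "b \<in> A"
  shows "ker E (\<lambda>e. a * u e - b * v e)"
  unfolding ker_def
proof (intro conjI ballI)
  fix e assume "e \<in> E"
  then show "a * u e - b * v e \<in> A" by (intro diff_in mult_in a b kerD[OF u] kerD[OF v])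
next
  fix w assume w: "w \<in> lists Fs"
  have "(\<Sum>e\<in>E. (a * u e - b * v e) * apply_word w (m e)) =
    a * (\<Sum>e\<in>E. u e * apply_word w (m e)) - b * (\<Sum>e\<in>E. v e * apply_word w (m e))"
    by (simp add: sum_distrib_left sum_subtractf algebra_simps)
  then show "(\<Sum>e\<in>E. (a * u e - b * v e) * apply_word w (m e)) = 0"
    by (simp add: ker_word[OF u w] ker_word[OF v w])
qed

lemma D_word_sum:
  assumes D: "D \<in> Fs" and v: "\<forall>e\<in>E. v e \<in> A" and w: "w \<in> lists Fs"
  shows "D (\<Sum>e\<in>E. v e * apply_word w (m e)) =
    (\<Sum>e\<in>E. v e * apply_word (D # w) (m e)) + (\<Sum>e\<in>E. D (v e) * apply_word w (m e))"
proof -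
  have "D (\<Sum>e\<in>E. v e * apply_word w (m e)) = (\<Sum>e\<in>E. D (v e * apply_word w (m e)))"
    by (rule D_sum[OF D]) (intro mult_in bspec[OF v] word_m_in[OF w])
  also have "\<dots> = (\<Sum>e\<in>E. v e * apply_word (D # w) (m e) + D (v e) * apply_word w (m e))"
  proof (intro sum.cong refl)
    fix e assume e: "e \<in> E"
    show "D (v e * apply_word w (m e)) = v e * apply_word (D # w) (m e) + D (v e) * apply_word w (m e)"
      unfolding D_mult[OF D bspec[OF v e] word_m_in[OF w]] apply_word_Cons by (simp add: mult.commute)
  qed
  finally show ?thesis by (simp only: sum.distrib)
qed

text \<open>Differentiating row \<open>w\<close> of the relation gives row \<open>D # w\<close> of
  the same vector plus row \<open>w\<close> of the differentiated vector; the total and the first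
  part are zero.\<close>

lemma ker_D:
  assumes v: "ker E v" and D: "D \<in> Fs"
  shows "ker E (\<lambda>e. D (v e))"
  unfolding ker_def
proof (intro conjI ballI)
  fix e assume "e \<in> E"
  then show "D (v e) \<in> A" by (rule D_in[OF D kerD[OF v]])
next
  fix w assume w: "w \<in> lists Fs"
  have Dw: "D # w \<in> lists Fs" using D w by simp
  have vA: "\<forall>e\<in>E. v e \<in> A" using v by (simp add: ker_def)
  show "(\<Sum>e\<in>E. D (v e) * apply_word w (m e)) = 0"
    using D_word_sum[OF D vA w] unfolding ker_word[OF v w] ker_word[OF v Dw] D_0[OF D] by simp
qed

section \<open>First integrals as fractions\<close>

text \<open>The fraction \<open>a / b\<close> is annihilated by every derivation in
  \<open>Fs\<close>. Unlike \<open>first_integral\<close> this admits constants, so that such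
  fractions are closed under field operations.\<close>

definition con :: "(('n \<Rightarrow> complex) \<Rightarrow> complex) \<Rightarrow> (('n \<Rightarrow> complex) \<Rightarrow> complex) \<Rightarrow> bool" where
  "con a b \<longleftrightarrow> a \<in> A \<and> b \<in> A \<and> b \<noteq> 0 \<and> (\<forall>D\<in>Fs. D a * b = a * D b)"

lemma con_in: "con a b \<Longrightarrow> a \<in> A" "con a b \<Longrightarrow> b \<in> A" "con a b \<Longrightarrow> b \<noteq> 0"
  by (simp_all add: con_def)

lemma con_D:
  assumes "con a b" "D \<in> Fs"
  shows "D a * b = a * D b"
  using assms unfolding con_def by simp

lemma con_self: "a \<in> A \<Longrightarrow> a \<noteq> 0 \<Longrightarrow> con a a"
  unfolding con_def by (simp add: mult.commute)

lemma con_mult: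
  assumes 1: "con a1 b1" and 2: "con a2 b2"
  shows "con (a1 * a2) (b1 * b2)"
  unfolding con_def
proof (intro conjI ballI)
  note in1 = con_in[OF 1] and in2 = con_in[OF 2]
  show "a1 * a2 \<in> A" "b1 * b2 \<in> A" by (intro mult_in in1 in2)+
  show "b1 * b2 \<noteq> 0" by (rule mult_nonzero[OF in1(2) in2(2) in1(3) in2(3)])
  fix D assume D: "D \<in> Fs"
  have "D (a1 * a2) * (b1 * b2) = a1 * b1 * (D a2 * b2) + a2 * b2 * (D a1 * b1)"
    unfolding D_mult[OF D in1(1) in2(1)] by (simp add: algebra_simps)
  also have "\<dots> = a1 * a2 * D (b1 * b2)"
    unfolding con_D[OF 1 D] con_D[OF 2 D] D_mult[OF D in1(2) in2(2)] by (simp add: algebra_simps)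
  finally show "D (a1 * a2) * (b1 * b2) = a1 * a2 * D (b1 * b2)" .
qed

lemma con_add_same:
  assumes 1: "con a1 b" and 2: "con a2 b"
  shows "con (a1 + a2) b"
  unfolding con_def
proof (intro conjI ballI)
  note in1 = con_in[OF 1] and in2 = con_in[OF 2]
  show "a1 + a2 \<in> A" "b \<in> A" "b \<noteq> 0" by (intro add_in in1 in2)+
  fix D assume D: "D \<in> Fs"
  show "D (a1 + a2) * b = (a1 + a2) * D b"
    unfolding D_add[OF D in1(1) in2(1)] distrib_right con_D[OF 1 D] con_D[OF 2 D] ..
qed

lemma con_add:
  assumes 1: "con a1 b1" and 2: "con a2 b2"
  shows "con (a1 * b2 + a2 * b1) (b1 * b2)"
proof (rule con_add_same)
  show "con (a1 * b2) (b1 * b2)" by (rule con_mult[OF 1 con_self[OF con_in(2,3)[OF 2]]])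
  show "con (a2 * b1) (b1 * b2)"
    unfolding mult.commute[of b1 b2] by (rule con_mult[OF 2 con_self[OF con_in(2,3)[OF 1]]])
qed

lemma con_const: "con ((\<lambda>_. c) * unit) unit"
  unfolding con_def
proof (intro conjI ballI)
  show "(\<lambda>_. c) * unit \<in> A" "unit \<in> A" "unit \<noteq> 0" by (intro A_scale unit_in unit_nonzero)+
  fix D assume D: "D \<in> Fs"
  show "D ((\<lambda>_. c) * unit) * unit = (\<lambda>_. c) * unit * D unit"
    unfolding D_scale[OF D unit_in] D_unit[OF D] by simp
qed

lemma con_uminus: "con a b \<Longrightarrow> con (- a) b"
  using con_mult[OF con_const[of "- 1"], of a b] unit_mult[OF con_in(1)[of a b]] unit_mult[OF con_in(2)[of a b]]
  by (simp add: mult.assoc)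

lemma con_inverse: "con a b \<Longrightarrow> a \<noteq> 0 \<Longrightarrow> con b a"
  unfolding con_def by (simp add: mult.commute)

text \<open>The common denominator vanishes on \<open>X\<close> exactly where one of the given
  denominators does, so passing to it leaves the open domain unchanged.\<close>

lemma con_common_denominator:
  assumes "finite J" "\<forall>j\<in>J. con (a j) (b j)"
  shows "\<exists>B a'. B \<in> A \<and> B \<noteq> 0 \<and> (\<forall>x\<in>X. B x \<noteq> 0 \<longleftrightarrow> (\<forall>j\<in>J. b j x \<noteq> 0)) \<and>
    (\<forall>j\<in>J. con (a' j) B \<and> a' j * b j = a j * B)"
  using assms
proof (induction J)
  case empty
  show ?case by (intro exI[of _ unit]) (simp add: unit_in unit_nonzero rst_apply one_fun_apply)
next
  case (insert j J)
  then obtain B a' where B: "B \<in> A" "B \<noteq> 0" "\<forall>x\<in>X. B x \<noteq> 0 \<longleftrightarrow> (\<forall>j\<in>J. b j x \<noteq> 0)"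
    and a': "\<forall>j\<in>J. con (a' j) B \<and> a' j * b j = a j * B" by auto
  have j: "con (a j) (b j)" using insert.prems by simp
  define a'' where "a'' k = (if k = j then a j * B else a' k * b j)" for k
  have "con (a'' k) (B * b j) \<and> a'' k * b k = a k * (B * b j)" if "k \<in> insert j J" for k
  proof (cases "k = j")
    case True
    have "con (a j * B) (b j * B)" by (rule con_mult[OF j con_self[OF B(1,2)]])
    then show ?thesis using True by (simp add: a''_def mult_ac)
  next
    case False
    then have k: "con (a' k) B" "a' k * b k = a k * B" using a' that by auto
    have "con (a' k * b j) (B * b j)" by (rule con_mult[OF k(1) con_self[OF con_in(2,3)[OF j]]])
    moreover have "a' k * b j * b k = a k * (B * b j)"
      using arg_cong[OF k(2), of "\<lambda>h. h * b j"] by (simp add: mult_ac)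
    ultimately show ?thesis using False by (simp add: a''_def)
  qed
  moreover have "B * b j \<in> A" "B * b j \<noteq> 0"
    using B(1,2) con_in(2,3)[OF j] by (auto intro: mult_in dest: mult_eq_0)
  moreover have "\<forall>x\<in>X. (B * b j) x \<noteq> 0 \<longleftrightarrow> (\<forall>k\<in>insert j J. b k x \<noteq> 0)"
    using B(3) by (auto simp: times_fun_apply)
  ultimately show ?case by (intro exI[of _ "B * b j"] exI[of _ a''] conjI ballI) simp_all
qed

text \<open>The coefficients \<open>v e / b\<close> behave like constants: times \<open>b\<close>,
  the terms containing \<open>D (v e)\<close> add up to \<open>D b\<close> times the previous row,
  which is zero. Thus a relation among monomials propagates to all words.\<close>

lemma con_relation_imp_ker:
  assumes con: "\<And>e. e \<in> E \<Longrightarrow> con (v e) b" and b: "b \<in> A" "b \<noteq> 0" and rel: "(\<Sum>e\<in>E. v e * m e) = 0"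
  shows "ker E v"
proof -
  have v: "v e \<in> A" if "e \<in> E" for e using con_in(1)[OF con[OF that]] .
  have "(\<Sum>e\<in>E. v e * apply_word w (m e)) = 0" if "w \<in> lists Fs" for w
    using that
  proof (induction w)
    case (Cons D w)
    then have D: "D \<in> Fs" and w: "w \<in> lists Fs" by simp_all
    let ?S = "\<Sum>e\<in>E. v e * apply_word (D # w) (m e)"
    have IH: "(\<Sum>e\<in>E. v e * apply_word w (m e)) = 0" by (rule Cons.IH)
    have Dw: "D # w \<in> lists Fs" using D w by simp
    have eq: "?S + (\<Sum>e\<in>E. D (v e) * apply_word w (m e)) = 0"
      using D_word_sum[OF D _ w, of E v] v unfolding IH D_0[OF D] by simp
    have "b * (\<Sum>e\<in>E. D (v e) * apply_word w (m e)) = (\<Sum>e\<in>E. (D (v e) * b) * apply_word w (m e))"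
      by (simp add: sum_distrib_left mult_ac)
    also have "\<dots> = (\<Sum>e\<in>E. (v e * D b) * apply_word w (m e))"
      by (intro sum.cong refl) (simp only: con_D[OF con D])
    also have "\<dots> = D b * (\<Sum>e\<in>E. v e * apply_word w (m e))"
      by (simp add: sum_distrib_left mult_ac)
    finally have "b * (\<Sum>e\<in>E. D (v e) * apply_word w (m e)) = 0" by (simp only: IH mult_zero_right)
    then have "b * ?S = 0" using arg_cong[OF eq, of "\<lambda>h. b * h"] by (simp only: distrib_left add_0_right mult_zero_right)
    moreover have "?S \<in> A" by (intro sum_in mult_in v word_m_in Dw)
    ultimately show ?case using A_domain[OF b(1), of ?S] b(2) by blast
  qed (use rel in simp)
  then show ?thesis using v by (simp add: ker_def)
qed

text \<open>A kernel vector of minimal support with \<open>v \<beta> \<noteq> 0\<close> has all ratios \<open>v e / v \<beta>\<close> constant along \<open>Fs\<close>: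
  otherwise \<open>v \<beta> * D v - D (v \<beta>) * v\<close> would be a kernel vector of smaller support, and could be used to shrink
  the support of \<open>v\<close> itself.\<close>
lemma exists_con_kernel_vector:
  assumes E: "finite E" "\<beta> \<in> E" and v0: "ker E v0" "v0 \<beta> \<noteq> 0"
  shows "\<exists>v. ker E v \<and> v \<beta> \<noteq> 0 \<and> (\<forall>e\<in>E. con (v e) (v \<beta>))"
proof -
  define P where "P v \<longleftrightarrow> ker E v \<and> v \<beta> \<noteq> 0" for v
  define sz where "sz v = card {e\<in>E. v e \<noteq> 0}" for v :: "('n \<Rightarrow> nat) \<Rightarrow> ('n \<Rightarrow> complex) \<Rightarrow> complex"
  have "P v0" using v0 by (simp add: P_def)
  from ex_has_least_nat[of P, OF this, of sz] obtain v where Pv: "P v" and min: "\<And>u. P u \<Longrightarrow> sz v \<le> sz u" by auto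
  have v: "ker E v" "v \<beta> \<noteq> 0" using Pv by (simp_all add: P_def)
  have "con (v e) (v \<beta>)" if e: "e \<in> E" for e
    unfolding con_def
  proof (intro conjI ballI)
    show "v e \<in> A" "v \<beta> \<in> A" "v \<beta> \<noteq> 0" using kerD[OF v(1)] e E(2) v(2) by simp_all
    fix D assume D: "D \<in> Fs"
    define u where "u k = v \<beta> * D (v k) - D (v \<beta>) * v k" for k
    have v\<beta>: "v \<beta> \<in> A" "D (v \<beta>) \<in> A" using kerD[OF v(1) E(2)] D_in[OF D kerD[OF v(1) E(2)]] by simp_all
    have u: "ker E u" unfolding u_def by (rule ker_comb[OF ker_D[OF v(1) D] v(1) v\<beta>])
    have "u e = 0"
    proof (rule ccontr)
      assume ue: "u e \<noteq> 0"
      \<comment> \<open>Chosen to vanish at \<open>e\<close>; since \<open>u\<close> vanishes at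
        \<open>\<beta>\<close>, the entry at \<open>\<beta>\<close> remains nonzero.\<close>
      define v' where "v' k = u e * v k - v e * u k" for k
      have "ker E v'" unfolding v'_def by (rule ker_comb[OF v(1) u kerD[OF u e] kerD[OF v(1) e]])
      moreover have "u \<beta> = 0" by (simp add: u_def mult.commute)
      then have "v' \<beta> \<noteq> 0" unfolding v'_def using mult_nonzero[OF kerD[OF u e] v\<beta>(1) ue v(2)] by simp
      ultimately have "sz v \<le> sz v'" using min by (simp add: P_def)
      moreover have "sz v' < sz v"
        unfolding sz_def
      proof (rule psubset_card_mono)
        have "v k = 0 \<Longrightarrow> u k = 0" for k by (simp add: u_def D_0[OF D])
        then have "{k\<in>E. v' k \<noteq> 0} \<subseteq> {k\<in>E. v k \<noteq> 0}" by (auto simp: v'_def)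
        moreover have "e \<in> {k\<in>E. v k \<noteq> 0}" using e ue \<open>v e = 0 \<Longrightarrow> u e = 0\<close> by auto
        moreover have "e \<notin> {k\<in>E. v' k \<noteq> 0}" by (simp add: v'_def mult.commute)
        ultimately show "{k\<in>E. v' k \<noteq> 0} \<subset> {k\<in>E. v k \<noteq> 0}" by blast
      qed (use E(1) in simp)
      ultimately show False by simp
    qed
    then show "D (v e) * v \<beta> = v e * D (v \<beta>)" unfolding u_def by (simp add: mult.commute)
  qed
  then show ?thesis using v by blast
qed

text \<open>In the second alternative a combination of rows is supported on column
  \<open>\<beta>\<close> alone; evaluated at \<open>x\<close> it says that
  \<open>\<delta> x * f \<beta>\<close> is zero for every kernel vector at \<open>x\<close>.\<close>

lemma ker_or_point_condition:
  assumes "finite E" "\<beta> \<in> E"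
  shows "(\<exists>v. ker E v \<and> v \<beta> \<noteq> 0) \<or>
    (\<exists>\<delta>\<in>A. \<delta> \<noteq> 0 \<and> (\<forall>x f. \<delta> x \<noteq> 0 \<longrightarrow> kernel_at E f x \<longrightarrow> f \<beta> = 0))"
proof -
  have "\<forall>w\<in>lists Fs. \<forall>e\<in>E. apply_word w (m e) \<in> A" using word_m_in by blast
  from kernel_or_row_combination[OF assms this] show ?thesis
  proof (elim disjE)
    assume "\<exists>v. (\<forall>e\<in>E. v e \<in> A) \<and> (\<forall>w\<in>lists Fs. (\<Sum>e\<in>E. v e * apply_word w (m e)) = 0) \<and> v \<beta> \<noteq> 0"
    then show ?thesis unfolding ker_def by auto
  next
    assume "\<exists>W0 a. finite W0 \<and> W0 \<subseteq> lists Fs \<and> (\<forall>w\<in>W0. a w \<in> A) \<and>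
      (\<forall>e\<in>E - {\<beta>}. (\<Sum>w\<in>W0. a w * apply_word w (m e)) = 0) \<and> (\<Sum>w\<in>W0. a w * apply_word w (m \<beta>)) \<noteq> 0"
    then obtain W0 a where W0: "finite W0" "W0 \<subseteq> lists Fs" "\<forall>w\<in>W0. a w \<in> A"
      and zero: "\<forall>e\<in>E - {\<beta>}. (\<Sum>w\<in>W0. a w * apply_word w (m e)) = 0"
      and nz: "(\<Sum>w\<in>W0. a w * apply_word w (m \<beta>)) \<noteq> 0" by auto
    define \<delta> where "\<delta> = (\<Sum>w\<in>W0. a w * apply_word w (m \<beta>))"
    have "\<delta> \<in> A" unfolding \<delta>_def using W0 by (intro sum_in mult_in word_m_in) auto
    moreover have "f \<beta> = 0" if \<delta>: "\<delta> x \<noteq> 0" and f: "kernel_at E f x" for x f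
    proof -
      have "0 = (\<Sum>w\<in>W0. a w x * (\<Sum>e\<in>E. f e * apply_word w (m e) x))"
        using f W0(2) unfolding kernel_at_def by (intro sum.neutral[symmetric]) auto
      also have "\<dots> = (\<Sum>w\<in>W0. \<Sum>e\<in>E. f e * (a w x * apply_word w (m e) x))"
        by (simp add: sum_distrib_left mult_ac)
      also have "\<dots> = (\<Sum>e\<in>E. \<Sum>w\<in>W0. f e * (a w x * apply_word w (m e) x))" by (rule sum.swap)
      also have "\<dots> = (\<Sum>e\<in>E. f e * (\<Sum>w\<in>W0. a w * apply_word w (m e)) x)"
        by (simp add: sum_distrib_left sum_fun_apply times_fun_apply)
      also have "\<dots> = (\<Sum>e\<in>{\<beta>}. f e * (\<Sum>w\<in>W0. a w * apply_word w (m e)) x)"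
        using assms zero by (intro sum.mono_neutral_right) (auto simp: zero_fun_apply)
      finally show ?thesis using \<delta> by (simp add: \<delta>_def)
    qed
    ultimately show ?thesis using nz unfolding \<delta>_def[symmetric] by blast
  qed
qed

text \<open>\<open>\<beta>\<close> is the normalising index: the ratios
  \<open>v e / v \<beta>\<close> are annihilated by \<open>Fs\<close>.\<close>

definition good :: "('n \<Rightarrow> nat) set \<Rightarrow> (('n \<Rightarrow> nat) \<Rightarrow> ('n \<Rightarrow> complex) \<Rightarrow> complex) \<Rightarrow> ('n \<Rightarrow> nat) \<Rightarrow> bool" where
  "good E v \<beta> \<longleftrightarrow> finite E \<and> \<beta> \<in> E \<and> ker E v \<and> v \<beta> \<noteq> 0 \<and> (\<forall>e\<in>E. con (v e) (v \<beta>))"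

text \<open>At a generic point the kernel is spanned by the values of the good kernel vectors.\<close>
lemma generic_kernel:
  assumes "finite E"
  shows "\<exists>\<delta>\<in>A. \<delta> \<noteq> 0 \<and> (\<forall>x f z. \<delta> x \<noteq> 0 \<longrightarrow> kernel_at E f x \<longrightarrow>
    (\<forall>E' v \<beta>. good E' v \<beta> \<longrightarrow> (\<Sum>e\<in>E'. v e x * mo e z) = 0) \<longrightarrow> (\<Sum>e\<in>E. f e * mo e z) = 0)"
  using assms
proof (induction E)
  case empty
  show ?case by (intro bexI[of _ unit]) (simp_all add: unit_in unit_nonzero)
next
  case (insert \<beta> E)
  then obtain \<delta>0 where \<delta>0: "\<delta>0 \<in> A" "\<delta>0 \<noteq> 0"
    and IH: "\<And>x f z. \<delta>0 x \<noteq> 0 \<Longrightarrow> kernel_at E f x \<Longrightarrow>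
      (\<forall>E' v \<beta>. good E' v \<beta> \<longrightarrow> (\<Sum>e\<in>E'. v e x * mo e z) = 0) \<Longrightarrow> (\<Sum>e\<in>E. f e * mo e z) = 0"
    by auto
  have fin: "finite (insert \<beta> E)" "\<beta> \<in> insert \<beta> E" using insert.hyps by auto
  from ker_or_point_condition[OF fin] show ?case
  proof (elim disjE)
    assume "\<exists>v. ker (insert \<beta> E) v \<and> v \<beta> \<noteq> 0"
    then obtain v0 where v0: "ker (insert \<beta> E) v0" "v0 \<beta> \<noteq> 0" by auto
    from exists_con_kernel_vector[OF fin v0] obtain v where v: "ker (insert \<beta> E) v" "v \<beta> \<noteq> 0" "\<forall>e\<in>insert \<beta> E. con (v e) (v \<beta>)" by auto
    have good: "good (insert \<beta> E) v \<beta>" unfolding good_def using v fin by simp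
    have "(\<Sum>e\<in>insert \<beta> E. f e * mo e z) = 0"
      if \<delta>: "(\<delta>0 * v \<beta>) x \<noteq> 0" and f: "kernel_at (insert \<beta> E) f x"
        and G: "\<forall>E' v \<beta>. good E' v \<beta> \<longrightarrow> (\<Sum>e\<in>E'. v e x * mo e z) = 0" for x f z
    proof -
      have nz: "\<delta>0 x \<noteq> 0" "v \<beta> x \<noteq> 0" using \<delta> by (auto simp: times_fun_apply)
      \<comment> \<open>Subtracting a multiple of the value of \<open>v\<close> at \<open>x\<close>
        removes the entry at \<open>\<beta>\<close>, so the induction hypothesis for
        \<open>E\<close> applies.\<close>
      define f' where "f' e = f e - f \<beta> / v \<beta> x * v e x" for e
      have split: "(\<Sum>e\<in>insert \<beta> E. f e * h e) = (\<Sum>e\<in>E. f' e * h e) + f \<beta> / v \<beta> x * (\<Sum>e\<in>insert \<beta> E. v e x * h e)" for h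
      proof -
        have "(\<Sum>e\<in>insert \<beta> E. f e * h e) - f \<beta> / v \<beta> x * (\<Sum>e\<in>insert \<beta> E. v e x * h e) = (\<Sum>e\<in>insert \<beta> E. f' e * h e)"
          unfolding sum_distrib_left sum_subtractf[symmetric] f'_def by (intro sum.cong refl) (simp add: algebra_simps)
        also have "\<dots> = (\<Sum>e\<in>E. f' e * h e)" using insert.hyps nz(2) by (simp add: f'_def)
        finally show ?thesis by (simp add: algebra_simps)
      qed
      have "kernel_at E f' x" unfolding kernel_at_def
      proof
        fix w assume w: "w \<in> lists Fs"
        have "(\<Sum>e\<in>insert \<beta> E. v e x * apply_word w (m e) x) = 0"
          using ker_imp_kernel_at[OF v(1), of x] w unfolding kernel_at_def by (rule bspec)
        moreover have "(\<Sum>e\<in>insert \<beta> E. f e * apply_word w (m e) x) = 0"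
          using f w unfolding kernel_at_def by (rule bspec)
        ultimately show "(\<Sum>e\<in>E. f' e * apply_word w (m e) x) = 0"
          using split[of "\<lambda>e. apply_word w (m e) x"] by simp
      qed
      from IH[OF nz(1) this G] show ?thesis
        using split[of "\<lambda>e. mo e z"] G good by simp
    qed
    moreover have "\<delta>0 * v \<beta> \<in> A" "\<delta>0 * v \<beta> \<noteq> 0"
      using \<delta>0 v(2) kerD[OF v(1) fin(2)] by (simp_all add: mult_in mult_nonzero)
    ultimately show ?case by (intro bexI[of _ "\<delta>0 * v \<beta>"] conjI allI impI) simp_all
  next
    assume "\<exists>\<delta>\<in>A. \<delta> \<noteq> 0 \<and> (\<forall>x f. \<delta> x \<noteq> 0 \<longrightarrow> kernel_at (insert \<beta> E) f x \<longrightarrow> f \<beta> = 0)"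
    then obtain \<delta>1 where \<delta>1: "\<delta>1 \<in> A" "\<delta>1 \<noteq> 0"
      and zero: "\<And>x f. \<delta>1 x \<noteq> 0 \<Longrightarrow> kernel_at (insert \<beta> E) f x \<Longrightarrow> f \<beta> = 0" by auto
    have "(\<Sum>e\<in>insert \<beta> E. f e * mo e z) = 0"
      if \<delta>: "(\<delta>0 * \<delta>1) x \<noteq> 0" and f: "kernel_at (insert \<beta> E) f x"
        and G: "\<forall>E' v \<beta>. good E' v \<beta> \<longrightarrow> (\<Sum>e\<in>E'. v e x * mo e z) = 0" for x f z
    proof -
      have nz: "\<delta>0 x \<noteq> 0" "\<delta>1 x \<noteq> 0" using \<delta> by (auto simp: times_fun_apply)
      have f\<beta>: "f \<beta> = 0" by (rule zero[OF nz(2) f])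
      have "kernel_at E f x" using f insert.hyps f\<beta> unfolding kernel_at_def by simp
      from IH[OF nz(1) this G] show ?thesis using insert.hyps f\<beta> by simp
    qed
    moreover have "\<delta>0 * \<delta>1 \<in> A" "\<delta>0 * \<delta>1 \<noteq> 0" using \<delta>0 \<delta>1 by (simp_all add: mult_in mult_nonzero)
    ultimately show ?case by (intro bexI[of _ "\<delta>0 * \<delta>1"] conjI allI impI) simp_all
  qed
qed

end

section \<open>Polynomial rings are Noetherian\<close>

definition sub_ideal :: "('b \<Rightarrow> complex) set \<Rightarrow> ('b \<Rightarrow> complex) set \<Rightarrow> bool" where
  "sub_ideal R I \<longleftrightarrow> I \<subseteq> R \<and> 0 \<in> I \<and> (\<forall>f\<in>I. \<forall>g\<in>I. f + g \<in> I) \<and> (\<forall>f\<in>I. \<forall>r\<in>R. r * f \<in> I)"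

inductive_set gideal :: "('b \<Rightarrow> complex) set \<Rightarrow> ('b \<Rightarrow> complex) set \<Rightarrow> ('b \<Rightarrow> complex) set" for R H where
  gideal_0: "0 \<in> gideal R H"
| gideal_step: "f \<in> gideal R H \<Longrightarrow> r \<in> R \<Longrightarrow> h \<in> H \<Longrightarrow> f + r * h \<in> gideal R H"

definition noetherian :: "('b \<Rightarrow> complex) set \<Rightarrow> bool" where
  "noetherian R \<longleftrightarrow> (\<forall>I. sub_ideal R I \<longrightarrow> (\<exists>H\<subseteq>I. finite H \<and> I \<subseteq> gideal R H))"

lemma sub_idealD:
  assumes "sub_ideal R I"
  shows "I \<subseteq> R" "0 \<in> I" "f \<in> I \<Longrightarrow> g \<in> I \<Longrightarrow> f + g \<in> I" "f \<in> I \<Longrightarrow> r \<in> R \<Longrightarrow> r * f \<in> I"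
  using assms unfolding sub_ideal_def by simp_all

lemma gideal_add: "f \<in> gideal R H \<Longrightarrow> g \<in> gideal R H \<Longrightarrow> g + f \<in> gideal R H"
  by (induction rule: gideal.induct) (auto simp: add.assoc[symmetric] intro: gideal.intros)

lemma gideal_gen: "r \<in> R \<Longrightarrow> h \<in> H \<Longrightarrow> r * h \<in> gideal R H"
  using gideal_step[OF gideal_0, of r R h H] by simp

lemma gideal_mono: "f \<in> gideal R H \<Longrightarrow> R \<subseteq> R' \<Longrightarrow> H \<subseteq> H' \<Longrightarrow> f \<in> gideal R' H'"
  by (induction rule: gideal.induct) (auto intro: gideal.intros)

lemma gideal_subset: "sub_ideal R I \<Longrightarrow> H \<subseteq> I \<Longrightarrow> f \<in> gideal R H \<Longrightarrow> f \<in> I"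
  by (erule gideal.induct) (auto intro: sub_idealD)

lemma gideal_vanish: "f \<in> gideal R H \<Longrightarrow> (\<And>h. h \<in> H \<Longrightarrow> h x = 0) \<Longrightarrow> f x = 0"
  by (induction rule: gideal.induct) (auto simp: fun_apply)

text \<open>Polynomials in \<open>t\<close> of degree below \<open>n\<close>. Since \<open>t\<close>
  is an actual function and may be algebraic over \<open>R\<close>, the coefficients are not unique,
  and \<open>n\<close> is only a bound for the degree of some representation.\<close>

definition pol_lt :: "('b \<Rightarrow> complex) set \<Rightarrow> ('b \<Rightarrow> complex) \<Rightarrow> nat \<Rightarrow> ('b \<Rightarrow> complex) set" where
  "pol_lt R t n = {f. \<exists>q. (\<forall>l. q l \<in> R) \<and> f = (\<Sum>l<n. q l * t ^ l)}"

lemma pol_lt_add: 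
  assumes "f \<in> pol_lt (alg Z) t n" "g \<in> pol_lt (alg Z) t n"
  shows "f + g \<in> pol_lt (alg Z) t n"
proof -
  obtain p q where "\<forall>l. p l \<in> alg Z" "f = (\<Sum>l<n. p l * t ^ l)" "\<forall>l. q l \<in> alg Z" "g = (\<Sum>l<n. q l * t ^ l)"
    using assms unfolding pol_lt_def by auto
  then show ?thesis unfolding pol_lt_def
    by (intro CollectI exI[of _ "\<lambda>l. p l + q l"]) (auto simp: sum.distrib distrib_right intro: alg_add)
qed

lemma pol_lt_mult:
  assumes "f \<in> pol_lt (alg Z) t n" "r \<in> alg Z"
  shows "r * f \<in> pol_lt (alg Z) t n"
proof -
  obtain p where "\<forall>l. p l \<in> alg Z" "f = (\<Sum>l<n. p l * t ^ l)" using assms unfolding pol_lt_def by auto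
  then show ?thesis unfolding pol_lt_def using assms(2)
    by (intro CollectI exI[of _ "\<lambda>l. r * p l"]) (auto simp: sum_distrib_left mult.assoc intro: alg_mult)
qed

lemma pol_lt_0: "0 \<in> pol_lt (alg Z) t n"
  unfolding pol_lt_def by (intro CollectI exI[of _ "\<lambda>_. 0"]) (simp add: alg_0)

lemma pol_lt_monomial:
  assumes "r \<in> alg Z" "k < n"
  shows "r * t ^ k \<in> pol_lt (alg Z) t n"
  unfolding pol_lt_def
proof (intro CollectI exI[of _ "\<lambda>l. if l = k then r else 0"] conjI)
  show "\<forall>l. (if l = k then r else 0) \<in> alg Z" using assms(1) by (simp add: alg_0)
  have "(\<Sum>l<n. (if l = k then r else 0) * t ^ l) = (\<Sum>l\<in>{k}. (if l = k then r else 0) * t ^ l)"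
    using assms(2) by (intro sum.mono_neutral_right) auto
  then show "r * t ^ k = (\<Sum>l<n. (if l = k then r else 0) * t ^ l)" by simp
qed

lemma pol_lt_shift:
  assumes "f \<in> pol_lt (alg Z) t n" "n + k \<le> n'"
  shows "t ^ k * f \<in> pol_lt (alg Z) t n'"
proof -
  obtain p where p: "\<forall>l. p l \<in> alg Z" "f = (\<Sum>l<n. p l * t ^ l)" using assms unfolding pol_lt_def by auto
  have "t ^ k * f = (\<Sum>l<n. p l * t ^ (k + l))" unfolding p(2) sum_distrib_left by (simp add: power_add mult_ac)
  also have "\<dots> \<in> pol_lt (alg Z) t n'"
  proof -
    have "(\<Sum>l\<in>B. p l * t ^ (k + l)) \<in> pol_lt (alg Z) t n'" if "finite B" "B \<subseteq> {..<n}" for B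
      using that by (induction B) (use p(1) assms(2) in \<open>auto intro!: pol_lt_0 pol_lt_add pol_lt_monomial\<close>)
    then show ?thesis by simp
  qed
  finally show ?thesis .
qed

lemma pol_lt_exists: "f \<in> alg (insert t Z) \<Longrightarrow> \<exists>n. f \<in> pol_lt (alg Z) t n"
proof (induction rule: alg.induct)
  case (alg_const c)
  have "(\<lambda>_. c) * t ^ 0 \<in> pol_lt (alg Z) t 1" by (rule pol_lt_monomial) (auto intro: alg.alg_const)
  then show ?case by auto
next
  case (alg_gen z)
  then consider "z = t" | "z \<in> Z" by blast
  then show ?case
  proof cases
    case 1
    have "1 * t ^ 1 \<in> pol_lt (alg Z) t 2" by (rule pol_lt_monomial) (auto intro: alg_1)
    then show ?thesis using 1 by auto
  next
    case 2
    have "z * t ^ 0 \<in> pol_lt (alg Z) t 1" by (rule pol_lt_monomial) (use 2 in \<open>auto intro: alg.alg_gen\<close>)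
    then show ?thesis by auto
  qed
next
  case (alg_add f g)
  then obtain n k where nk: "f \<in> pol_lt (alg Z) t n" "g \<in> pol_lt (alg Z) t k" by blast
  have "t ^ 0 * f \<in> pol_lt (alg Z) t (n + k)" "t ^ 0 * g \<in> pol_lt (alg Z) t (n + k)"
    by (rule pol_lt_shift[OF nk(1)], simp, rule pol_lt_shift[OF nk(2)], simp)
  then have "t ^ 0 * f + t ^ 0 * g \<in> pol_lt (alg Z) t (n + k)" by (rule pol_lt_add)
  then show ?case by auto
next
  case (alg_mult f g)
  then obtain n k where nk: "f \<in> pol_lt (alg Z) t n" "g \<in> pol_lt (alg Z) t k" by blast
  obtain p where p: "\<forall>l. p l \<in> alg Z" "f = (\<Sum>l<n. p l * t ^ l)" using nk(1) unfolding pol_lt_def by auto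
  have "(\<Sum>l\<in>B. p l * (t ^ l * g)) \<in> pol_lt (alg Z) t (n + k)" if "finite B" "B \<subseteq> {..<n}" for B
    using that
  proof (induction B)
    case (insert l B)
    have "t ^ l * g \<in> pol_lt (alg Z) t (n + k)" by (rule pol_lt_shift[OF nk(2)]) (use insert.prems in simp)
    then have "p l * (t ^ l * g) \<in> pol_lt (alg Z) t (n + k)" using pol_lt_mult p(1) by blast
    then show ?case using insert by (auto intro: pol_lt_add)
  qed (simp add: pol_lt_0)
  from this[of "{..<n}"] have "f * g \<in> pol_lt (alg Z) t (n + k)"
    unfolding p(2) sum_distrib_right by (simp add: mult.assoc)
  then show ?case by blast
qed

lemma noetherian_constants: "noetherian (alg {})"
  unfolding noetherian_def
proof (intro allI impI)
  fix I :: "('b \<Rightarrow> complex) set" assume I: "sub_ideal (alg {}) I"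
  have const: "\<exists>c. f = (\<lambda>_. c)" if "f \<in> alg {}" for f :: "'b \<Rightarrow> complex"
    using that by induction (auto simp: plus_fun_def times_fun_def)
  show "\<exists>H\<subseteq>I. finite H \<and> I \<subseteq> gideal (alg {}) H"
  proof (cases "I = {0}")
    case True
    then show ?thesis by (intro exI[of _ "{}"]) (auto intro: gideal_0)
  next
    case False
    then obtain f where f: "f \<in> I" "f \<noteq> 0" using sub_idealD(2)[OF I] by blast
    then obtain c where c: "f = (\<lambda>_. c)" using const sub_idealD(1)[OF I] by blast
    have c0: "c \<noteq> 0" using f(2) c by (auto simp: zero_fun_def)
    have "g \<in> gideal (alg {}) {f}" if "g \<in> I" for g
    proof -
      have "g * (\<lambda>_. inverse c) \<in> alg {}" using that sub_idealD(1)[OF I] by (intro alg_mult alg_const) blast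
      from gideal_gen[OF this, of f "{f}"] have "g * (\<lambda>_. inverse c) * f \<in> gideal (alg {}) {f}" by simp
      moreover have "g * (\<lambda>_. inverse c) * f = g" unfolding c by (rule ext) (simp add: fun_apply c0)
      ultimately show ?thesis by simp
    qed
    then show ?thesis using f(1) by (intro exI[of _ "{f}"]) auto
  qed
qed

text \<open>Hilbert's argument with ideals of leading coefficients, where a leading coefficient is
  one of some representation. These ideals increase with the degree, and the finitely many
  generators of their union already appear in degree \<open>N\<close>.\<close>

lemma hilbert_basis:
  assumes R: "noetherian (alg Z)"
  shows "noetherian (alg (insert t Z))"
  unfolding noetherian_def
proof (intro allI impI)
  let ?R = "alg Z" and ?R' = "alg (insert t Z)"
  fix I assume I: "sub_ideal ?R' I"
  note ID = sub_idealD[OF I]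
  have RR: "r \<in> ?R'" if "r \<in> ?R" for r using alg_mono[of Z "insert t Z"] that by blast
  have tR: "t ^ k \<in> ?R'" for k by (intro alg_power alg_gen) simp
  define lead where "lead n = {r \<in> ?R. \<exists>g\<in>pol_lt ?R t n. r * t ^ n + g \<in> I}" for n
  have lead_ideal: "sub_ideal ?R (lead n)" for n
    unfolding sub_ideal_def
  proof (intro conjI ballI)
    show "lead n \<subseteq> ?R" by (auto simp: lead_def)
    show "0 \<in> lead n" unfolding lead_def using alg_0 pol_lt_0 ID(2) by force
    fix r assume r: "r \<in> lead n"
    then obtain g where g: "r \<in> ?R" "g \<in> pol_lt ?R t n" "r * t ^ n + g \<in> I" unfolding lead_def by blast
    show "r + r' \<in> lead n" if r': "r' \<in> lead n" for r'
    proof -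
      obtain g' where g': "r' \<in> ?R" "g' \<in> pol_lt ?R t n" "r' * t ^ n + g' \<in> I" using r' unfolding lead_def by blast
      have "(r + r') * t ^ n + (g + g') = (r * t ^ n + g) + (r' * t ^ n + g')" by (simp add: algebra_simps)
      then have "(r + r') * t ^ n + (g + g') \<in> I" using ID(3)[OF g(3) g'(3)] by (simp only:)
      then show ?thesis unfolding lead_def using alg_add[OF g(1) g'(1)] pol_lt_add[OF g(2) g'(2)] by blast
    qed
    show "s * r \<in> lead n" if s: "s \<in> ?R" for s
    proof -
      have "(s * r) * t ^ n + s * g = s * (r * t ^ n + g)" by (simp add: algebra_simps)
      then have "(s * r) * t ^ n + s * g \<in> I" using ID(4)[OF g(3) RR[OF s]] by (simp only:)
      then show ?thesis unfolding lead_def using alg_mult[OF s g(1)] pol_lt_mult[OF g(2) s] by blast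
    qed
  qed
  have lead_mono: "lead n \<subseteq> lead k" if "n \<le> k" for n k
  proof
    fix r assume "r \<in> lead n"
    then obtain g where g: "r \<in> ?R" "g \<in> pol_lt ?R t n" "r * t ^ n + g \<in> I" unfolding lead_def by blast
    have "t ^ (k - n) * (r * t ^ n + g) \<in> I" by (rule ID(4)[OF g(3) tR])
    moreover have "t ^ (k - n) * (r * t ^ n + g) = r * t ^ k + t ^ (k - n) * g"
      using power_add[of t "k - n" n] that by (simp add: algebra_simps)
    moreover have "t ^ (k - n) * g \<in> pol_lt ?R t k" by (rule pol_lt_shift[OF g(2)]) (use that in simp)
    ultimately show "r \<in> lead k" unfolding lead_def using g(1) by auto
  qed
  define L where "L = (\<Union>n. lead n)"
  have "sub_ideal ?R L"
    unfolding sub_ideal_def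
  proof (intro conjI ballI)
    show "L \<subseteq> ?R" using sub_idealD(1)[OF lead_ideal] unfolding L_def by blast
    show "0 \<in> L" using sub_idealD(2)[OF lead_ideal] unfolding L_def by blast
    fix r assume "r \<in> L"
    then obtain n where n: "r \<in> lead n" unfolding L_def by blast
    show "s * r \<in> L" if "s \<in> ?R" for s using sub_idealD(4)[OF lead_ideal n that] unfolding L_def by blast
    fix r' assume "r' \<in> L"
    then obtain k where k: "r' \<in> lead k" unfolding L_def by blast
    have "r \<in> lead (max n k)" "r' \<in> lead (max n k)" using lead_mono[of n "max n k"] lead_mono[of k "max n k"] n k by auto
    then show "r + r' \<in> L" using sub_idealD(3)[OF lead_ideal] unfolding L_def by blast
  qed
  then obtain F where F: "F \<subseteq> L" "finite F" "L \<subseteq> gideal ?R F" using R unfolding noetherian_def by blast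
  have "\<exists>N. F \<subseteq> lead N"
    using F(2,1)
  proof (induction F)
    case (insert r F)
    then obtain N where N: "F \<subseteq> lead N" by blast
    obtain k where k: "r \<in> lead k" using insert.prems unfolding L_def by blast
    have "insert r F \<subseteq> lead (max N k)" using lead_mono[of N "max N k"] lead_mono[of k "max N k"] N k by auto
    then show ?case by blast
  qed simp
  then obtain N where N: "F \<subseteq> lead N" by blast
  have "\<forall>n. \<exists>H. H \<subseteq> lead n \<and> finite H \<and> lead n \<subseteq> gideal ?R H"
    using R lead_ideal unfolding noetherian_def by blast
  from choice[OF this] obtain Hl where Hl: "\<forall>n. Hl n \<subseteq> lead n \<and> finite (Hl n) \<and> lead n \<subseteq> gideal ?R (Hl n)" ..
  \<comment> \<open>Below \<open>N\<close> every degree has its own generators; from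
    \<open>N\<close> on the generators \<open>F\<close> of the union serve.\<close>
  define G where "G n = (if n < N then Hl n else F)" for n
  have G: "G n \<subseteq> lead (min n N)" "finite (G n)" "lead n \<subseteq> gideal ?R (G n)" for n
  proof -
    have "lead n \<subseteq> gideal ?R F" using F(3) unfolding L_def by blast
    then show "G n \<subseteq> lead (min n N)" "finite (G n)" "lead n \<subseteq> gideal ?R (G n)"
      using Hl F(2) N by (simp_all add: G_def min_def)
  qed
  define lift where "lift n r = (SOME h. h \<in> I \<and> (\<exists>g\<in>pol_lt ?R t n. h = r * t ^ n + g))" for n r
  have lift: "lift n r \<in> I \<and> (\<exists>g\<in>pol_lt ?R t n. lift n r = r * t ^ n + g)" if "r \<in> lead n" for n r
  proof -
    have "\<exists>h. h \<in> I \<and> (\<exists>g\<in>pol_lt ?R t n. h = r * t ^ n + g)" using that unfolding lead_def by blast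
    from someI_ex[OF this] show ?thesis unfolding lift_def .
  qed
  define H where "H = (\<Union>n\<le>N. lift n ` G n)"
  have H: "H \<subseteq> I" "finite H"
  proof -
    show "H \<subseteq> I"
    proof
      fix h assume "h \<in> H"
      then obtain n r where "n \<le> N" "r \<in> G n" "h = lift n r" unfolding H_def by blast
      moreover have "r \<in> lead n" using G(1)[of n] \<open>r \<in> G n\<close> \<open>n \<le> N\<close> by (auto simp: min_def)
      ultimately show "h \<in> I" using lift by blast
    qed
    show "finite H" unfolding H_def using G(2) by simp
  qed
  have GN: "G n = G (min n N)" for n by (auto simp: G_def min_def)
  have uminus_g: "- f \<in> pol_lt ?R t n" if "f \<in> pol_lt ?R t n" for f n
    using pol_lt_mult[OF that alg_uminus[OF alg_1]] by simp
  \<comment> \<open>The generators live in degree \<open>min n N\<close>, and the missing power of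
    \<open>t\<close> shifts them up to degree \<open>n\<close>. Subtracting such an \<open>h\<close>
    lowers the degree bound of a member of \<open>I\<close>.\<close>
  have lt_cancel: "\<exists>h\<in>gideal ?R' H. \<exists>g\<in>pol_lt ?R t n. h = r * t ^ n + g" if "r \<in> gideal ?R (G n)" for r n
    using that
  proof (induction rule: gideal.induct)
    case gideal_0
    show ?case by (intro bexI[of _ 0]) (auto simp: pol_lt_0 intro: gideal.gideal_0)
  next
    case (gideal_step f s r0)
    then obtain h g where hg: "h \<in> gideal ?R' H" "g \<in> pol_lt ?R t n" "h = f * t ^ n + g" by blast
    let ?k = "min n N"
    have r0: "r0 \<in> lead ?k" "r0 \<in> G ?k" using gideal_step.hyps G(1)[of n] GN[of n] by auto
    obtain g' where g': "g' \<in> pol_lt ?R t ?k" "lift ?k r0 = r0 * t ^ ?k + g'" using lift[OF r0(1)] by blast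
    have "lift ?k r0 \<in> H" unfolding H_def using r0(2) by auto
    then have "h + s * t ^ (n - ?k) * lift ?k r0 \<in> gideal ?R' H"
      by (intro gideal.gideal_step[OF hg(1)] alg_mult RR tR gideal_step.hyps)
    moreover have "h + s * t ^ (n - ?k) * lift ?k r0 = (f + s * r0) * t ^ n + (g + s * (t ^ (n - ?k) * g'))"
      using power_add[of t "n - ?k" ?k] unfolding hg(3) g'(2) by (simp add: algebra_simps)
    moreover have "g + s * (t ^ (n - ?k) * g') \<in> pol_lt ?R t n"
      by (intro pol_lt_add hg(2) pol_lt_mult pol_lt_shift[OF g'(1)] gideal_step.hyps) simp
    ultimately show ?case by blast
  qed
  have neg_gideal: "- h \<in> gideal ?R' H" if "h \<in> gideal ?R' H" for h
    using that
  proof (induction rule: gideal.induct)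
    case (gideal_step f s r0)
    have "- f + (- s) * r0 \<in> gideal ?R' H" by (intro gideal.gideal_step gideal_step alg_uminus)
    then show ?case by simp
  qed (simp add: gideal.gideal_0)
  have main: "f \<in> I \<Longrightarrow> f \<in> pol_lt ?R t n \<Longrightarrow> f \<in> gideal ?R' H" for f n
  proof (induction n arbitrary: f)
    case 0
    then have "f = 0" unfolding pol_lt_def by auto
    then show ?case by (simp add: gideal_0)
  next
    case (Suc n)
    then obtain q where q: "\<forall>l. q l \<in> ?R" "f = (\<Sum>l<Suc n. q l * t ^ l)" unfolding pol_lt_def by auto
    define low where "low = (\<Sum>l<n. q l * t ^ l)"
    have low: "low \<in> pol_lt ?R t n" using q(1) unfolding low_def pol_lt_def by blast
    have f: "f = q n * t ^ n + low" unfolding q(2) low_def by (simp add: add.commute)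
    have "q n \<in> lead n" unfolding lead_def using q(1) low Suc.prems(1) f by blast
    then have "q n \<in> gideal ?R (G n)" using G(3) by blast
    from lt_cancel[OF this] obtain h g where hg: "h \<in> gideal ?R' H" "g \<in> pol_lt ?R t n" "h = q n * t ^ n + g" by blast
    have eq: "f + (- h) = low + (- g)" unfolding f hg(3) by simp
    have "low + (- g) \<in> pol_lt ?R t n" by (rule pol_lt_add[OF low uminus_g[OF hg(2)]])
    moreover have "low + (- g) \<in> I"
      unfolding eq[symmetric]
      by (rule ID(3)[OF Suc.prems(1) gideal_subset[OF I H(1) neg_gideal[OF hg(1)]]])
    ultimately have "low + (- g) \<in> gideal ?R' H" by (intro Suc.IH)
    from gideal_add[OF this hg(1)] have "h + (low + - g) \<in> gideal ?R' H" .
    then show ?case unfolding eq[symmetric] by simp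
  qed
  have "I \<subseteq> gideal ?R' H" using main pol_lt_exists ID(1) by blast
  then show "\<exists>H\<subseteq>I. finite H \<and> I \<subseteq> gideal ?R' H" using H by blast
qed

lemma noetherian_finitely_generated: "finite Z \<Longrightarrow> noetherian (alg Z)"
  by (induction Z rule: finite_induct) (auto intro: noetherian_constants hilbert_basis)

text \<open>The ideal generated by \<open>P\<close> has finitely many generators, and each of these
  is a combination of finitely many members of \<open>P\<close>.\<close>

theorem finite_common_zeros:
  fixes P :: "(('a::finite \<Rightarrow> complex) \<Rightarrow> complex) set"
  assumes P: "P \<subseteq> polyfun"
  shows "\<exists>Q\<subseteq>P. finite Q \<and> (\<forall>x. (\<forall>f\<in>Q. f x = 0) \<longrightarrow> (\<forall>f\<in>P. f x = 0))"
proof -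
  have sub: "gideal polyfun P \<subseteq> polyfun"
  proof
    fix f assume "f \<in> gideal polyfun P"
    then show "f \<in> polyfun" by induction (use P in \<open>auto intro: polyfun_closed\<close>)
  qed
  have mult: "s * f \<in> gideal polyfun P" if "f \<in> gideal polyfun P" "s \<in> polyfun" for f s
    using that(1)
  proof induction
    case (gideal_step f r h)
    have "s * f + (s * r) * h \<in> gideal polyfun P"
      by (intro gideal.gideal_step gideal_step polyfun_mult that(2))
    then show ?case by (simp add: algebra_simps)
  qed (simp add: gideal.gideal_0)
  have "sub_ideal polyfun (gideal polyfun P)"
    unfolding sub_ideal_def using sub mult by (blast intro: gideal_0 gideal_add)
  moreover have "noetherian (polyfun :: (('a \<Rightarrow> complex) \<Rightarrow> complex) set)"
    unfolding polyfun_eq_alg by (rule noetherian_finitely_generated) simp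
  ultimately obtain H where H: "H \<subseteq> gideal polyfun P" "finite H" "gideal polyfun P \<subseteq> gideal polyfun H"
    unfolding noetherian_def by blast
  have "\<exists>Q\<subseteq>P. finite Q \<and> h \<in> gideal polyfun Q" if "h \<in> gideal polyfun P" for h
    using that
  proof induction
    case gideal_0
    then show ?case by (intro exI[of _ "{}"]) (simp add: gideal.gideal_0)
  next
    case (gideal_step f r h)
    then obtain Q where Q: "Q \<subseteq> P" "finite Q" "f \<in> gideal polyfun Q" by blast
    have "f \<in> gideal polyfun (insert h Q)" by (rule gideal_mono[OF Q(3)]) auto
    then have "f + r * h \<in> gideal polyfun (insert h Q)" by (rule gideal.gideal_step[OF _ gideal_step.hyps(2)]) simp
    then show ?case using Q(1,2) gideal_step.hyps(3) by (intro exI[of _ "insert h Q"]) simp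
  qed
  then have "\<forall>h\<in>H. \<exists>Q. Q \<subseteq> P \<and> finite Q \<and> h \<in> gideal polyfun Q" using H(1) by blast
  from bchoice[OF this] obtain q where q: "\<forall>h\<in>H. q h \<subseteq> P \<and> finite (q h) \<and> h \<in> gideal polyfun (q h)" ..
  define Q where "Q = (\<Union>h\<in>H. q h)"
  have "f x = 0" if Q0: "\<forall>f\<in>Q. f x = 0" and f: "f \<in> P" for f x
  proof -
    have "1 * f \<in> gideal polyfun P" by (rule gideal_gen[OF polyfun_1 f])
    then have "f \<in> gideal polyfun H" using H(3) by auto
    moreover have "h x = 0" if h: "h \<in> H" for h
      using q h Q0 unfolding Q_def by (intro gideal_vanish[of h polyfun "q h"]) auto
    ultimately show ?thesis by (rule gideal_vanish)
  qed
  moreover have "Q \<subseteq> P" "finite Q" using q H(2) unfolding Q_def by auto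
  ultimately show ?thesis by blast
qed

section \<open>Rational functions on open subsets\<close>

lemma algebraic_over_mono: "algebraic_over R z \<Longrightarrow> R \<subseteq> R' \<Longrightarrow> algebraic_over R' z"
  unfolding algebraic_over_def by (meson subsetD)

lemma growth_adjoin_set:
  assumes "finite J" "growth (alg Z) t"
  shows "growth (alg (Z \<union> z ` J)) (t + card J)"
  using assms
proof (induction J)
  case (insert j J)
  then have "growth (alg (Z \<union> z ` J)) (t + card J)" by simp
  from growth_adjoin[OF this, of "z j"] show ?case using insert.hyps by (simp add: alg_alg_insert)
qed simp

lemma growth_adjoin_algebraic_set:
  assumes "finite J" "growth (alg Z) t" "no_zero_divisors (alg (Z \<union> z ` J))"
    "\<forall>j\<in>J. algebraic_over (alg Z) (z j)"
  shows "growth (alg (Z \<union> z ` J)) t"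
  using assms
proof (induction J)
  case (insert j J)
  have dom: "no_zero_divisors (alg (Z \<union> z ` J))"
    using insert.prems(2) by (rule no_zero_divisors_subset) (rule alg_mono, auto)
  have gr: "growth (alg (Z \<union> z ` J)) t" using insert dom by simp
  have "algebraic_over (alg (Z \<union> z ` J)) (z j)"
    by (rule algebraic_over_mono[of "alg Z"]) (use insert.prems in simp, rule alg_mono, simp)
  from growth_adjoin_algebraic[OF gr dom this] show ?case by (simp add: alg_alg_insert)
qed simp

lemma algebraic_over_fraction:
  assumes "a \<in> alg Z" "b \<in> alg Z" "b \<noteq> 0" "z * b = a"
  shows "algebraic_over (alg Z) z"
proof -
  define p :: "nat \<Rightarrow> 'a \<Rightarrow> complex" where "p l = (if l = 0 then - a else if l = 1 then b else 0)" for l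
  have "\<forall>l. p l \<in> alg Z" using assms by (auto simp: p_def intro: alg_uminus alg_0)
  moreover have "p 1 \<noteq> 0" using assms(3) by (simp add: p_def)
  moreover have "(\<Sum>l\<le>1. p l * z ^ l) = 0" using assms(4) by (simp add: p_def mult.commute)
  ultimately show ?thesis unfolding algebraic_over_def by (intro exI[of _ p] exI[of _ "1 :: nat"]) auto
qed

text \<open>Quotients of polynomials without poles on \<open>U\<close>, read through the retraction
  so that a function is determined by its values on \<open>U\<close>.\<close>

definition ratl :: "('a \<Rightarrow> complex) set \<Rightarrow> (('a \<Rightarrow> complex) \<Rightarrow> complex) set" where
  "ratl U = {f. \<exists>p\<in>polyfun. \<exists>q\<in>polyfun. (\<forall>x\<in>U. q x \<noteq> 0) \<and> (\<forall>x. f x = p (retr U x) / q (retr U x))}"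

lemma ratlI: "p \<in> polyfun \<Longrightarrow> q \<in> polyfun \<Longrightarrow> \<forall>x\<in>U. q x \<noteq> 0 \<Longrightarrow>
  (\<And>x. f x = p (retr U x) / q (retr U x)) \<Longrightarrow> f \<in> ratl U"
  unfolding ratl_def by blast

lemma ratlE:
  assumes "f \<in> ratl U"
  obtains p q where "p \<in> polyfun" "q \<in> polyfun" "\<forall>x\<in>U. q x \<noteq> 0" "\<forall>x. f x = p (retr U x) / q (retr U x)"
  using assms unfolding ratl_def by blast

lemma alg_subset_ratl:
  assumes U: "U \<noteq> {}" and Z: "Z \<subseteq> ratl U" and f: "f \<in> alg Z"
  shows "f \<in> ratl U"
  using f
proof induction
  case (alg_const c)
  show ?case by (rule ratlI[of "\<lambda>_. c" 1]) (auto simp: one_fun_apply intro: polyfun_const polyfun_1)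
next
  case (alg_gen z)
  then show ?case using Z by blast
next
  case (alg_add f g)
  obtain p q where f: "p \<in> polyfun" "q \<in> polyfun" "\<forall>x\<in>U. q x \<noteq> 0" "\<forall>x. f x = p (retr U x) / q (retr U x)"
    using alg_add.IH(1) by (rule ratlE)
  obtain r s where g: "r \<in> polyfun" "s \<in> polyfun" "\<forall>x\<in>U. s x \<noteq> 0" "\<forall>x. g x = r (retr U x) / s (retr U x)"
    using alg_add.IH(2) by (rule ratlE)
  show ?case
  proof (rule ratlI[of "p * s + r * q" "q * s"])
    fix x have "q (retr U x) \<noteq> 0" "s (retr U x) \<noteq> 0" using f(3) g(3) retr_in[OF U] by blast+
    then show "(f + g) x = (p * s + r * q) (retr U x) / (q * s) (retr U x)"
      by (simp add: plus_fun_apply times_fun_apply f(4) g(4) add_frac_eq)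
  qed (use f g in \<open>auto simp: times_fun_apply intro: polyfun_closed\<close>)
next
  case (alg_mult f g)
  obtain p q where f: "p \<in> polyfun" "q \<in> polyfun" "\<forall>x\<in>U. q x \<noteq> 0" "\<forall>x. f x = p (retr U x) / q (retr U x)"
    using alg_mult.IH(1) by (rule ratlE)
  obtain r s where g: "r \<in> polyfun" "s \<in> polyfun" "\<forall>x\<in>U. s x \<noteq> 0" "\<forall>x. g x = r (retr U x) / s (retr U x)"
    using alg_mult.IH(2) by (rule ratlE)
  show ?case
    by (rule ratlI[of "p * r" "q * s"]) (use f g in \<open>auto simp: times_fun_apply intro: polyfun_closed\<close>)
qed

lemma no_zero_divisors_ratl:
  assumes X: "zirred X" and \<beta>: "\<beta> \<in> polyfun" and U: "U = {x \<in> X. \<beta> x \<noteq> 0}" "U \<noteq> {}" and Z: "Z \<subseteq> ratl U"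
  shows "no_zero_divisors (alg Z)"
  unfolding no_zero_divisors_def
proof (intro ballI impI)
  fix f g assume "f \<in> alg Z" "g \<in> alg Z" and fg: "f * g = 0"
  then have fr: "f \<in> ratl U" and gr: "g \<in> ratl U" using alg_subset_ratl[OF U(2) Z] by auto
  obtain p q where f: "p \<in> polyfun" "q \<in> polyfun" "\<forall>x\<in>U. q x \<noteq> 0" "\<forall>x. f x = p (retr U x) / q (retr U x)"
    using fr by (rule ratlE)
  obtain r s where g: "r \<in> polyfun" "s \<in> polyfun" "\<forall>x\<in>U. s x \<noteq> 0" "\<forall>x. g x = r (retr U x) / s (retr U x)"
    using gr by (rule ratlE)
  \<comment> \<open>The extra factor \<open>\<beta>\<close> extends the identity from
    \<open>U\<close> to all of \<open>X\<close>, where irreducibility can be used.\<close>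
  have "p x * (r * \<beta>) x = 0" if "x \<in> X" for x
  proof (cases "\<beta> x = 0")
    case False
    then have x: "x \<in> U" using that U by simp
    have "f x * g x = 0" using fun_cong[OF fg, of x] by (simp add: times_fun_apply zero_fun_apply)
    then have "p x * r x = 0" using f(3,4) g(3,4) x by (auto simp: retr_id)
    then show ?thesis by (auto simp: times_fun_apply)
  qed (simp add: times_fun_apply)
  then consider "\<forall>x\<in>X. p x = 0" | "\<forall>x\<in>X. (r * \<beta>) x = 0"
    using zirred_no_zero_divisors[OF X f(1) polyfun_mult[OF g(1) \<beta>]] by blast
  then show "f = 0 \<or> g = 0"
  proof cases
    case 1
    then have "f x = 0" for x using f(4) retr_in[OF U(2), of x] U(1) by simp
    then show ?thesis by (simp add: fun_eq_iff zero_fun_apply)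
  next
    case 2
    then have "g x = 0" for x using g(4) retr_in[OF U(2), of x] U(1) by (auto simp: times_fun_apply)
    then show ?thesis by (simp add: fun_eq_iff zero_fun_apply)
  qed
qed

lemma coord_ratl: "coord i \<circ> retr U \<in> ratl U"
  by (rule ratlI[of "coord i" 1]) (simp_all add: one_fun_apply polyfun_coord polyfun_1)

lemma very_genericI:
  assumes H: "countable H" "H \<noteq> {}" "\<And>h. h \<in> H \<Longrightarrow> h \<in> polyfun \<and> (\<exists>x\<in>X. h x \<noteq> 0)"
    and P: "\<And>x. x \<in> X \<Longrightarrow> \<forall>h\<in>H. h x \<noteq> 0 \<Longrightarrow> P x"
  shows "very_generic X P"
  unfolding very_generic_def
proof (intro exI[of _ "\<lambda>k. {x. from_nat_into H k x = 0}"] conjI allI ballI impI)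
  fix k
  have h: "from_nat_into H k \<in> H" by (rule from_nat_into[OF H(2)])
  show "zclosed {x. from_nat_into H k x = 0}" using H(3)[OF h] by (intro zclosed_zero_set) blast
  show "X - {x. from_nat_into H k x = 0} \<noteq> {}" using H(3)[OF h] by blast
next
  fix x assume "x \<in> X" and x: "\<forall>k. x \<notin> {x. from_nat_into H k x = 0}"
  have "h x \<noteq> 0" if "h \<in> H" for h
    using x from_nat_into_surj[OF H(1) that] by auto
  then show "P x" using P[OF \<open>x \<in> X\<close>] by blast
qed

context foliated
begin

text \<open>A chosen polynomial representing a regular function; needed because elements of
  \<open>A\<close> are cut off outside \<open>X\<close> and so are not polynomial functions
  themselves.\<close>

definition pext :: "(('n \<Rightarrow> complex) \<Rightarrow> complex) \<Rightarrow> ('n \<Rightarrow> complex) \<Rightarrow> complex" where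
  "pext f = (SOME p. p \<in> polyfun \<and> f = rst X p)"

lemma pext: "f \<in> A \<Longrightarrow> pext f \<in> polyfun" "f \<in> A \<Longrightarrow> x \<in> X \<Longrightarrow> pext f x = f x"
proof -
  assume "f \<in> A"
  then have "\<exists>p. p \<in> polyfun \<and> f = rst X p" unfolding regfun_eq by blast
  then have e: "pext f \<in> polyfun \<and> f = rst X (pext f)" unfolding pext_def by (rule someI_ex)
  then show "pext f \<in> polyfun" by blast
  assume "x \<in> X"
  then have "rst X (pext f) x = pext f x" by (rule rst_apply)
  then show "pext f x = f x" using e by simp
qed

lemma A_nonzero_point: "f \<in> A \<Longrightarrow> f \<noteq> 0 \<Longrightarrow> \<exists>x\<in>X. f x \<noteq> 0"
  using regfun_eq_0 by blast

lemma A_eqI: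
  assumes "f \<in> A" "g \<in> A" "\<And>x. x \<in> X \<Longrightarrow> f x = g x"
  shows "f = g"
proof
  fix x show "f x = g x" using assms regfun_outside[of f X x] regfun_outside[of g X x] by (cases "x \<in> X") auto
qed

lemma A_zero_on_open:
  assumes f: "f \<in> A" and B: "B \<in> A" "B \<noteq> 0" and zero: "\<And>x. x \<in> X \<Longrightarrow> B x \<noteq> 0 \<Longrightarrow> f x = 0"
  shows "f = 0"
proof -
  have "f * B = 0" by (rule A_eqI[OF mult_in[OF f B(1)] zero_in]) (use zero in \<open>auto simp: times_fun_apply zero_fun_apply\<close>)
  then show ?thesis using A_domain[OF f B(1)] B(2) by blast
qed

lemma A_retr_ratl:
  assumes a: "a \<in> A" and b: "b \<in> A" "\<forall>x\<in>U. b x \<noteq> 0" and U: "U \<subseteq> X" "U \<noteq> {}"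
  shows "(\<lambda>x. a x / b x) \<circ> retr U \<in> ratl U"
proof (rule ratlI[of "pext a" "pext b"])
  show "pext a \<in> polyfun" "pext b \<in> polyfun" using a b pext(1) by auto
  have e: "x \<in> U \<Longrightarrow> pext a x = a x" "x \<in> U \<Longrightarrow> pext b x = b x" for x using pext(2)[OF a] pext(2)[OF b(1)] U(1) by auto
  show "\<forall>x\<in>U. pext b x \<noteq> 0" using e(2) b(2) by simp
  show "((\<lambda>x. a x / b x) \<circ> retr U) x = pext a (retr U x) / pext b (retr U x)" for x
    using e retr_in[OF U(2), of x] by simp
qed

text \<open>Otherwise each of the countably many pairs of a finite \<open>E\<close> in
  \<open>exps T\<close> and an index in \<open>E\<close> has a function \<open>\<delta>\<close>
  forcing that entry of any pointwise kernel vector to vanish. At a point where all these functions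
  are nonzero, \<open>T\<close> is independent on V(F,x), whose dimension is then too large.\<close>

lemma exists_kernel_vector:
  assumes T: "\<forall>x\<in>X. zdim (Vset X Fs {x}) < card T"
  shows "\<exists>E v \<beta>. finite E \<and> E \<subseteq> exps T \<and> \<beta> \<in> E \<and> ker E v \<and> v \<beta> \<noteq> 0"
proof (rule ccontr)
  assume no: "\<not> ?thesis"
  define Pairs where "Pairs = {(E, \<beta>). finite E \<and> E \<subseteq> exps T \<and> \<beta> \<in> E}"
  have "\<forall>P\<in>Pairs. \<exists>\<delta>. \<delta> \<in> A \<and> \<delta> \<noteq> 0 \<and> (\<forall>x f. \<delta> x \<noteq> 0 \<longrightarrow> kernel_at (fst P) f x \<longrightarrow> f (snd P) = 0)"
  proof
    fix P assume "P \<in> Pairs"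
    then obtain E \<beta> where P: "P = (E, \<beta>)" "finite E" "E \<subseteq> exps T" "\<beta> \<in> E" unfolding Pairs_def by blast
    from ker_or_point_condition[OF P(2,4)] show "\<exists>\<delta>. \<delta> \<in> A \<and> \<delta> \<noteq> 0 \<and> (\<forall>x f. \<delta> x \<noteq> 0 \<longrightarrow> kernel_at (fst P) f x \<longrightarrow> f (snd P) = 0)"
    proof (elim disjE)
      assume "\<exists>v. ker E v \<and> v \<beta> \<noteq> 0"
      then show ?thesis using no P by blast
    next
      assume "\<exists>\<delta>\<in>A. \<delta> \<noteq> 0 \<and> (\<forall>x f. \<delta> x \<noteq> 0 \<longrightarrow> kernel_at E f x \<longrightarrow> f \<beta> = 0)"
      then show ?thesis unfolding P(1) fst_conv snd_conv by (elim bexE) (rule exI, rule conjI)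
    qed
  qed
  from bchoice[OF this] obtain \<delta> where \<delta>: "\<forall>P\<in>Pairs. \<delta> P \<in> A \<and> \<delta> P \<noteq> 0 \<and>
    (\<forall>x f. \<delta> P x \<noteq> 0 \<longrightarrow> kernel_at (fst P) f x \<longrightarrow> f (snd P) = 0)" ..
  have "countable Pairs"
  proof (rule countable_subset)
    show "Pairs \<subseteq> {E. finite E} \<times> UNIV" unfolding Pairs_def by blast
    show "countable ({E :: ('n \<Rightarrow> nat) set. finite E} \<times> (UNIV :: ('n \<Rightarrow> nat) set))"
      using countable_Collect_finite by (intro countable_SIGMA) auto
  qed
  then have "countable ((\<lambda>P. pext (\<delta> P)) ` Pairs)" by simp
  moreover have "h \<in> polyfun \<and> (\<exists>x\<in>X. h x \<noteq> 0)" if hP: "h \<in> (\<lambda>P. pext (\<delta> P)) ` Pairs" for h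
  proof -
    obtain P where P: "P \<in> Pairs" "h = pext (\<delta> P)" using hP by blast
    have d: "\<delta> P \<in> A" "\<delta> P \<noteq> 0" using \<delta> P(1) by auto
    obtain y where "y \<in> X" "\<delta> P y \<noteq> 0" using A_nonzero_point[OF d] by blast
    then show ?thesis unfolding P(2) using pext[OF d(1)] by (intro conjI bexI[of _ y]) auto
  qed
  ultimately obtain x where x: "x \<in> X" "\<forall>h\<in>(\<lambda>P. pext (\<delta> P)) ` Pairs. h x \<noteq> 0"
    using exists_very_generic_point[OF irr, of "(\<lambda>P. pext (\<delta> P)) ` Pairs"] by blast
  have "alg_independent_on (Vset X Fs {x}) T coord"
    unfolding alg_independent_mo
  proof (intro allI impI ballI)
    fix E c \<beta> assume E: "finite E \<and> E \<subseteq> exps T \<and> (\<forall>y\<in>Vset X Fs {x}. (\<Sum>e\<in>E. c e * mo e y) = 0)" and \<beta>: "\<beta> \<in> E"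
    then have P: "(E, \<beta>) \<in> Pairs" unfolding Pairs_def by blast
    have "kernel_at E c x" using kernel_at_vanish[OF x(1)] E by blast
    moreover have "\<delta> (E, \<beta>) x \<noteq> 0" using x P \<delta> pext(2)[of "\<delta> (E, \<beta>)" x] by auto
    ultimately show "c \<beta> = 0" using bspec[OF \<delta> P] by simp
  qed
  then have "card T \<le> zdim (Vset X Fs {x})"
    using zdim_eq_independent(2)[OF zirred_Vset[OF x(1)], of UNIV T] by simp
  then show False using T x(1) by force
qed

section \<open>Fractions annihilated by the foliation and independence transversal to V(F,x)\<close>

definition cfrac :: "('n \<Rightarrow> complex) set \<Rightarrow> (('n \<Rightarrow> complex) \<Rightarrow> complex) \<Rightarrow> bool" where
  "cfrac U f \<longleftrightarrow> (\<exists>a b. con a b \<and> (\<forall>x\<in>U. b x \<noteq> 0 \<and> f x = a x / b x))"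

lemma cfracI: "con a b \<Longrightarrow> (\<And>x. x \<in> U \<Longrightarrow> b x \<noteq> 0 \<and> f x = a x / b x) \<Longrightarrow> cfrac U f"
  unfolding cfrac_def by blast

lemma cfrac_const: "U \<subseteq> X \<Longrightarrow> cfrac U (\<lambda>_. c)"
  by (rule cfracI[OF con_const[of c]]) (auto simp: times_fun_apply rst_apply one_fun_apply)

lemma cfrac_add:
  assumes "cfrac U f" "cfrac U g"
  shows "cfrac U (f + g)"
proof -
  obtain a b c d where 1: "con a b" "\<forall>x\<in>U. b x \<noteq> 0 \<and> f x = a x / b x" and 2: "con c d" "\<forall>x\<in>U. d x \<noteq> 0 \<and> g x = c x / d x"
    using assms unfolding cfrac_def by auto
  show ?thesis
    by (rule cfracI[OF con_add[OF 1(1) 2(1)]]) (use 1(2) 2(2) in \<open>simp add: plus_fun_apply times_fun_apply add_frac_eq\<close>)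
qed

lemma cfrac_mult:
  assumes "cfrac U f" "cfrac U g"
  shows "cfrac U (f * g)"
proof -
  obtain a b c d where 1: "con a b" "\<forall>x\<in>U. b x \<noteq> 0 \<and> f x = a x / b x" and 2: "con c d" "\<forall>x\<in>U. d x \<noteq> 0 \<and> g x = c x / d x"
    using assms unfolding cfrac_def by auto
  show ?thesis
    by (rule cfracI[OF con_mult[OF 1(1) 2(1)]]) (use 1(2) 2(2) in \<open>simp add: times_fun_apply\<close>)
qed

lemma cfrac_power: "U \<subseteq> X \<Longrightarrow> cfrac U f \<Longrightarrow> cfrac U (f ^ k)"
  using cfrac_const[of U 1] by (induction k) (simp_all add: cfrac_mult one_fun_def)

lemma cfrac_prod: "U \<subseteq> X \<Longrightarrow> (\<And>i. i \<in> I \<Longrightarrow> cfrac U (f i)) \<Longrightarrow> cfrac U (\<Prod>i\<in>I. f i)"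
  using cfrac_const[of U 1]
  by (induction I rule: infinite_finite_induct) (simp_all add: cfrac_mult one_fun_def)

lemma cfrac_sum: "U \<subseteq> X \<Longrightarrow> (\<And>i. i \<in> I \<Longrightarrow> cfrac U (f i)) \<Longrightarrow> cfrac U (\<Sum>i\<in>I. f i)"
  using cfrac_const[of U 0]
  by (induction I rule: infinite_finite_induct) (simp_all add: cfrac_add zero_fun_def)

lemma cfrac_relation_vanish:
  assumes x0: "x0 \<in> X" and T: "alg_independent_on (Vset X Fs {x0}) T coord"
    and B: "B \<in> A" "B \<noteq> 0" and U: "U = {x \<in> X. B x \<noteq> 0}"
    and E: "finite E" "E \<subseteq> exps T" and q: "\<And>e. e \<in> E \<Longrightarrow> cfrac U (q e)"
    and rel: "\<And>x. x \<in> U \<Longrightarrow> (\<Sum>e\<in>E. q e x * mo e x) = 0" and e: "e \<in> E" and x: "x \<in> U"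
  shows "q e x = 0"
proof -
  have "\<forall>e\<in>E. \<exists>ab. con (fst ab) (snd ab) \<and> (\<forall>x\<in>U. snd ab x \<noteq> 0 \<and> q e x = fst ab x / snd ab x)"
    using q unfolding cfrac_def by auto
  from bchoice[OF this] obtain ab where
    ab: "\<forall>e\<in>E. con (fst (ab e)) (snd (ab e)) \<and> (\<forall>x\<in>U. snd (ab e) x \<noteq> 0 \<and> q e x = fst (ab e) x / snd (ab e) x)" ..
  have "\<forall>e\<in>E. con (fst (ab e)) (snd (ab e))" using ab by simp
  from con_common_denominator[OF E(1) this] obtain B' a' where
    B': "B' \<in> A" "B' \<noteq> 0" "\<forall>x\<in>X. B' x \<noteq> 0 \<longleftrightarrow> (\<forall>e\<in>E. snd (ab e) x \<noteq> 0)"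
    and a': "\<forall>e\<in>E. con (a' e) B' \<and> a' e * snd (ab e) = fst (ab e) * B'" by auto
  have B'U: "B' x \<noteq> 0" if "x \<in> U" for x using B'(3) ab that U by auto
  have a'U: "a' e x = q e x * B' x" if "e \<in> E" "x \<in> U" for e x
  proof -
    have "a' e * snd (ab e) = fst (ab e) * B'" using a' that(1) by blast
    from fun_cong[OF this, of x] have "a' e x * snd (ab e) x = fst (ab e) x * B' x" by (simp add: times_fun_apply)
    moreover have nz: "snd (ab e) x \<noteq> 0" and q: "q e x = fst (ab e) x / snd (ab e) x" using ab that by auto
    ultimately have "a' e x = fst (ab e) x * B' x / snd (ab e) x" by (simp add: eq_divide_eq)
    then show ?thesis by (simp add: q)
  qed
  have a'A: "a' e \<in> A" if "e \<in> E" for e using a' that con_in(1) by blast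
  \<comment> \<open>With denominators cleared the relation holds on a nonempty open set, hence
    everywhere on the irreducible \<open>X\<close>.\<close>
  have "(\<Sum>e\<in>E. a' e * m e) = 0"
  proof (rule A_zero_on_open[OF _ B])
    show "(\<Sum>e\<in>E. a' e * m e) \<in> A" by (intro sum_in mult_in a'A m_in)
    fix x assume "x \<in> X" "B x \<noteq> 0"
    then have x: "x \<in> U" "x \<in> X" using U by auto
    have "(\<Sum>e\<in>E. a' e * m e) x = (\<Sum>e\<in>E. B' x * (q e x * mo e x))"
      unfolding sum_fun_apply times_fun_apply
      by (intro sum.cong refl) (simp add: a'U x rst_apply)
    then show "(\<Sum>e\<in>E. a' e * m e) x = 0" using rel[OF x(1)] by (simp add: sum_distrib_left[symmetric])
  qed
  then have ker: "ker E a'" by (intro con_relation_imp_ker[OF _ B'(1,2)]) (use a' in blast)+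
  have "a' e = 0"
  proof (rule ccontr)
    assume "a' e \<noteq> 0"
    then have nz: "\<exists>e\<in>E. a' e \<noteq> 0" using e by blast
    have "\<forall>w\<in>lists Fs. \<forall>e\<in>E. apply_word w (m e) \<in> A" "\<forall>e\<in>E. a' e \<in> A"
      "\<forall>w\<in>lists Fs. (\<Sum>e\<in>E. a' e * apply_word w (m e)) = 0" using word_m_in a'A ker_word[OF ker] by auto
    from kernel_specialises[OF E(1) this nz, of x0] obtain f :: "('n \<Rightarrow> nat) \<Rightarrow> complex" where
      f: "\<exists>e\<in>E. f e \<noteq> 0" "\<forall>w\<in>lists Fs. (\<Sum>e\<in>E. f e * apply_word w (m e) x0) = 0" by auto
    have "kernel_at E f x0" using f(2) unfolding kernel_at_def .
    then have "\<forall>y\<in>Vset X Fs {x0}. (\<Sum>e\<in>E. f e * mo e y) = 0" using kernel_at_vanish[OF x0] by blast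
    then have "\<forall>e\<in>E. f e = 0" using T E unfolding alg_independent_mo by blast
    then show False using f(1) by blast
  qed
  then show ?thesis using a'U[OF e x] B'U[OF x] by (simp add: zero_fun_apply)
qed

text \<open>Each fraction satisfies an equation of degree one over the coordinate functions, so
  adjoining fractions does not raise the growth exponent.\<close>

lemma growth_on_open:
  assumes B: "B \<in> A" "B \<noteq> 0" and U: "U = {x \<in> X. B x \<noteq> 0}" and J: "finite J"
    and a: "\<forall>j\<in>J. a j \<in> A" and b: "\<forall>j\<in>J. b j \<in> A \<and> (\<forall>x\<in>U. b j x \<noteq> 0)"
  shows "\<exists>t\<le>zdim X. growth (alg (range (\<lambda>i. coord i \<circ> retr U) \<union> (\<lambda>j. (\<lambda>x. a j x / b j x) \<circ> retr U) ` J)) t"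
    and "no_zero_divisors (alg (range (\<lambda>i. coord i \<circ> retr U) \<union> (\<lambda>j. (\<lambda>x. a j x / b j x) \<circ> retr U) ` J))"
proof -
  let ?Z = "range (\<lambda>i. coord i \<circ> retr U)" and ?z = "\<lambda>j. (\<lambda>x. a j x / b j x) \<circ> retr U"
  have Une: "U \<noteq> {}" using A_nonzero_point[OF B] U by blast
  have UX: "U \<subseteq> X" using U by blast
  have Ueq: "U = {x \<in> X. pext B x \<noteq> 0}" unfolding U using pext(2)[OF B(1)] by auto
  have sub: "?Z \<union> ?z ` J \<subseteq> ratl U"
  proof (intro Un_least image_subsetI)
    show "coord i \<circ> retr U \<in> ratl U" for i by (rule coord_ratl)
    show "(\<lambda>x. a j x / b j x) \<circ> retr U \<in> ratl U" if "j \<in> J" for j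
      using a b that by (intro A_retr_ratl[OF _ _ _ UX Une]) auto
  qed
  show dom: "no_zero_divisors (alg (?Z \<union> ?z ` J))"
    by (rule no_zero_divisors_ratl[OF irr pext(1)[OF B(1)] Ueq Une sub])
  have domZ: "no_zero_divisors (alg ?Z)"
    using dom by (rule no_zero_divisors_subset) (rule alg_mono, simp)
  obtain T where T: "alg_independent_on UNIV T (\<lambda>i. coord i \<circ> retr U)" "growth (alg ?Z) (card T)"
    using growth_basis[of UNIV "\<lambda>i. coord i \<circ> retr U"] domZ by auto
  have "alg_independent_on U T coord" using T(1) alg_independent_on_pullback[OF range_retr[OF Une], of T coord] by blast
  then have "alg_independent_on X T coord" using alg_independent_on_mono UX by blast
  then have le: "card T \<le> zdim X" using zdim_eq_independent(2)[OF irr, of UNIV T] by simp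
  have "\<forall>j\<in>J. algebraic_over (alg ?Z) (?z j)"
  proof
    fix j assume j: "j \<in> J"
    have ext_alg: "c \<circ> retr U \<in> alg ?Z" if "c \<in> A" for c
    proof -
      have "pext c \<circ> retr U \<in> alg ((\<lambda>i. coord i \<circ> retr U) ` UNIV)" by (rule comp_retr_in_alg[OF Une _ pext(1)[OF that]]) simp
      moreover have "pext c \<circ> retr U = c \<circ> retr U" using pext(2)[OF that] retr_in[OF Une] UX by (auto simp: fun_eq_iff)
      ultimately show ?thesis by simp
    qed
    show "algebraic_over (alg ?Z) (?z j)"
    proof (rule algebraic_over_fraction)
      show "a j \<circ> retr U \<in> alg ?Z" "b j \<circ> retr U \<in> alg ?Z" using ext_alg a b j by auto
      show "b j \<circ> retr U \<noteq> 0" unfolding comp_retr_eq_0[OF Une] using b j Une by blast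
      show "?z j * (b j \<circ> retr U) = a j \<circ> retr U"
        by (rule ext) (use b j retr_in[OF Une] in \<open>simp add: times_fun_apply\<close>)
    qed
  qed
  from growth_adjoin_algebraic_set[OF J T(2) dom this] le
  show "\<exists>t\<le>zdim X. growth (alg (?Z \<union> ?z ` J)) t" by blast
qed

text \<open>The coordinates in \<open>T\<close> and the fractions indexed by \<open>J\<close> are
  jointly independent on \<open>U\<close>, whereas the algebra containing them has growth exponent
  at most \<open>zdim X\<close>.\<close>

lemma transversal_bound:
  fixes J :: "'j set"
  assumes x0: "x0 \<in> X" and T: "alg_independent_on (Vset X Fs {x0}) T coord"
    and B: "B \<in> A" "B \<noteq> 0" and U: "U = {x \<in> X. B x \<noteq> 0}"
    and J: "finite J" "\<forall>j\<in>J. con (a j) (b j) \<and> (\<forall>x\<in>U. b j x \<noteq> 0)"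
    and ind: "alg_independent_on U J (\<lambda>j x. a j x / b j x)"
  shows "card T + card J \<le> zdim X"
proof (rule ccontr)
  assume gt: "\<not> ?thesis"
  have Une: "U \<noteq> {}" using A_nonzero_point[OF B] U by blast
  have UX: "U \<subseteq> X" using U by blast
  define r where "r j x = a j x / b j x" for j x
  let ?Z = "range (\<lambda>i. coord i \<circ> retr U) \<union> (\<lambda>j. (\<lambda>x. a j x / b j x) \<circ> retr U) ` J"
  have aA: "\<forall>j\<in>J. a j \<in> A" and bA: "\<forall>j\<in>J. b j \<in> A \<and> (\<forall>x\<in>U. b j x \<noteq> 0)" using J(2) con_in by blast+
  obtain t where t: "t \<le> zdim X" "growth (alg ?Z) t" using growth_on_open(1)[OF B U J(1) aA bA] by blast
  define w where "w k = (case k of Inl i \<Rightarrow> coord i | Inr j \<Rightarrow> r j)" for k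
  let ?K = "T <+> J"
  have K: "finite ?K" "t < card ?K" using J(1) t(1) gt by (simp_all add: card_Plus)
  have "w k \<circ> retr U \<in> alg ?Z" if "k \<in> ?K" for k
  proof (cases k)
    case (Inl i)
    have "w k = coord i" using Inl by (simp add: w_def)
    then show ?thesis by (simp only:) (intro alg_gen UnI1 rangeI)
  next
    case (Inr j)
    then have j: "j \<in> J" using that by auto
    have "w k \<circ> retr U = (\<lambda>x. a j x / b j x) \<circ> retr U" using Inr by (simp add: w_def r_def fun_eq_iff)
    moreover have "(\<lambda>x. a j x / b j x) \<circ> retr U \<in> ?Z" using j by blast
    ultimately show ?thesis by (simp only: alg_gen)
  qed
  then have "\<not> alg_independent_on UNIV ?K (\<lambda>k. w k \<circ> retr U)"
    using growth_imp_dependent[OF t(2) growth_on_open(2)[OF B U J(1) aA bA] K, of "\<lambda>k. w k \<circ> retr U"] by blast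
  then have "\<not> alg_independent_on U ?K w" using alg_independent_on_pullback[OF range_retr[OF Une], of ?K w] by blast
  moreover have "alg_independent_on U ?K w"
    unfolding alg_independent_on_def
  proof (intro allI impI ballI)
    fix E c e0 assume E: "finite E \<and> E \<subseteq> exps ?K \<and> (\<forall>x\<in>U. (\<Sum>e\<in>E. c e * (\<Prod>k\<in>?K. w k x ^ e k)) = 0)" and e0: "e0 \<in> E"
    define \<alpha> where "\<alpha> e i = e (Inl i)" for e :: "'n + 'j \<Rightarrow> nat" and i
    define \<gamma> where "\<gamma> e j = e (Inr j)" for e :: "'n + 'j \<Rightarrow> nat" and j
    \<comment> \<open>The relation is sorted by its monomials in \<open>T\<close>. The coefficients
      \<open>q d\<close> are fractions annihilated by \<open>Fs\<close>, so they vanish on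
      \<open>U\<close> by \<open>cfrac_relation_vanish\<close>; what remains is a relation among the
      fractions alone.\<close>
    define q where "q d = (\<Sum>e\<in>{e\<in>E. \<alpha> e = d}. (\<lambda>_. c e) * (\<Prod>j\<in>J. r j ^ \<gamma> e j))" for d
    have \<alpha>T: "\<alpha> e \<in> exps T" if "e \<in> E" for e using that E by (auto simp: exps_def \<alpha>_def subset_iff)
    have \<gamma>J: "\<gamma> e \<in> exps J" if "e \<in> E" for e using that E by (auto simp: exps_def \<gamma>_def subset_iff)
    have "cfrac U (r j)" if "j \<in> J" for j using J(2) that by (intro cfracI[of "a j" "b j"]) (auto simp: r_def)
    then have qc: "cfrac U (q d)" for d
      unfolding q_def by (intro cfrac_sum[OF UX] cfrac_mult cfrac_const[OF UX] cfrac_prod[OF UX] cfrac_power[OF UX])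
    have rel: "(\<Sum>d\<in>\<alpha> ` E. q d x * mo d x) = 0" if x: "x \<in> U" for x
    proof -
      have mon: "(\<Prod>k\<in>?K. w k x ^ e k) = mo (\<alpha> e) x * (\<Prod>j\<in>J. r j x ^ \<gamma> e j)" if "e \<in> E" for e
      proof -
        have "(\<Prod>k\<in>?K. w k x ^ e k) = (\<Prod>i\<in>T. coord i x ^ \<alpha> e i) * (\<Prod>j\<in>J. r j x ^ \<gamma> e j)"
          using J(1) by (simp add: prod.Plus w_def \<alpha>_def \<gamma>_def)
        then show ?thesis by (simp add: mo_exps[OF \<alpha>T[OF that]])
      qed
      have "0 = (\<Sum>e\<in>E. c e * (\<Prod>k\<in>?K. w k x ^ e k))" using E x by simp
      also have "\<dots> = (\<Sum>e\<in>E. (c e * (\<Prod>j\<in>J. r j x ^ \<gamma> e j)) * mo (\<alpha> e) x)"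
        by (intro sum.cong refl) (simp add: mon mult_ac)
      also have "\<dots> = (\<Sum>d\<in>\<alpha> ` E. \<Sum>e\<in>{e\<in>E. \<alpha> e = d}. (c e * (\<Prod>j\<in>J. r j x ^ \<gamma> e j)) * mo (\<alpha> e) x)"
        using E by (intro sum.image_gen) blast
      also have "\<dots> = (\<Sum>d\<in>\<alpha> ` E. q d x * mo d x)"
        unfolding q_def sum_fun_apply times_fun_apply prod_fun_apply power_fun_apply sum_distrib_right
        by (intro sum.cong refl) auto
      finally show ?thesis by simp
    qed
    have "q (\<alpha> e0) x = 0" if "x \<in> U" for x
      by (rule cfrac_relation_vanish[OF x0 T B U _ _ qc rel _ that]) (use E e0 \<alpha>T in auto)
    then have q0: "(\<Sum>e\<in>{e\<in>E. \<alpha> e = \<alpha> e0}. c e * (\<Prod>j\<in>J. r j x ^ \<gamma> e j)) = 0" if "x \<in> U" for x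
      using that by (simp add: q_def sum_fun_apply times_fun_apply prod_fun_apply power_fun_apply)
    let ?E = "{e\<in>E. \<alpha> e = \<alpha> e0}"
    have inj: "inj_on \<gamma> ?E"
    proof (rule inj_onI)
      fix e f assume ef: "e \<in> ?E" "f \<in> ?E" "\<gamma> e = \<gamma> f"
      then have "\<alpha> e = \<alpha> f" by simp
      show "e = f"
      proof
        fix k show "e k = f k"
        proof (cases k)
          case (Inl i)
          then show ?thesis using fun_cong[OF \<open>\<alpha> e = \<alpha> f\<close>, of i] by (simp add: \<alpha>_def)
        next
          case (Inr j)
          then show ?thesis using fun_cong[OF ef(3), of j] by (simp add: \<gamma>_def)
        qed
      qed
    qed
    have "(\<Sum>d\<in>\<gamma> ` ?E. c (inv_into ?E \<gamma> d) * (\<Prod>j\<in>J. r j x ^ d j)) = 0" if "x \<in> U" for x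
      using q0[OF that] by (simp add: sum.reindex[OF inj] inv_into_f_f[OF inj])
    moreover have "finite (\<gamma> ` ?E)" "\<gamma> ` ?E \<subseteq> exps J" using E \<gamma>J by auto
    moreover have "\<gamma> e0 \<in> \<gamma> ` ?E" using e0 by simp
    ultimately have "c (inv_into ?E \<gamma> (\<gamma> e0)) = 0"
      using alg_independent_onD[OF ind[folded r_def], of "\<gamma> ` ?E" "\<lambda>d. c (inv_into ?E \<gamma> d)" "\<gamma> e0"] by blast
    then show "c e0 = 0" using inv_into_f_f[OF inj, of e0] e0 by simp
  qed
  ultimately show False by contradiction
qed

end

section \<open>Finitely many first integrals that determine V(F,x)\<close>

lemma polyfun_reindex:
  assumes "p \<in> polyfun"
  shows "(\<lambda>u. p (\<lambda>i. u (h i))) \<in> polyfun"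
  using assms by induction (auto intro: polyfun.intros)

context foliated
begin

definition all_con :: "((('n \<Rightarrow> complex) \<Rightarrow> complex) \<times> (('n \<Rightarrow> complex) \<Rightarrow> complex)) set \<Rightarrow> bool" where
  "all_con Ps \<longleftrightarrow> (\<forall>P\<in>Ps. con (fst P) (snd P))"

definition same_value where
  "same_value P x z \<longleftrightarrow> snd P x \<noteq> 0 \<and> snd P z \<noteq> 0 \<and> fst P x / snd P x = (fst P z / snd P z :: complex)"

text \<open>By Noetherianity of the coordinate ring of the product, finitely many good kernel vectors, read as
  functions of two points \<open>(x, z)\<close>, cut out the common zero set of all of them.\<close>
lemma finitely_many_ratios_separate:
  "\<exists>Ps. finite Ps \<and> all_con Ps \<and> (\<forall>x\<in>X. \<forall>z\<in>X. (\<forall>P\<in>Ps. same_value P x z) \<longrightarrow>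
    (\<forall>E v \<beta>. good E v \<beta> \<longrightarrow> (\<Sum>e\<in>E. v e x * mo e z) = 0))"
proof -
  \<comment> \<open>A polynomial on the product: the \<open>Inl\<close> coordinates carry
    \<open>x\<close>, the \<open>Inr\<close> coordinates carry \<open>z\<close>.\<close>
  define G where "G = (\<lambda>(E, v, \<beta> :: 'n \<Rightarrow> nat). (\<Sum>e\<in>E. (\<lambda>u :: 'n + 'n \<Rightarrow> complex. pext (v e) (\<lambda>i. u (Inl i))) * (\<lambda>u. mo e (\<lambda>i. u (Inr i)))))"
  define \<G> where "\<G> = {(E, v, \<beta>). good E v \<beta>}"
  have good_in: "v e \<in> A" if "good E v \<beta>" "e \<in> E" for E v \<beta> e
    using that kerD unfolding good_def by blast
  have G_apply: "G (E, v, \<beta>) (case_sum x z) = (\<Sum>e\<in>E. v e x * mo e z)" if "good E v \<beta>" "x \<in> X" for E v \<beta> x z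
    unfolding G_def prod.case sum_fun_apply times_fun_apply
    by (intro sum.cong refl) (simp add: pext(2)[OF good_in[OF that(1)] that(2)])
  have "G ` \<G> \<subseteq> polyfun"
  proof
    fix f assume "f \<in> G ` \<G>"
    then obtain E v \<beta> where g: "good E v \<beta>" "f = G (E, v, \<beta>)" unfolding \<G>_def by blast
    show "f \<in> polyfun" unfolding g(2) G_def prod.case
    proof (intro polyfun_sum polyfun_mult)
      fix e assume e: "e \<in> E"
      show "(\<lambda>u :: 'n + 'n \<Rightarrow> complex. pext (v e) (\<lambda>i. u (Inl i))) \<in> polyfun"
        by (rule polyfun_reindex[OF pext(1)[OF good_in[OF g(1) e]]])
      show "(\<lambda>u :: 'n + 'n \<Rightarrow> complex. mo e (\<lambda>i. u (Inr i))) \<in> polyfun"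
        by (rule polyfun_reindex[OF polyfun_mo])
    qed
  qed
  from finite_common_zeros[OF this] obtain Q where Q: "Q \<subseteq> G ` \<G>" "finite Q"
    "\<forall>u. (\<forall>f\<in>Q. f u = 0) \<longrightarrow> (\<forall>f\<in>G ` \<G>. f u = 0)" by (elim exE conjE)
  from finite_subset_image[OF Q(2,1)] obtain \<Q> where \<Q>: "\<Q> \<subseteq> \<G>" "finite \<Q>" "Q = G ` \<Q>" by blast
  define Ps where "Ps = (\<Union>(E, v, \<beta>)\<in>\<Q>. (\<lambda>e. (v e, v \<beta>)) ` E)"
  have "finite Ps" unfolding Ps_def
    using \<Q>(1,2) by (intro finite_UN_I) (auto simp: \<G>_def good_def)
  moreover have "all_con Ps" unfolding all_con_def Ps_def
  proof
    fix P assume "P \<in> (\<Union>(E, v, \<beta>)\<in>\<Q>. (\<lambda>e. (v e, v \<beta>)) ` E)"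
    then obtain E v \<beta> e where q: "(E, v, \<beta>) \<in> \<Q>" "e \<in> E" "P = (v e, v \<beta>)" by auto
    then have "good E v \<beta>" using \<Q>(1) unfolding \<G>_def by blast
    then show "con (fst P) (snd P)" using q unfolding good_def by simp
  qed
  moreover have "(\<Sum>e\<in>E. v e x * mo e z) = 0"
    if x: "x \<in> X" and z: "z \<in> X" and same: "\<forall>P\<in>Ps. same_value P x z" and g: "good E v \<beta>" for x z E v \<beta>
  proof -
    have "f (case_sum x z) = 0" if fQ: "f \<in> Q" for f
    proof -
      obtain E v \<beta> where q: "(E, v, \<beta>) \<in> \<Q>" "f = G (E, v, \<beta>)" using fQ \<Q>(3) by auto
      then have g: "good E v \<beta>" using \<Q>(1) unfolding \<G>_def by blast
      \<comment> \<open>Equal ratios make the vector at \<open>x\<close> proportional to the vector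
        at \<open>z\<close>, and the latter annihilates the monomials at \<open>z\<close> by the row
        of the empty word.\<close>
      have "v e x * mo e z = v \<beta> x / v \<beta> z * (v e z * mo e z)" if e: "e \<in> E" for e
      proof -
        have "(v e, v \<beta>) \<in> Ps" unfolding Ps_def using q(1) e by force
        then have "same_value (v e, v \<beta>) x z" using same by blast
        then have sv: "v \<beta> x \<noteq> 0" "v e x / v \<beta> x = v e z / v \<beta> z" unfolding same_value_def by simp_all
        have "v e x = v e x / v \<beta> x * v \<beta> x" using sv(1) by simp
        then have "v e x = v e z / v \<beta> z * v \<beta> x" unfolding sv(2) .
        then show ?thesis by simp
      qed
      then have "(\<Sum>e\<in>E. v e x * mo e z) = v \<beta> x / v \<beta> z * (\<Sum>e\<in>E. v e z * mo e z)"
        by (simp add: sum_distrib_left)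
      also have "\<dots> = 0" using ker_sum[of E v z] g z unfolding good_def by simp
      finally show ?thesis unfolding q(2) G_apply[OF g x] .
    qed
    then have "\<forall>f\<in>G ` \<G>. f (case_sum x z) = 0" using Q(3) by blast
    moreover have "G (E, v, \<beta>) \<in> G ` \<G>" using g unfolding \<G>_def by blast
    ultimately have "G (E, v, \<beta>) (case_sum x z) = 0" by blast
    then show ?thesis unfolding G_apply[OF g x] .
  qed
  ultimately show ?thesis by (intro exI[of _ Ps]) blast
qed

text \<open>Algebraic independence of the coordinates in \<open>T\<close> over the field of
  fractions annihilated by \<open>Fs\<close>, phrased through kernel vectors;
  \<open>exists_con_kernel_vector\<close> and \<open>con_relation_imp_ker\<close> translate between
  the two.\<close>

definition kernel_free :: "'n set \<Rightarrow> bool" where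
  "kernel_free T \<longleftrightarrow> (\<forall>E v. finite E \<and> E \<subseteq> exps T \<and> ker E v \<longrightarrow> (\<forall>e\<in>E. v e = 0))"

lemma kernel_free_empty: "kernel_free {}"
  unfolding kernel_free_def
proof (intro allI impI ballI)
  fix E v e assume E: "finite E \<and> E \<subseteq> exps {} \<and> ker E v" "e \<in> E"
  have e0: "e = (\<lambda>_. 0)" if "e \<in> exps {}" for e :: "'n \<Rightarrow> nat" using that by (auto simp: exps_def)
  have "E = {e}" using E e0 by blast
  moreover have "mo e = 1" using E e0[of e] by (auto simp: mo_def)
  ultimately have "v e * unit = 0" using ker_word[of E v "[]"] E by simp
  then show "v e = 0" using unit_mult[of "v e"] kerD[of E v e] E by (simp add: mult.commute)
qed

lemma exists_maximal_kernel_free: "\<exists>T. kernel_free T \<and> (\<forall>i. i \<notin> T \<longrightarrow> \<not> kernel_free (insert i T))"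
proof -
  have "\<forall>T. kernel_free T \<longrightarrow> card T < Suc (card (UNIV :: 'n set))" by (simp add: card_mono less_Suc_eq_le)
  from ex_has_greatest_nat[of kernel_free "{}" card, OF kernel_free_empty this]
  obtain T where T: "kernel_free T" "\<forall>S. kernel_free S \<longrightarrow> card S \<le> card T" by auto
  have "\<not> kernel_free (insert i T)" if "i \<notin> T" for i
    using T(2)[rule_format, of "insert i T"] that by auto
  then show ?thesis using T(1) by blast
qed

lemma good_of_not_kernel_free:
  assumes "\<not> kernel_free T"
  shows "\<exists>E v \<beta>. good E v \<beta> \<and> E \<subseteq> exps T"
proof -
  obtain E v \<beta> where E: "finite E" "E \<subseteq> exps T" "ker E v" "\<beta> \<in> E" "v \<beta> \<noteq> 0"
    using assms unfolding kernel_free_def by blast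
  from exists_con_kernel_vector[OF E(1,4,3,5)] show ?thesis using E unfolding good_def by blast
qed

text \<open>Divided by \<open>v \<beta>\<close>, the good vector becomes a polynomial relation for
  coordinate \<open>i\<close> whose coefficients involve only ratios and the coordinates in
  \<open>T\<close>. It is nontrivial because a vanishing coefficient in degree
  \<open>\<beta> i\<close> would contradict \<open>kernel_free T\<close>.\<close>

lemma algebraic_over_first_integrals:
  assumes kf: "kernel_free T" and i: "i \<notin> T" and g: "good E v \<beta>" and E: "E \<subseteq> exps (insert i T)"
    and B: "B \<in> A" "B \<noteq> 0" and U: "U = {x \<in> X. B x \<noteq> 0}" and nz: "\<forall>x\<in>U. v \<beta> x \<noteq> 0"
    and cT: "\<And>j. j \<in> T \<Longrightarrow> coord j \<circ> retr U \<in> alg Z"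
    and rZ: "\<And>e. e \<in> E \<Longrightarrow> (\<lambda>x. v e x / v \<beta> x) \<circ> retr U \<in> alg Z"
  shows "algebraic_over (alg Z) (coord i \<circ> retr U)"
proof -
  have Une: "U \<noteq> {}" using A_nonzero_point[OF B] U by blast
  have g': "finite E" "\<beta> \<in> E" "ker E v" "v \<beta> \<noteq> 0" "\<forall>e\<in>E. con (v e) (v \<beta>)" using g unfolding good_def by blast+
  have finT: "finite T" by (rule finite)
  define z where "z j = coord j \<circ> retr U" for j
  define r where "r e = (\<lambda>x. v e x / v \<beta> x) \<circ> retr U" for e
  define M where "M = Max ((\<lambda>e. e i) ` E)"
  have M: "e i \<le> M" if "e \<in> E" for e using that g'(1) by (simp add: M_def)
  define p where "p l = (\<Sum>e\<in>{e\<in>E. e i = l}. r e * (\<Prod>j\<in>T. z j ^ e j))" for l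
  have "(\<Sum>l\<le>M. p l * z i ^ l) = (\<Sum>e\<in>E. r e * (\<Prod>j\<in>insert i T. z j ^ e j))"
    unfolding p_def by (rule sum_regroup[symmetric]) (use g'(1) finT i M in auto)
  also have "\<dots> = 0"
  proof
    fix y
    define x where "x = retr U y"
    have x: "x \<in> U" "x \<in> X" using retr_in[OF Une, of y] U by (auto simp: x_def)
    have "(\<Sum>e\<in>E. r e * (\<Prod>j\<in>insert i T. z j ^ e j)) y = (\<Sum>e\<in>E. v e x / v \<beta> x * mo e x)"
      unfolding sum_fun_apply times_fun_apply prod_fun_apply power_fun_apply
    proof (intro sum.cong refl)
      fix e assume "e \<in> E"
      then have "e \<in> exps (insert i T)" using E by blast
      then show "r e y * (\<Prod>j\<in>insert i T. z j y ^ e j) = v e x / v \<beta> x * mo e x"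
        using mo_exps[of e "insert i T" x] by (simp only: r_def z_def comp_apply x_def)
    qed
    also have "\<dots> = (\<Sum>e\<in>E. v e x * mo e x) / v \<beta> x" by (simp add: sum_divide_distrib)
    also have "\<dots> = 0" using ker_sum[OF g'(3) x(2)] by simp
    finally show "(\<Sum>e\<in>E. r e * (\<Prod>j\<in>insert i T. z j ^ e j)) y = 0 y" by (simp add: zero_fun_apply)
  qed
  finally have rel: "(\<Sum>l\<le>M. p l * z i ^ l) = 0" .
  have pZ: "p l \<in> alg Z" for l
    unfolding p_def r_def z_def by (intro alg_sum alg_mult alg_prod alg_power rZ cT) auto
  have "p (\<beta> i) \<noteq> 0"
  proof
    assume p0: "p (\<beta> i) = 0"
    let ?E = "{e\<in>E. e i = \<beta> i}"
    \<comment> \<open>Erasing the exponent of \<open>i\<close> on this slice turns the vanishing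
      coefficient into a relation among monomials in \<open>T\<close>, hence into a kernel vector
      that is nonzero at \<open>s \<beta>\<close>.\<close>
    define s where "s e = e(i := 0)" for e :: "'n \<Rightarrow> nat"
    have s_inv: "(s e)(i := \<beta> i) = e" if "e \<in> ?E" for e
      using that by (metis (mono_tags, lifting) fun_upd_triv fun_upd_upd mem_Collect_eq s_def)
    have inj: "inj_on s ?E" by (rule inj_on_inverseI[where g="\<lambda>e. e(i := \<beta> i)"]) (rule s_inv)
    define v' where "v' e = v (e(i := \<beta> i))" for e
    have v's: "v' (s e) = v e" if "e \<in> ?E" for e unfolding v'_def using s_inv[OF that] by simp
    have sT: "s e \<in> exps T" if "e \<in> ?E" for e using that E by (auto simp: s_def exps_def subset_iff)
    have con': "con (v' e) (v \<beta>)" if e: "e \<in> s ` ?E" for e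
    proof -
      obtain e' where e': "e' \<in> ?E" "e = s e'" using e by blast
      have "con (v e') (v \<beta>)" using g'(5) e'(1) by blast
      then show ?thesis using v's[OF e'(1)] e'(2) by simp
    qed
    have "ker (s ` ?E) v'"
    proof (rule con_relation_imp_ker[OF con'])
      show "v \<beta> \<in> A" "v \<beta> \<noteq> 0" using kerD[OF g'(3,2)] g'(4) by auto
      show "(\<Sum>e\<in>s ` ?E. v' e * m e) = 0"
      proof (rule A_zero_on_open[OF _ B])
        show "(\<Sum>e\<in>s ` ?E. v' e * m e) \<in> A" by (intro sum_in mult_in m_in con_in(1)[OF con'])
        fix x assume "x \<in> X" "B x \<noteq> 0"
        then have x: "x \<in> U" "x \<in> X" using U by auto
        have "(\<Sum>e\<in>s ` ?E. v' e * m e) x = (\<Sum>e\<in>?E. v e x * mo (s e) x)"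
          unfolding sum_fun_apply times_fun_apply sum.reindex[OF inj] o_def
          by (intro sum.cong refl) (simp add: v's rst_apply x)
        also have "\<dots> = v \<beta> x * p (\<beta> i) x"
          unfolding p_def sum_fun_apply times_fun_apply prod_fun_apply power_fun_apply sum_distrib_left
        proof (intro sum.cong refl)
          fix e assume e: "e \<in> ?E"
          have "(\<Prod>j\<in>T. z j x ^ e j) = (\<Prod>j\<in>T. coord j x ^ s e j)"
            using i x by (intro prod.cong refl) (auto simp: z_def s_def retr_id)
          also have "\<dots> = mo (s e) x" by (rule mo_exps[OF sT[OF e]])
          finally show "v e x * mo (s e) x = v \<beta> x * (r e x * (\<Prod>j\<in>T. z j x ^ e j))"
            using nz x by (simp add: r_def retr_id)
        qed
        finally show "(\<Sum>e\<in>s ` ?E. v' e * m e) x = 0" using p0 by (simp add: zero_fun_apply)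
      qed
    qed
    moreover have "finite (s ` ?E)" "s ` ?E \<subseteq> exps T" using g'(1) sT by auto
    ultimately have "\<forall>e\<in>s ` ?E. v' e = 0" using kf unfolding kernel_free_def by blast
    then have "v' (s \<beta>) = 0" using g'(2) by blast
    then show False using v's[of \<beta>] g'(2,4) by simp
  qed
  then have "\<exists>l\<le>M. p l \<noteq> 0" using M[OF g'(2)] by blast
  then show ?thesis unfolding algebraic_over_def using pZ rel unfolding z_def by blast
qed

text \<open>A derivative of \<open>a / b = constant\<close> only relates first derivatives; for
  longer words the induction differentiates the previous identity, multiplies by \<open>b\<close>
  and cancels it in the domain.\<close>

lemma con_word:
  assumes con: "con a b" and w: "w \<in> lists Fs"
  shows "apply_word w a * b = a * apply_word w b"
  using w
proof (induction w)
  case (Cons D w)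
  then have D: "D \<in> Fs" and w: "w \<in> lists Fs" by simp_all
  have IH: "apply_word w a * b = a * apply_word w b" by (rule Cons.IH)
  note inA = con_in(1,2)[OF con]
  have wa: "apply_word w a \<in> A" and wb: "apply_word w b \<in> A" using apply_word_in[OF w] inA by auto
  have Dwa: "D (apply_word w a) \<in> A" and Dwb: "D (apply_word w b) \<in> A" by (fact D_in[OF D wa] D_in[OF D wb])+
  have d: "apply_word w a * D b + b * D (apply_word w a) = a * D (apply_word w b) + apply_word w b * D a"
    using arg_cong[OF IH, of D] unfolding D_mult[OF D wa inA(2)] D_mult[OF D inA(1) wb] .
  have "b * (D (apply_word w a) * b - a * D (apply_word w b)) =
    b * (apply_word w a * D b + b * D (apply_word w a)) - b * (a * D (apply_word w b)) - (apply_word w a * b) * D b"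
    by (simp add: algebra_simps)
  also have "\<dots> = apply_word w b * (D a * b) - (apply_word w a * b) * D b" unfolding d by (simp add: algebra_simps)
  also have "\<dots> = 0" unfolding IH con_D[OF con D] by (simp add: algebra_simps)
  finally have "b * (D (apply_word w a) * b - a * D (apply_word w b)) = 0" .
  moreover have "D (apply_word w a) * b - a * D (apply_word w b) \<in> A"
    by (intro diff_in mult_in Dwa Dwb inA)
  ultimately have "D (apply_word w a) * b - a * D (apply_word w b) = 0"
    using A_domain[OF inA(2)] con_in(3)[OF con] by blast
  then show ?case by simp
qed simp

text \<open>The combination of \<open>a\<close> and \<open>b\<close> that vanishes at
  \<open>x\<close> is killed at \<open>x\<close> by every word, thanks to \<open>con_word\<close>,
  and so it lies in I(F,x).\<close>

lemma con_constant_on_Vset: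
  assumes con: "con a b" and x: "x \<in> X" and y: "y \<in> Vset X Fs {x}"
  shows "b x * a y = a x * b y"
proof -
  define g where "g = (\<lambda>_. b x) * a + (\<lambda>_. - a x) * b"
  note inA = con_in(1,2)[OF con]
  have "g \<in> Iw x" unfolding Iw_def
  proof (intro CollectI conjI ballI)
    show "g \<in> A" unfolding g_def by (intro add_in A_scale inA)
    fix w assume w: "w \<in> lists Fs"
    have eq: "apply_word w g = (\<lambda>_. b x) * apply_word w a + (\<lambda>_. - a x) * apply_word w b"
      unfolding g_def apply_word_add[OF w A_scale[OF inA(1)] A_scale[OF inA(2)]]
        apply_word_scale[OF w inA(1)] apply_word_scale[OF w inA(2)] ..
    have "apply_word w g x = b x * apply_word w a x - a x * apply_word w b x"
      unfolding eq plus_fun_apply times_fun_apply by simp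
    then show "apply_word w g x = 0"
      using fun_cong[OF con_word[OF con w], of x] by (simp add: times_fun_apply mult.commute)
  qed
  then have "g y = 0" using y unfolding Vset_def inv_ideal_eq_Iw by blast
  then show ?thesis unfolding g_def plus_fun_apply times_fun_apply by simp
qed

lemma point_in_Vset: "x \<in> X \<Longrightarrow> x \<in> Vset X Fs {x}"
  unfolding Vset_def inv_ideal_eq_Iw using Iw_vanish by blast

lemma KF_imp_con: "r \<in> KF X Fs \<Longrightarrow> con (fst r) (snd r)"
proof (induction rule: KF.induct)
  case (KF_const c)
  have "(\<lambda>x. if x \<in> X then c else 0) = (\<lambda>_. c) * unit" "(\<lambda>x. if x \<in> X then 1 else 0) = unit"
    by (auto simp: fun_eq_iff rst_def fun_apply)
  then show ?case using con_const[of c] by simp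
next
  case (KF_fi r)
  then have r: "fst r \<in> A" "snd r \<in> A" "\<exists>x\<in>X. snd r x \<noteq> 0"
    and d: "\<forall>D\<in>Fs. \<forall>x\<in>X. D (fst r) x * snd r x - fst r x * D (snd r) x = 0"
    unfolding first_integral_def ratfun_def by blast+
  show ?case unfolding con_def
  proof (intro conjI ballI r)
    show "snd r \<noteq> 0" using r(3) by (auto simp: zero_fun_apply)
    fix D assume D: "D \<in> Fs"
    show "D (fst r) * snd r = fst r * D (snd r)"
      by (rule A_eqI[OF mult_in[OF D_in[OF D r(1)] r(2)] mult_in[OF r(1) D_in[OF D r(2)]]])
        (use bspec[OF d D] in \<open>simp add: times_fun_apply\<close>)
  qed
next
  case (KF_add a1 b1 a2 b2)
  then show ?case using con_add[of a1 b1 a2 b2] by (simp add: plus_fun_def times_fun_def)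
next
  case (KF_mult a1 b1 a2 b2)
  then show ?case using con_mult[of a1 b1 a2 b2] by (simp add: times_fun_def)
next
  case (KF_neg a b)
  then show ?case using con_uminus[of a b] by (simp add: fun_Compl_def)
next
  case (KF_inv a b)
  then have "a \<noteq> 0" by (auto simp: zero_fun_apply)
  then show ?case using con_inverse[of a b] KF_inv.IH by simp
qed

lemma con_imp_KF:
  assumes con: "con a b" and nc: "\<not> (\<exists>c. \<forall>x\<in>X. a x = c * b x)"
  shows "(a, b) \<in> KF X Fs"
proof (rule KF_fi)
  have "D a x * b x - a x * D b x = 0" if "D \<in> Fs" for D x
    using fun_cong[OF con_D[OF con that], of x] by (simp add: times_fun_apply)
  then show "first_integral X Fs (a, b)"
    unfolding first_integral_def ratfun_def
    using con_in[OF con] nc A_nonzero_point[of b] by simp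
qed

end

section \<open>Independent rational functions and images of rational maps\<close>

lemma alg_indep_iff:
  "alg_indep X d g \<longleftrightarrow> (\<forall>i<d. ratfun X (g i)) \<and>
    alg_independent_on {x \<in> X. \<forall>i<d. snd (g i) x \<noteq> 0} {..<d} (\<lambda>i x. fst (g i) x / snd (g i) x)"
proof -
  let ?U = "{x \<in> X. \<forall>i<d. snd (g i) x \<noteq> 0}"
  let ?f = "\<lambda>i x. fst (g i) x / snd (g i) x"
  have "(\<forall>c. mpoly d c \<and> (\<exists>e. c e \<noteq> 0) \<longrightarrow>
      (\<exists>x\<in>X. (\<forall>i<d. snd (g i) x \<noteq> 0) \<and> mpoly_eval c d (\<lambda>i. ?f i x) \<noteq> 0)) \<longleftrightarrow>
    alg_independent_on ?U {..<d} ?f" (is "?L \<longleftrightarrow> ?R")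
  proof
    assume L: ?L
    show ?R unfolding alg_independent_on_def
    proof (intro allI impI ballI, rule ccontr)
      fix E c e assume E: "finite E \<and> E \<subseteq> exps {..<d} \<and> (\<forall>x\<in>?U. (\<Sum>e\<in>E. c e * (\<Prod>i\<in>{..<d}. ?f i x ^ e i)) = 0)"
        and e: "e \<in> E" "c e \<noteq> 0"
      \<comment> \<open>\<open>mpoly\<close> speaks of a coefficient function of finite support, so
        \<open>c\<close> is set to zero outside \<open>E\<close>.\<close>
      define c' where "c' e = (if e \<in> E then c e else 0)" for e
      have sub: "{e. c' e \<noteq> 0} \<subseteq> E" by (auto simp: c'_def)
      have "mpoly d c'"
        unfolding mpoly_def using finite_subset[OF sub] E sub by (auto simp: exps_def subset_iff)
      moreover have "c' e \<noteq> 0" using e by (simp add: c'_def)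
      ultimately obtain x where x: "x \<in> X" "\<forall>i<d. snd (g i) x \<noteq> 0" "mpoly_eval c' d (\<lambda>i. ?f i x) \<noteq> 0"
        using L by blast
      have "mpoly_eval c' d (\<lambda>i. ?f i x) = (\<Sum>e\<in>E. c e * (\<Prod>i\<in>{..<d}. ?f i x ^ e i))"
        unfolding mpoly_eval_def using E sub
        by (intro sum.mono_neutral_cong_left) (auto simp: c'_def)
      then show False using E x by simp
    qed
  next
    assume R: ?R
    show ?L
    proof (intro allI impI, rule ccontr)
      fix c assume c: "mpoly d c \<and> (\<exists>e. c e \<noteq> 0)"
        and no: "\<not> (\<exists>x\<in>X. (\<forall>i<d. snd (g i) x \<noteq> 0) \<and> mpoly_eval c d (\<lambda>i. ?f i x) \<noteq> 0)"
      have "finite {e. c e \<noteq> 0}" "{e. c e \<noteq> 0} \<subseteq> exps {..<d}" using c by (auto simp: mpoly_def exps_def)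
      moreover have "(\<Sum>e\<in>{e. c e \<noteq> 0}. c e * (\<Prod>i\<in>{..<d}. ?f i x ^ e i)) = 0" if "x \<in> ?U" for x
        using no that unfolding mpoly_eval_def by auto
      ultimately have "\<forall>e\<in>{e. c e \<noteq> 0}. c e = 0" using R unfolding alg_independent_on_def by blast
      then show False using c by blast
    qed
  qed
  then show ?thesis unfolding alg_indep_def by blast
qed

lemma alg_independent_nonconstant:
  assumes ind: "alg_independent_on V T z" and T: "finite T" "i \<in> T"
  shows "\<not> (\<forall>x\<in>V. z i x = c)"
proof
  assume zc: "\<forall>x\<in>V. z i x = c"
  have ind1: "alg_independent_on V {i} z" by (rule alg_independent_on_subset[OF ind]) (use T in auto)
  define e1 where "e1 k = (if k = i then 1 else 0 :: nat)" for k
  have ne: "e1 \<noteq> (\<lambda>_. 0)" unfolding e1_def by (metis one_neq_zero)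
  define cf where "cf e = (if e = e1 then 1 else - c)" for e
  have "cf e1 = 0"
  proof (rule alg_independent_onD[OF ind1, of "{e1, \<lambda>_. 0}"])
    show "{e1, \<lambda>_. 0} \<subseteq> exps {i}" by (auto simp: exps_def e1_def)
    fix x assume "x \<in> V"
    then show "(\<Sum>e\<in>{e1, \<lambda>_. 0}. cf e * (\<Prod>j\<in>{i}. z j x ^ e j)) = 0"
      using ne zc by (simp add: cf_def) (simp add: e1_def)
  qed auto
  then show False by (simp add: cf_def)
qed

lemma very_generic_cong:
  assumes "\<And>x. x \<in> X \<Longrightarrow> P x \<longleftrightarrow> Q x"
  shows "very_generic X P \<longleftrightarrow> very_generic X Q"
  using assms unfolding very_generic_def by simp

text \<open>Moves polynomial conditions on the image of the rational map back to polynomial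
  conditions on its source.\<close>

lemma clear_denominators:
  assumes a: "\<forall>i<M. a i \<in> polyfun" and b: "b \<in> polyfun" and q: "q \<in> polyfun"
  shows "\<exists>k. \<exists>p\<in>polyfun. \<forall>x. b x \<noteq> 0 \<longrightarrow>
    q (\<lambda>i. if i < M then a i x / b x else (0 :: complex)) * b x ^ k = p x"
  using q
proof induction
  case (pf_const c)
  show ?case by (rule exI[of _ 0], rule bexI[of _ "\<lambda>_. c"]) (auto intro: polyfun.intros)
next
  case (pf_coord i)
  show ?case
  proof (cases "i < M")
    case True
    then show ?thesis using a by (intro exI[of _ 1] bexI[of _ "a i"]) auto
  next
    case False
    then show ?thesis by (intro exI[of _ 0] bexI[of _ "\<lambda>_. 0"]) (auto intro: polyfun.intros)
  qed
next
  case (pf_add f g)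
  then obtain k p l r where p: "p \<in> polyfun" "r \<in> polyfun"
    and eq: "\<forall>x. b x \<noteq> 0 \<longrightarrow> f (\<lambda>i. if i < M then a i x / b x else 0) * b x ^ k = p x"
      "\<forall>x. b x \<noteq> 0 \<longrightarrow> g (\<lambda>i. if i < M then a i x / b x else 0) * b x ^ l = r x"
    by blast
  have "p * b ^ l + r * b ^ k \<in> polyfun" using p b by (intro polyfun_closed)
  moreover have "\<forall>x. b x \<noteq> 0 \<longrightarrow> (f (\<lambda>i. if i < M then a i x / b x else 0) +
      g (\<lambda>i. if i < M then a i x / b x else 0)) * b x ^ (k + l) = (p * b ^ l + r * b ^ k) x"
  proof (intro allI impI)
    fix x assume "b x \<noteq> 0"
    then show "(f (\<lambda>i. if i < M then a i x / b x else 0) +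
      g (\<lambda>i. if i < M then a i x / b x else 0)) * b x ^ (k + l) = (p * b ^ l + r * b ^ k) x"
      using eq[rule_format, of x, symmetric]
      by (simp add: plus_fun_apply times_fun_apply power_fun_apply algebra_simps power_add)
  qed
  ultimately show ?case by blast
next
  case (pf_mult f g)
  then obtain k p l r where p: "p \<in> polyfun" "r \<in> polyfun"
    and eq: "\<forall>x. b x \<noteq> 0 \<longrightarrow> f (\<lambda>i. if i < M then a i x / b x else 0) * b x ^ k = p x"
      "\<forall>x. b x \<noteq> 0 \<longrightarrow> g (\<lambda>i. if i < M then a i x / b x else 0) * b x ^ l = r x"
    by blast
  have "p * r \<in> polyfun" using p by (intro polyfun_closed)
  moreover have "\<forall>x. b x \<noteq> 0 \<longrightarrow> (f (\<lambda>i. if i < M then a i x / b x else 0) *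
      g (\<lambda>i. if i < M then a i x / b x else 0)) * b x ^ (k + l) = (p * r) x"
  proof (intro allI impI)
    fix x assume "b x \<noteq> 0"
    then show "(f (\<lambda>i. if i < M then a i x / b x else 0) *
      g (\<lambda>i. if i < M then a i x / b x else 0)) * b x ^ (k + l) = (p * r) x"
      using eq[rule_format, of x, symmetric] by (simp add: times_fun_apply algebra_simps power_add)
  qed
  ultimately show ?case by blast
qed

text \<open>A polynomial vanishes on the closure as soon as it vanishes on the image; so the
  dimension of the target can be read off from the components of the map.\<close>

lemma alg_independent_zclosure_image:
  assumes "finite T"
  shows "alg_independent_on (zclosure (F ` U)) T coord \<longleftrightarrow> alg_independent_on U T (\<lambda>j x. F x j)"
proof -
  have "(\<forall>y\<in>zclosure (F ` U). (\<Sum>e\<in>E. c e * (\<Prod>i\<in>T. coord i y ^ e i)) = 0) \<longleftrightarrow>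
    (\<forall>x\<in>U. (\<Sum>e\<in>E. c e * (\<Prod>i\<in>T. F x i ^ e i)) = 0)" (is "?L \<longleftrightarrow> ?R") for E c
  proof
    assume ?L
    then show ?R using zclosure_superset[of "F ` U"] by (auto simp: coord_def subset_iff)
  next
    assume R: ?R
    define q where "q = (\<Sum>e\<in>E. (\<lambda>_. c e) * (\<Prod>i\<in>T. coord i ^ e i))"
    have qe: "q y = (\<Sum>e\<in>E. c e * (\<Prod>i\<in>T. coord i y ^ e i))" for y
      unfolding q_def sum_fun_apply times_fun_apply prod_fun_apply power_fun_apply ..
    have q: "q \<in> polyfun" unfolding q_def
      by (intro polyfun_sum polyfun_mult polyfun_prod polyfun_power polyfun_const polyfun_coord)
    have "q y = 0" if y: "y \<in> zclosure (F ` U)" for y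
      by (rule zclosure_vanish[OF q _ y]) (use R in \<open>auto simp: qe coord_def\<close>)
    then show ?L unfolding qe by blast
  qed
  then show ?thesis unfolding alg_independent_on_def by simp
qed

text \<open>A product vanishing on the image is pulled back to \<open>X\<close>, with denominators
  cleared and an extra factor \<open>b\<close> to cover the points outside \<open>U\<close>;
  irreducibility of \<open>X\<close> decides which factor vanishes.\<close>

lemma zirred_image_closure:
  assumes X: "zirred X" and a: "\<forall>i<M. a i \<in> polyfun" and b: "b \<in> polyfun" "\<exists>x\<in>X. b x \<noteq> 0"
    and F: "F = (\<lambda>x i. if i < M then a i x / b x else (0 :: complex))" and U: "U = {x \<in> X. b x \<noteq> 0}"
  shows "zirred (zclosure (F ` U))"
proof (rule zirredI)
  show "zclosure (F ` U) \<noteq> {}" using b(2) U zclosure_superset[of "F ` U"] by blast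
  show "zclosed (zclosure (F ` U))" by (rule zclosed_zclosure)
  fix f g assume f: "f \<in> polyfun" and g: "g \<in> polyfun"
    and fg: "\<And>y. y \<in> zclosure (F ` U) \<Longrightarrow> f y * g y = 0"
  from clear_denominators[OF a b(1) f] obtain k p where p: "p \<in> polyfun"
    "\<forall>x. b x \<noteq> 0 \<longrightarrow> f (F x) * b x ^ k = p x" unfolding F by blast
  from clear_denominators[OF a b(1) g] obtain l r where r: "r \<in> polyfun"
    "\<forall>x. b x \<noteq> 0 \<longrightarrow> g (F x) * b x ^ l = r x" unfolding F by blast
  have "(p * b) x * (r * b) x = 0" if x: "x \<in> X" for x
  proof (cases "b x = 0")
    case False
    then have "F x \<in> zclosure (F ` U)" using x U zclosure_superset[of "F ` U"] by blast
    then have "f (F x) * g (F x) = 0" by (rule fg)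
    then show ?thesis using p(2)[rule_format, OF False, symmetric] r(2)[rule_format, OF False, symmetric]
      by (auto simp: times_fun_apply)
  qed (simp add: times_fun_apply)
  with zirred_no_zero_divisors[OF X polyfun_mult[OF p(1) b(1)] polyfun_mult[OF r(1) b(1)]]
  have "(\<forall>x\<in>X. (p * b) x = 0) \<or> (\<forall>x\<in>X. (r * b) x = 0)" by blast
  then show "(\<forall>y\<in>zclosure (F ` U). f y = 0) \<or> (\<forall>y\<in>zclosure (F ` U). g y = 0)"
  proof
    assume 0: "\<forall>x\<in>X. (p * b) x = 0"
    have "f (F x) = 0" if "x \<in> U" for x
    proof -
      have bx: "b x \<noteq> 0" and "(p * b) x = 0" using that U 0 by auto
      then show ?thesis using p(2)[rule_format, OF bx] by (simp add: times_fun_apply)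
    qed
    then have "f v = 0" if "v \<in> F ` U" for v using that by blast
    from zclosure_vanish[OF f this] show ?thesis by blast
  next
    assume 0: "\<forall>x\<in>X. (r * b) x = 0"
    have "g (F x) = 0" if "x \<in> U" for x
    proof -
      have bx: "b x \<noteq> 0" and "(r * b) x = 0" using that U 0 by auto
      then show ?thesis using r(2)[rule_format, OF bx] by (simp add: times_fun_apply)
    qed
    then have "g v = 0" if "v \<in> F ` U" for v using that by blast
    from zclosure_vanish[OF g this] show ?thesis by blast
  qed
qed

section \<open>Construction of the rational map\<close>

context foliated
begin

lemma alg_independent_coord_open:
  assumes ind: "alg_independent_on X T coord" and B: "B \<in> A" "B \<noteq> 0"
  shows "alg_independent_on {x \<in> X. B x \<noteq> 0} T coord"
  unfolding alg_independent_mo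
proof (intro allI impI)
  fix E c assume E: "finite E \<and> E \<subseteq> exps T \<and> (\<forall>x\<in>{x \<in> X. B x \<noteq> 0}. (\<Sum>e\<in>E. c e * mo e x) = 0)"
  have "(\<Sum>e\<in>E. (\<lambda>_. c e) * mo e) x * pext B x = 0" if x: "x \<in> X" for x
    unfolding lincomb_mo_apply pext(2)[OF B(1) x] using E x by auto
  with zirred_no_zero_divisors[OF irr polyfun_lincomb pext(1)[OF B(1)]]
  have "(\<forall>x\<in>X. (\<Sum>e\<in>E. (\<lambda>_. c e) * mo e) x = 0) \<or> (\<forall>x\<in>X. pext B x = 0)" by blast
  then have "\<forall>x\<in>X. (\<Sum>e\<in>E. c e * mo e x) = 0"
    using A_nonzero_point[OF B] pext(2)[OF B(1)] unfolding lincomb_mo_apply by auto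
  then show "\<forall>e\<in>E. c e = 0" using ind E unfolding alg_independent_mo by blast
qed

text \<open>Two finite families of ratios are merged over one denominator: \<open>Ps1\<close>
  separates points as required, and \<open>Ps2\<close> makes the coordinates outside a maximal
  kernel-free \<open>T\<close> algebraic over the ratios and \<open>T\<close>. The second family
  forces at least \<open>zdim X - p\<close> independent ratios.\<close>

lemma exists_separating_first_integrals:
  assumes p: "\<forall>x\<in>X. zdim (Vset X Fs {x}) \<le> p"
  shows "\<exists>M B a. B \<in> A \<and> B \<noteq> 0 \<and> (\<forall>j<M. con (a j) B) \<and>
    (\<forall>x\<in>X. \<forall>z\<in>X. B x \<noteq> 0 \<longrightarrow> B z \<noteq> 0 \<longrightarrow> (\<forall>j<M. a j x / B x = a j z / B z) \<longrightarrow>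
      (\<forall>E v \<beta>. good E v \<beta> \<longrightarrow> (\<Sum>e\<in>E. v e x * mo e z) = 0)) \<and>
    (\<exists>J\<subseteq>{..<M :: nat}. alg_independent_on {x \<in> X. B x \<noteq> 0} J (\<lambda>j x. a j x / B x) \<and> zdim X \<le> card J + p)"
proof -
  from finitely_many_ratios_separate obtain Ps1 where Ps1: "finite Ps1" "all_con Ps1"
    "\<forall>x\<in>X. \<forall>z\<in>X. (\<forall>P\<in>Ps1. same_value P x z) \<longrightarrow>
      (\<forall>E v \<beta>. good E v \<beta> \<longrightarrow> (\<Sum>e\<in>E. v e x * mo e z) = 0)" by blast
  from exists_maximal_kernel_free obtain T where kf: "kernel_free T"
    and mx: "\<forall>i. i \<notin> T \<longrightarrow> \<not> kernel_free (insert i T)" by blast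
  have cardT: "card T \<le> p"
  proof (rule ccontr)
    assume "\<not> card T \<le> p"
    then have "\<forall>x\<in>X. zdim (Vset X Fs {x}) < card T" using p by fastforce
    from exists_kernel_vector[OF this] show False using kf unfolding kernel_free_def by blast
  qed
  define Q where "Q i t = (good (fst t) (fst (snd t)) (snd (snd t)) \<and> fst t \<subseteq> exps (insert i T))" for i t
  have "\<exists>t. Q i t" if "i \<notin> T" for i
  proof -
    from good_of_not_kernel_free[OF mx[rule_format, OF that]]
    obtain E v \<beta> where "good E v \<beta>" "E \<subseteq> exps (insert i T)" by blast
    then have "Q i (E, v, \<beta>)" by (simp add: Q_def)
    then show ?thesis ..
  qed
  then obtain t where t: "\<And>i. i \<notin> T \<Longrightarrow> Q i (t i)" by metis
  define E v \<beta> where "E i = fst (t i)" and "v i = fst (snd (t i))" and "\<beta> i = snd (snd (t i))" for i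
  have good: "good (E i) (v i) (\<beta> i)" and Ee: "E i \<subseteq> exps (insert i T)" if "i \<notin> T" for i
    using t[OF that] unfolding Q_def E_def v_def \<beta>_def by blast+
  define Ps2 where "Ps2 = (\<Union>i\<in>-T. (\<lambda>e. (v i e, v i (\<beta> i))) ` E i)"
  have "finite Ps2" unfolding Ps2_def
  proof (intro finite_UN_I finite_imageI)
    show "finite (E i)" if "i \<in> - T" for i using good[of i] that unfolding good_def by blast
  qed simp
  have con2: "con (v i e) (v i (\<beta> i))" if "i \<notin> T" "e \<in> E i" for i e
    using good[OF that(1)] that(2) unfolding good_def by blast
  from finite_list[OF finite_UnI[OF Ps1(1) \<open>finite Ps2\<close>]] obtain ps where ps: "set ps = Ps1 \<union> Ps2" by blast
  define M where "M = length ps"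
  have "con (fst P) (snd P)" if "P \<in> set ps" for P
  proof (cases "P \<in> Ps1")
    case True
    then show ?thesis using Ps1(2) unfolding all_con_def by blast
  next
    case False
    then have "P \<in> Ps2" using that ps by blast
    then obtain i where i: "i \<in> - T" "P \<in> (\<lambda>e. (v i e, v i (\<beta> i))) ` E i" unfolding Ps2_def by (rule UN_E)
    from i(2) obtain e where P: "P = (v i e, v i (\<beta> i))" "e \<in> E i" by (rule imageE)
    have "i \<notin> T" using i(1) by simp
    from con2[OF this P(2)] show ?thesis unfolding P(1) fst_conv snd_conv .
  qed
  then have "\<forall>j\<in>{..<M}. con (fst (ps ! j)) (snd (ps ! j))" unfolding M_def by simp
  from con_common_denominator[OF finite_lessThan this] obtain B a where B: "B \<in> A" "B \<noteq> 0"
    and Bz: "\<forall>x\<in>X. B x \<noteq> 0 \<longleftrightarrow> (\<forall>j\<in>{..<M}. snd (ps ! j) x \<noteq> 0)"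
    and a: "\<forall>j\<in>{..<M}. con (a j) B \<and> a j * snd (ps ! j) = fst (ps ! j) * B" by blast
  define U where "U = {x \<in> X. B x \<noteq> 0}"
  have UX: "U \<subseteq> X" and Une: "U \<noteq> {}" using A_nonzero_point[OF B] unfolding U_def by blast+
  have val: "\<exists>j<M. \<forall>x\<in>U. snd P x \<noteq> 0 \<and> fst P x / snd P x = a j x / B x" if P: "P \<in> set ps" for P
  proof -
    obtain j where j: "j < M" "P = ps ! j" using P unfolding M_def in_set_conv_nth by blast
    have "snd P x \<noteq> 0 \<and> fst P x / snd P x = a j x / B x" if x: "x \<in> U" for x
    proof -
      have "B x \<noteq> 0" "snd P x \<noteq> 0" using x Bz j unfolding U_def by auto
      moreover have "a j * snd P = fst P * B" unfolding j(2) using bspec[OF a, of j] j(1) by simp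
      from fun_cong[OF this, of x] have "a j x * snd P x = fst P x * B x" unfolding times_fun_apply .
      ultimately show ?thesis by (simp add: field_simps)
    qed
    then show ?thesis using j(1) by blast
  qed
  have sep: "\<forall>E v \<beta>. good E v \<beta> \<longrightarrow> (\<Sum>e\<in>E. v e x * mo e z) = 0"
    if xz: "x \<in> X" "z \<in> X" "B x \<noteq> 0" "B z \<noteq> 0" "\<forall>j<M. a j x / B x = a j z / B z" for x z
  proof -
    have xU: "x \<in> U" "z \<in> U" using xz unfolding U_def by auto
    have "same_value P x z" if "P \<in> Ps1" for P
    proof -
      from val[of P] that ps obtain j where "j < M"
        "\<forall>x\<in>U. snd P x \<noteq> 0 \<and> fst P x / snd P x = a j x / B x" by blast
      then show ?thesis using xU xz(5) unfolding same_value_def by simp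
    qed
    then show ?thesis using Ps1(3) xz(1,2) by blast
  qed
  define zf where "zf j = (\<lambda>x. a j x / B x) \<circ> retr U" for j
  define c where "c i = coord i \<circ> retr U" for i :: 'n
  have aA: "\<forall>j\<in>{..<M}. a j \<in> A" using a con_in(1) by blast
  have bA: "\<forall>j\<in>{..<M}. B \<in> A \<and> (\<forall>x\<in>U. B x \<noteq> 0)" using B U_def by blast
  have dom: "no_zero_divisors (alg (range c \<union> zf ` {..<M}))"
    using growth_on_open(2)[OF B U_def finite_lessThan aA bA] unfolding c_def zf_def .
  have "no_zero_divisors (alg (zf ` {..<M}))"
    by (rule no_zero_divisors_subset[OF dom alg_mono]) blast
  from growth_basis[OF finite_lessThan this] obtain J where J: "J \<subseteq> {..<M}" "alg_independent_on UNIV J zf"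
    and gJ: "growth (alg (zf ` {..<M})) (card J)" by blast
  \<comment> \<open>Over the ratios, the coordinates in \<open>T\<close> raise the growth exponent
    by at most \<open>card T\<close>, and the remaining coordinates, being algebraic, by nothing. As
    \<open>zdim X\<close> coordinates are independent on \<open>U\<close>, the total
    \<open>card J + card T\<close> is at least \<open>zdim X\<close>.\<close>
  define Z where "Z = zf ` {..<M} \<union> c ` T"
  have gZ: "growth (alg Z) (card J + card T)" unfolding Z_def by (rule growth_adjoin_set[OF finite gJ])
  have dom': "no_zero_divisors (alg (Z \<union> c ` (-T)))"
    by (rule no_zero_divisors_subset[OF dom alg_mono]) (auto simp: Z_def)
  have algZ: "algebraic_over (alg Z) (c i)" if i: "i \<notin> T" for i
    unfolding c_def
  proof (rule algebraic_over_first_integrals[OF kf i good[OF i] Ee[OF i] B U_def])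
    have g: "\<beta> i \<in> E i" using good[OF i] unfolding good_def by blast
    have inps: "(v i e, v i (\<beta> i)) \<in> set ps" if e: "e \<in> E i" for e
    proof -
      have "(v i e, v i (\<beta> i)) \<in> Ps2" unfolding Ps2_def
      proof (rule UN_I[of i])
        show "i \<in> - T" using i by simp
        show "(v i e, v i (\<beta> i)) \<in> (\<lambda>e. (v i e, v i (\<beta> i))) ` E i" by (rule image_eqI[OF _ e]) (rule refl)
      qed
      then show ?thesis unfolding ps by (rule UnI2)
    qed
    show "\<forall>x\<in>U. v i (\<beta> i) x \<noteq> 0" using val[OF inps[OF g]] unfolding snd_conv by blast
    show "coord j \<circ> retr U \<in> alg Z" if "j \<in> T" for j
      using that by (intro alg_gen) (auto simp: Z_def c_def)
    show "(\<lambda>x. v i e x / v i (\<beta> i) x) \<circ> retr U \<in> alg Z" if "e \<in> E i" for e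
    proof -
      from val[OF inps[OF that]] obtain j where j: "j < M" "\<forall>x\<in>U. v i e x / v i (\<beta> i) x = a j x / B x"
        unfolding fst_conv snd_conv by blast
      have "(\<lambda>x. v i e x / v i (\<beta> i) x) \<circ> retr U = zf j"
        unfolding zf_def using j(2) retr_in[OF Une] by (auto simp: fun_eq_iff)
      then show ?thesis using j(1) by (simp add: alg_gen Z_def)
    qed
  qed
  have gfull: "growth (alg (Z \<union> c ` (-T))) (card J + card T)"
    by (rule growth_adjoin_algebraic_set[OF _ gZ dom']) (use algZ in auto)
  from zdim_eq_independent(1)[OF irr, of UNIV] obtain T0 where T0: "alg_independent_on X T0 coord" "card T0 = zdim X"
    by auto
  have "alg_independent_on U T0 coord"
    unfolding U_def by (rule alg_independent_coord_open[OF T0(1) B])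
  then have ind0: "alg_independent_on UNIV T0 c"
    using alg_independent_on_pullback[OF range_retr[OF Une], of T0 coord] unfolding c_def by blast
  have "c i \<in> alg (Z \<union> c ` (-T))" for i by (rule alg_gen) (auto simp: Z_def)
  then have "\<not> card J + card T < card T0"
    using growth_imp_dependent[OF gfull dom' finite, of T0 c] ind0 by blast
  then have le: "zdim X \<le> card J + p" using cardT T0(2) by simp
  have indJ: "alg_independent_on {x \<in> X. B x \<noteq> 0} J (\<lambda>j x. a j x / B x)"
    using alg_independent_on_pullback[OF range_retr[OF Une], of J "\<lambda>j x. a j x / B x"] J(2)
    unfolding zf_def U_def by blast
  show ?thesis
  proof (intro exI[of _ M] exI[of _ B] exI[of _ a] exI[of _ J] conjI B J(1) indJ le)
    show "\<forall>j<M. con (a j) B" using a by blast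
  qed (intro ballI impI sep)
qed

text \<open>A fibre point \<open>z\<close> satisfies all good relations of \<open>x\<close>, so at
  generic \<open>x\<close> it satisfies every relation valid on V(F,x). Conversely the map is
  constant on V(F,x) wherever \<open>B\<close> is nonzero, and that part is dense.\<close>

lemma very_generic_fiber:
  assumes B: "B \<in> A" "B \<noteq> 0" and con: "\<forall>j<M. con (a j) B"
    and sep: "\<forall>x\<in>X. \<forall>z\<in>X. B x \<noteq> 0 \<longrightarrow> B z \<noteq> 0 \<longrightarrow> (\<forall>j<M. a j x / B x = a j z / B z) \<longrightarrow>
      (\<forall>E v \<beta>. good E v \<beta> \<longrightarrow> (\<Sum>e\<in>E. v e x * mo e z) = 0)"
  shows "very_generic X (\<lambda>x. B x \<noteq> 0 \<and>
    zclosure {z \<in> X. B z \<noteq> 0 \<and> (\<forall>j<M. a j x / B x = a j z / B z)} = Vset X Fs {x})"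
proof -
  define Q where "Q E \<delta> = (\<delta> \<in> A \<and> \<delta> \<noteq> 0 \<and> (\<forall>x f z. \<delta> x \<noteq> 0 \<longrightarrow> kernel_at E f x \<longrightarrow>
    (\<forall>E' v \<beta>. good E' v \<beta> \<longrightarrow> (\<Sum>e\<in>E'. v e x * mo e z) = 0) \<longrightarrow> (\<Sum>e\<in>E. f e * mo e z) = 0))" for E \<delta>
  have "\<exists>\<delta>. Q E \<delta>" if "finite E" for E using generic_kernel[OF that] unfolding Q_def Bex_def .
  then obtain \<delta> where \<delta>Q: "\<And>E. finite E \<Longrightarrow> Q E (\<delta> E)" by metis
  have \<delta>1: "\<delta> E \<in> A" if "finite E" for E using \<delta>Q[OF that] unfolding Q_def by (elim conjE) assumption
  have \<delta>2: "\<delta> E \<noteq> 0" if "finite E" for E using \<delta>Q[OF that] unfolding Q_def by (elim conjE) assumption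
  note \<delta>A = \<delta>1 \<delta>2
  have \<delta>: "(\<Sum>e\<in>E. f e * mo e z) = 0"
    if fin: "finite E" and E: "\<delta> E x \<noteq> 0" "kernel_at E f x"
      "\<forall>E' v \<beta>. good E' v \<beta> \<longrightarrow> (\<Sum>e\<in>E'. v e x * mo e z) = 0" for E x f z
  proof -
    have q: "\<forall>x f z. \<delta> E x \<noteq> 0 \<longrightarrow> kernel_at E f x \<longrightarrow>
      (\<forall>E' v \<beta>. good E' v \<beta> \<longrightarrow> (\<Sum>e\<in>E'. v e x * mo e z) = 0) \<longrightarrow> (\<Sum>e\<in>E. f e * mo e z) = 0"
      using \<delta>Q[OF fin] unfolding Q_def by (elim conjE) assumption
    from mp[OF mp[OF mp[OF spec[OF spec[OF spec[OF q, of x], of f], of z] E(1)] E(2)] E(3)] show ?thesis .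
  qed
  \<comment> \<open>One condition for each finite set of exponent vectors, hence countably many,
    plus the denominator.\<close>
  define H where "H = insert (pext B) ((\<lambda>E. pext (\<delta> E)) ` {E. finite E})"
  show ?thesis
  proof (rule very_genericI[of H])
    show "countable H" unfolding H_def by (intro countable_insert countable_image countable_Collect_finite)
    show "H \<noteq> {}" by (simp add: H_def)
    have nz: "pext f \<in> polyfun \<and> (\<exists>x\<in>X. pext f x \<noteq> 0)" if "f \<in> A" "f \<noteq> 0" for f
      using A_nonzero_point[OF that] pext[OF that(1)] by auto
    show "h \<in> polyfun \<and> (\<exists>x\<in>X. h x \<noteq> 0)" if "h \<in> H" for h
      using that nz[OF B] nz[OF \<delta>A] unfolding H_def by fast
    fix x assume x: "x \<in> X" and Hx: "\<forall>h\<in>H. h x \<noteq> 0"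
    have Bx: "B x \<noteq> 0" using Hx pext(2)[OF B(1) x] unfolding H_def by simp
    have \<delta>x: "\<delta> E x \<noteq> 0" if "finite E" for E
      using Hx that pext(2)[OF \<delta>A(1)[OF that] x] unfolding H_def by auto
    let ?V = "Vset X Fs {x}"
    let ?S = "{z \<in> X. B z \<noteq> 0 \<and> (\<forall>j<M. a j x / B x = a j z / B z)}"
    have V: "zirred ?V" by (rule zirred_Vset[OF x])
    have "?S \<subseteq> ?V"
    proof
      fix z assume "z \<in> ?S"
      then have z: "z \<in> X" "B z \<noteq> 0" "\<forall>j<M. a j x / B x = a j z / B z" by auto
      note gz = mp[OF mp[OF mp[OF bspec[OF bspec[OF sep x] z(1)] Bx] z(2)] z(3)]
      have "q z = 0" if q: "q \<in> PI x" for q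
      proof -
        have "q \<in> polyfun" using q unfolding PI_def by blast
        from polyfun_explicit[OF this] obtain E f where E: "finite E" "q = (\<Sum>e\<in>E. (\<lambda>_. f e) * mo e)" by (elim exE conjE)
        have "kernel_at E f x" using q unfolding E(2) kernel_at_iff .
        from \<delta>[OF E(1) \<delta>x[OF E(1)] this gz] show ?thesis unfolding E(2) lincomb_mo_apply .
      qed
      then show "z \<in> ?V" unfolding Vset_eq_zeros zeros_def by blast
    qed
    moreover have "zclosed ?V" using V unfolding zirred_def by (elim conjE)
    ultimately have "zclosure ?S \<subseteq> ?V" by (intro zclosure_minimal)
    \<comment> \<open>\<open>h * B\<close> vanishes on the irreducible V(F,x), which contains
      \<open>x\<close>; since \<open>B\<close> is nonzero at \<open>x\<close>, the factor
      \<open>h\<close> has to vanish.\<close>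
    moreover have "?V \<subseteq> zclosure ?S"
    proof
      fix y assume y: "y \<in> ?V"
      have "h y = 0" if h: "h \<in> polyfun" "\<forall>z\<in>?S. h z = 0" for h
      proof -
        have "h y * pext B y = 0" if y: "y \<in> ?V" for y
        proof (cases "B y = 0")
          case False
          have yX: "y \<in> X" using y unfolding Vset_def by blast
          have "a j x / B x = a j y / B y" if j: "j < M" for j
            using con_constant_on_Vset[OF con[rule_format, OF j] x y] Bx False by (simp add: field_simps)
          then have "y \<in> ?S" using yX False by blast
          then show ?thesis using h(2) by simp
        next
          case True
          have "y \<in> X" using y unfolding Vset_def by blast
          then show ?thesis using True pext(2)[OF B(1)] by simp
        qed
        with zirred_no_zero_divisors[OF V h(1) pext(1)[OF B(1)]]
        have "(\<forall>y\<in>?V. h y = 0) \<or> (\<forall>y\<in>?V. pext B y = 0)" by blast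
        then show ?thesis using y point_in_Vset[OF x] Bx pext(2)[OF B(1) x] by auto
      qed
      then show "y \<in> zclosure ?S" unfolding zclosure_eq by blast
    qed
    ultimately show "B x \<noteq> 0 \<and> zclosure ?S = ?V" using Bx by blast
  qed
qed

text \<open>Independence makes the chosen fractions nonconstant, so they are genuine first
  integrals. Conversely every element of \<open>KF\<close> satisfies \<open>con\<close>, and
  \<open>transversal_bound\<close> limits independent families of such elements.\<close>

lemma has_trdeg_first_integrals:
  assumes B: "B \<in> A" "B \<noteq> 0" and con: "\<forall>j\<in>J. con (a j) B" and J: "finite J"
    and ind: "alg_independent_on {x \<in> X. B x \<noteq> 0} J (\<lambda>j x. a j x / B x)"
    and x0: "x0 \<in> X" and T: "alg_independent_on (Vset X Fs {x0}) T coord" and d: "zdim X \<le> card J + card T"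
  shows "has_trdeg X (KF X Fs) (card J)"
  unfolding has_trdeg_def
proof (intro conjI allI impI)
  let ?U = "{x \<in> X. B x \<noteq> 0}"
  obtain h where h: "bij_betw h {..<card J} J"
    using ex_bij_betw_nat_finite[OF J] unfolding atLeast0LessThan by blast
  have hJ: "h i \<in> J" if "i < card J" for i using h that unfolding bij_betw_def by auto
  define g where "g i = (a (h i), B)" for i
  have "g i \<in> KF X Fs" if i: "i < card J" for i unfolding g_def
  proof (rule con_imp_KF)
    show "con (a (h i)) B" using con hJ[OF i] by blast
    show "\<not> (\<exists>c. \<forall>x\<in>X. a (h i) x = c * B x)"
    proof
      assume "\<exists>c. \<forall>x\<in>X. a (h i) x = c * B x"
      then obtain c where "\<forall>x\<in>X. a (h i) x = c * B x" by blast
      then have "\<forall>x\<in>?U. a (h i) x / B x = c" by simp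
      with alg_independent_nonconstant[OF ind J hJ[OF i], of c] show False by blast
    qed
  qed
  moreover have "alg_indep X (card J) g" unfolding alg_indep_iff
  proof (intro conjI allI impI)
    fix i assume "i < card J"
    then show "ratfun X (g i)"
      using con_in(1)[OF bspec[OF con hJ]] B A_nonzero_point[OF B] unfolding ratfun_def g_def by simp
  next
    have "alg_independent_on ?U {..<card J} (\<lambda>i x. a (h i) x / B x)"
      by (rule alg_independent_reindex'[where z = "\<lambda>j x. a j x / B x"])
        (use h ind in \<open>auto simp: bij_betw_def\<close>)
    then have "alg_independent_on {x \<in> X. \<forall>i<card J. snd (g i) x \<noteq> 0} {..<card J} (\<lambda>i x. a (h i) x / B x)"
      by (rule alg_independent_on_mono) (auto simp: g_def)
    then show "alg_independent_on {x \<in> X. \<forall>i<card J. snd (g i) x \<noteq> 0} {..<card J}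
      (\<lambda>i x. fst (g i) x / snd (g i) x)" by (simp add: g_def)
  qed
  ultimately show "\<exists>g. (\<forall>i<card J. g i \<in> KF X Fs) \<and> alg_indep X (card J) g" by blast
next
  fix k g assume g: "(\<forall>i<k. g i \<in> KF X Fs) \<and> alg_indep X k g"
  then have con': "\<forall>i\<in>{..<k}. con (fst (g i)) (snd (g i))" using KF_imp_con by blast
  from con_common_denominator[OF finite_lessThan con'] obtain B' where B': "B' \<in> A" "B' \<noteq> 0"
    and B'z: "\<forall>x\<in>X. B' x \<noteq> 0 \<longleftrightarrow> (\<forall>i\<in>{..<k}. snd (g i) x \<noteq> 0)" by blast
  define U where "U = {x \<in> X. B' x \<noteq> 0}"
  have "U = {x \<in> X. \<forall>i<k. snd (g i) x \<noteq> 0}" unfolding U_def using B'z by auto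
  then have "alg_independent_on U {..<k} (\<lambda>i x. fst (g i) x / snd (g i) x)" using g unfolding alg_indep_iff by simp
  from transversal_bound[OF x0 T B' U_def finite_lessThan _ this] con' B'z
  have "card T + k \<le> zdim X" unfolding U_def by auto
  then show "k \<le> card J" using d by simp
qed

end

section \<open>The dominant map, its fibres and the transcendence degree\<close>

theorem theorem2:
  fixes X :: "('n::finite \<Rightarrow> complex) set"
    and Fs :: "((('n \<Rightarrow> complex) \<Rightarrow> complex) \<Rightarrow> (('n \<Rightarrow> complex) \<Rightarrow> complex)) set"
    and n p :: nat
  assumes "zirred X"
    and "zdim X = n"
    and "foliation X Fs"
    and "\<forall>x\<in>X. zdim (Vset X Fs {x}) \<le> p"
    and "\<exists>x\<in>X. zdim (Vset X Fs {x}) = p"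
  shows "(\<exists>(M::nat) (Y :: (nat \<Rightarrow> complex) set) (a :: nat \<Rightarrow> ('n \<Rightarrow> complex) \<Rightarrow> complex) b.
            zirred Y \<and> Y \<subseteq> {y. \<forall>i\<ge>M. y i = 0} \<and> zdim Y = n - p \<and>
            b \<in> polyfun \<and> (\<exists>x\<in>X. b x \<noteq> 0) \<and> (\<forall>i<M. a i \<in> polyfun) \<and>
            (let F = (\<lambda>x i. if i < M then a i x / b x else 0);
                 U = {x \<in> X. b x \<noteq> 0}
             in F ` U \<subseteq> Y \<and> zclosure (F ` U) = Y \<and>
                very_generic X (\<lambda>x. b x \<noteq> 0 \<and>
                   zclosure {z \<in> U. F z = F x} = Vset X Fs {x})))
         \<and> has_trdeg X (KF X Fs) (n - p)"
proof -
  interpret foliated X Fs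
    using assms(1,3) unfolding foliation_def by unfold_locales auto
  obtain x0 where x0: "x0 \<in> X" "zdim (Vset X Fs {x0}) = p" using assms(5) by blast
  from zdim_eq_independent(1)[OF zirred_Vset[OF x0(1)], of UNIV] obtain T where
    T: "alg_independent_on (Vset X Fs {x0}) T coord" "card T = p" using x0(2) by auto
  from exists_separating_first_integrals[OF assms(4)] show ?thesis
  proof (elim exE conjE, goal_cases)
    case (1 M B a' J)
    note B = 1(1,2) and con = 1(3) and sep = 1(4) and J = 1(5-7)
    \<comment> \<open>Applied to \<open>J\<close> this gives \<open>card J = n - p\<close>, and
      applied to an arbitrary \<open>J'\<close> the upper bound for \<open>zdim Y\<close>. The
      inequality \<open>p \<le> n\<close> comes from the same transversality.\<close>
    have bound: "card J' \<le> n - p" "p \<le> n"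
      if "J' \<subseteq> {..<M}" "alg_independent_on {x \<in> X. B x \<noteq> 0} J' (\<lambda>j x. a' j x / B x)" for J'
    proof -
      have J': "finite J'" using that(1) finite_subset by blast
      have "\<forall>j\<in>J'. con (a' j) B \<and> (\<forall>x\<in>{x \<in> X. B x \<noteq> 0}. B x \<noteq> 0)"
      proof
        fix j assume "j \<in> J'"
        then have "j < M" using that(1) by blast
        then show "con (a' j) B \<and> (\<forall>x\<in>{x \<in> X. B x \<noteq> 0}. B x \<noteq> 0)" using con by simp
      qed
      from transversal_bound[OF x0(1) T(1) B refl J' this that(2)]
      show "card J' \<le> n - p" "p \<le> n" using T(2) assms(2) by simp_all
    qed
    have cJ: "card J = n - p" using bound(1)[OF J(1,2)] J(3) assms(2) by simp
    define b where "b = pext B"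
    define a where "a j = pext (a' j)" for j
    \<comment> \<open>The number \<open>M\<close> of components is not known in advance, so the
      target lies in \<open>nat \<Rightarrow> complex\<close> with all coordinates from
      \<open>M\<close> on equal to 0; \<open>{..<M}\<close> is then the finite coordinate set
      required by the dimension theorem.\<close>
    define F where "F = (\<lambda>x i. if i < M then a i x / b x else 0)"
    define U where "U = {x \<in> X. b x \<noteq> 0}"
    define Y where "Y = zclosure (F ` U)"
    have bX: "b x = B x" if "x \<in> X" for x unfolding b_def by (rule pext(2)[OF B(1) that])
    have aX: "a j x = a' j x" if "x \<in> X" "j < M" for x j
      unfolding a_def by (rule pext(2)[OF con_in(1) that(1)]) (use con that in blast)
    have a: "\<forall>j<M. a j \<in> polyfun" using pext(1)[OF con_in(1)] con unfolding a_def by blast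
    have b: "b \<in> polyfun" "\<exists>x\<in>X. b x \<noteq> 0"
      using pext(1)[OF B(1)] A_nonzero_point[OF B] bX unfolding b_def[symmetric] by auto
    have UB: "U = {x \<in> X. B x \<noteq> 0}" unfolding U_def using bX by auto
    have Y: "zirred Y" unfolding Y_def by (rule zirred_image_closure[OF assms(1) a b F_def U_def])
    have off: "y i = 0" if y: "y \<in> Y" and i: "i \<ge> M" for y i
    proof -
      have "coord i v = 0" if "v \<in> F ` U" for v using that i by (auto simp: coord_def F_def)
      from zclosure_vanish[OF polyfun_coord this y[unfolded Y_def]] show ?thesis unfolding coord_def .
    qed
    have ind_iff: "alg_independent_on Y J' coord \<longleftrightarrow> alg_independent_on {x \<in> X. B x \<noteq> 0} J' (\<lambda>j x. a' j x / B x)"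
      if J': "J' \<subseteq> {..<M}" for J'
      unfolding Y_def alg_independent_zclosure_image[OF finite_subset[OF J' finite_lessThan]] UB[symmetric]
    proof (rule alg_independent_on_cong)
      fix j x assume "j \<in> J'" "x \<in> U"
      then show "F x j = a' j x / B x" using J' aX bX unfolding F_def U_def by auto
    qed
    have "zdim Y = n - p"
    proof (rule antisym)
      from zdim_eq_independent(1)[OF Y, of "{..<M}"] off obtain J' where
        "J' \<subseteq> {..<M}" "alg_independent_on Y J' coord" "card J' = zdim Y" by auto
      then show "zdim Y \<le> n - p" using bound(1)[of J'] ind_iff[of J'] by simp
      have "card J \<le> zdim Y"
        by (rule zdim_eq_independent(2)[OF Y, of "{..<M}"]) (use off J ind_iff finite_subset[OF J(1)] in auto)
      then show "n - p \<le> zdim Y" unfolding cJ .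
    qed
    moreover have "very_generic X (\<lambda>x. b x \<noteq> 0 \<and> zclosure {z \<in> U. F z = F x} = Vset X Fs {x})"
    proof (rule iffD1[OF very_generic_cong very_generic_fiber[OF B con sep]])
      fix x assume x: "x \<in> X"
      have "F z = F x \<longleftrightarrow> (\<forall>j<M. a' j x / B x = a' j z / B z)" if "z \<in> X" for z
        unfolding F_def fun_eq_iff using aX[OF x] aX[OF that] bX[OF x] bX[OF that] by auto
      then have "{z \<in> X. B z \<noteq> 0 \<and> (\<forall>j<M. a' j x / B x = a' j z / B z)} = {z \<in> U. F z = F x}"
        unfolding UB by blast
      then show "(B x \<noteq> 0 \<and> zclosure {z \<in> X. B z \<noteq> 0 \<and> (\<forall>j<M. a' j x / B x = a' j z / B z)} = Vset X Fs {x}) \<longleftrightarrow>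
        (b x \<noteq> 0 \<and> zclosure {z \<in> U. F z = F x} = Vset X Fs {x})" using bX[OF x] by simp
    qed
    moreover have "Y \<subseteq> {y. \<forall>i\<ge>M. y i = 0}" using off by blast
    moreover have "F ` U \<subseteq> Y" unfolding Y_def by (rule zclosure_superset)
    ultimately have map: "zirred Y \<and> Y \<subseteq> {y. \<forall>i\<ge>M. y i = 0} \<and> zdim Y = n - p \<and>
      b \<in> polyfun \<and> (\<exists>x\<in>X. b x \<noteq> 0) \<and> (\<forall>i<M. a i \<in> polyfun) \<and> F ` U \<subseteq> Y \<and> zclosure (F ` U) = Y \<and>
      very_generic X (\<lambda>x. b x \<noteq> 0 \<and> zclosure {z \<in> U. F z = F x} = Vset X Fs {x})"
      using Y a b Y_def by blast
    have "has_trdeg X (KF X Fs) (card J)"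
    proof (rule has_trdeg_first_integrals[OF B _ _ J(2) x0(1) T(1)])
      show "\<forall>j\<in>J. con (a' j) B" using con J(1) by blast
      show "finite J" by (rule finite_subset[OF J(1) finite_lessThan])
      show "zdim X \<le> card J + card T" using J(3) T(2) by simp
    qed
    moreover note map[unfolded F_def U_def]
    ultimately show ?thesis unfolding cJ Let_def by blast
  qed
qed

end
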